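(* Let $\{Z_t\}_{t\in\mathbb Z}$ be a strictly stationary real-valued process such that for every integer $k\ge 2$ $$\sum_{\ell_1,\dots,\ell_{k-1}=-\infty}^\infty\Bigl(1+\sum_{j=1}^{k-1}|\ell_j|\Bigr)\sup_{(u_1,\ldots,u_k)\in\mathbb R^k}\bigl|{\rm Cum}(e^{iu_1Z_{t+\ell_1}},\ldots,e^{iu_{k-1}Z_{t+\ell_{k-1}}},e^{iu_kZ_t})\bigr|<\infty ,$$ with generalized spectrum $f(\lambda;u,v)$. Let $L>0$ and let $\mathcal F=\{f_{\boldsymbol\theta}(\lambda;u,v):\boldsymbol\theta\in\boldsymbol\Theta\}$, $\boldsymbol\Theta\subset\mathbb R^d$, be a parametric family of generalized spectra such that: (a) $\boldsymbol\Theta$ is compact; (b) if $f_{\boldsymbol\theta}(\lambda;u,v)=f_{\boldsymbol\theta'}(\lambda;u,v)$ for all $\lambda\in[0,2\pi]$ and $(u,v)\in[-L,L]^2$, then $\boldsymbol\theta=\boldsymbol\theta'$; (c) $f_{\boldsymbol\theta}(\lambda;u,v)$ is UBPH$(\mathcal S,\tau,\alpha,\beta,\gamma)$ for some admissible set $\mathcal S$ and constants $\alpha,\beta,\gamma\in(0,1]$, $\tau\ge0$. Assume that $f$ is PH$(\mathcal S,\tilde\tau,\tilde\alpha,\tilde\beta)$, that $M_n\to\infty$ as $n\to\infty$, and that $\boldsymbol\theta\mapsto D(f,f_{\boldsymbol\theta})$ has a unique minimizer $\boldsymbol\theta_0$ over $\boldsymbol\Theta$. Let $\hat{\boldsymbol\theta}_n$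 be a minimizer of $\boldsymbol\theta\mapsto D_n(I_n,f_{\boldsymbol\theta})$ over $\boldsymbol\Theta$. Then $\hat{\boldsymbol\theta}_n$ converges in probability to $\boldsymbol\theta_0$ as $n\to\infty$.
   Context: ${\rm Cum}$ denotes the joint cumulant (no complex conjugation). The generalized spectrum of $\{Z_t\}$ is $$f(\lambda;u,v)=\frac1{2\pi}\sum_{\ell=-\infty}^\infty\bigl\{{\rm E}(e^{iuZ_{t+\ell}+ivZ_t})-{\rm E}(e^{iuZ_{t+\ell}}){\rm E}(e^{ivZ_t})\bigr\}e^{-i\ell\lambda},\quad \lambda\in\mathbb R,\ (u,v)\in\mathbb R^2.$$ Admissible set: a closed set $\mathcal S\subset[-L,L]^2$ such that $\mathcal S_\varepsilon=\{(u,v)\in[-L,L]^2:\inf_{(x,y)\in\mathcal S}\|(u,v)-(x,y)\|_2\le\varepsilon\}$ has Lebesgue measure $O(\varepsilon)$ as $\varepsilon\downarrow0$. UBPH$(\mathcal S,\tau,\alpha,\beta,\gamma)$: there is a constant $C'>0$ such that $|f_{\boldsymbol\theta}(\lambda;u,v)|\le C'$ for all $(\lambda,u,v,\boldsymbol\theta)\in[0,2\pi]\times[-L,L]^2\times\boldsymbol\Theta$ and, for every $\varepsilon>0$, all $(\lambda,u,v),(\lambda',u',v')\in[0,2\pi]\times([-L,L]^2\setminus\mathcal S_\varepsilon)$ and all $\boldsymbol\theta,\boldsymbol\theta'\in\boldsymbol\Theta$, $$|f_{\boldsymbol\theta}(\lambda;u,v)-f_{\boldsymbol\theta'}(\lambda';u',v')|\le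 C'\varepsilon^{-\tau}\bigl(|\lambda-\lambda'|^\alpha+\|(u,v)-(u',v')\|^\beta+\|\boldsymbol\theta-\boldsymbol\theta'\|^\gamma\bigr).$$ PH$(\mathcal S,\tilde\tau,\tilde\alpha,\tilde\beta)$ (with $\tilde\tau\ge0$, $\tilde\alpha,\tilde\beta\in(0,1]$): there is $C'>0$ such that for every $\varepsilon>0$ and all $(\lambda,u,v),(\lambda',u',v')\in[0,2\pi]\times([-L,L]^2\setminus\mathcal S_\varepsilon)$, $|f(\lambda;u,v)-f(\lambda';u',v')|\le C'\varepsilon^{-\tilde\tau}(|\lambda-\lambda'|^{\tilde\alpha}+\|(u,v)-(u',v')\|^{\tilde\beta})$. Divergence: $D(f,f_{\boldsymbol\theta})=\int_0^{2\pi}\int_{-L}^L\int_{-L}^L|f(\lambda;u,v)-f_{\boldsymbol\theta}(\lambda;u,v)|^2\,du\,dv\,d\lambda$. Empirical criterion: from observations $Z_1,\ldots,Z_n$, let $d_n(\lambda;u)=\sum_{t=1}^ne^{iuZ_t}e^{-it\lambda}$, $I_n(\lambda;u,v)=\frac1{2\pi n}d_n(\lambda;u)d_n(-\lambda;v)$, and, with $(M_n)$ a sequence of positive integers, $\lambda_j=2\pi j/n$, $u_{i}=v_i=-L+2Li/M_n$, $$D_n(I_n,f_{\boldsymbol\theta})=\frac{8\pi L^2}{nM_n^2}\sum_{j=1}^{n-1}\sum_{i_1,i_2=1}^{M_n}|I_n(\lambda_j;u_{i_1},v_{i_2})-f_{\boldsymbol\theta}(\lambda_j;u_{i_1},v_{i_2})|^2.$$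 *)

theory Defs
  imports
    "HOL-Probability.Probability"
    "HOL-Library.Disjoint_Sets"
    "HOL-Library.Landau_Symbols"
begin

section \<open>Processes, cumulants and the generalized spectrum\<close>

definition strictly_stationary :: "'a measure \<Rightarrow> (int \<Rightarrow> 'a \<Rightarrow> real) \<Rightarrow> bool" where
  "strictly_stationary P Z \<longleftrightarrow>
     (\<forall>t. Z t \<in> borel_measurable P) \<and>
     (\<forall>J h. finite J \<longrightarrow>
        distr P (Pi\<^sub>M J (\<lambda>_. borel)) (\<lambda>\<omega>. \<lambda>t\<in>J. Z (t + h) \<omega>) =
        distr P (Pi\<^sub>M J (\<lambda>_. borel)) (\<lambda>\<omega>. \<lambda>t\<in>J. Z t \<omega>))"

text \<open>
  The joint cumulant of the complex variables \<open>X i\<close>, \<open>i \<in> I\<close>, through the partition (Leonov--Shiryaev)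
  formula, without complex conjugation.
\<close>

definition joint_cumulant :: "'a measure \<Rightarrow> ('i \<Rightarrow> 'a \<Rightarrow> complex) \<Rightarrow> 'i set \<Rightarrow> complex" where
  "joint_cumulant P X I =
     (\<Sum>\<pi> | partition_on I \<pi>. (- 1) ^ (card \<pi> - 1) * fact (card \<pi> - 1) *
        (\<Prod>B\<in>\<pi>. \<integral>\<omega>. (\<Prod>i\<in>B. X i \<omega>) \<partial>P))"

text \<open>
  For stationary processes the time origin \<open>t\<close> is immaterial; below it is always \<open>t = 0\<close>.
  The sum and the supremum are taken in \<open>[0, \<infinity>]\<close>. The lags \<open>l 1, \<dots>, l (k - 1)\<close> are completed
  by \<open>l k = 0\<close>; only \<open>u 1, \<dots>, u k\<close> matter. Frequencies are written \<open>w\<close>.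
\<close>

definition summable_exp_cumulants :: "'a measure \<Rightarrow> (int \<Rightarrow> 'a \<Rightarrow> real) \<Rightarrow> bool" where
  "summable_exp_cumulants P Z \<longleftrightarrow>
     (\<forall>k\<ge>2. (\<Sum>\<^sub>\<infinity>l \<in> {1..k - 1} \<rightarrow>\<^sub>E (UNIV :: int set).
          ennreal (1 + (\<Sum>j = 1..k - 1. \<bar>real_of_int (l j)\<bar>)) *
          (SUP u :: nat \<Rightarrow> real. ennreal (cmod
             (joint_cumulant P (\<lambda>j \<omega>. iexp (u j * Z ((l(k := 0)) j) \<omega>)) {1..k})))) < \<infinity>)"

definition gen_cov :: "'a measure \<Rightarrow> (int \<Rightarrow> 'a \<Rightarrow> real) \<Rightarrow> int \<Rightarrow> real \<Rightarrow> real \<Rightarrow> complex" where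
  "gen_cov P Z l u v =
     (\<integral>\<omega>. iexp (u * Z l \<omega> + v * Z 0 \<omega>) \<partial>P) -
     (\<integral>\<omega>. iexp (u * Z l \<omega>) \<partial>P) * (\<integral>\<omega>. iexp (v * Z 0 \<omega>) \<partial>P)"

definition gen_spectrum ::
    "'a measure \<Rightarrow> (int \<Rightarrow> 'a \<Rightarrow> real) \<Rightarrow> real \<Rightarrow> real \<Rightarrow> real \<Rightarrow> complex" where
  "gen_spectrum P Z w u v =
     1 / (2 * pi) * (\<Sum>\<^sub>\<infinity>l \<in> UNIV. gen_cov P Z l u v * iexp (- (real_of_int l * w)))"

text \<open>
  Every real-valued process indexed by the integers has the same law as one on the path space
  \<open>int \<Rightarrow> real\<close>, so quantifying over measures on that type loses no process. Summability says that the
  defining series of the spectrum converges.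
\<close>

definition is_gen_spectrum :: "(real \<Rightarrow> real \<Rightarrow> real \<Rightarrow> complex) \<Rightarrow> bool" where
  "is_gen_spectrum g \<longleftrightarrow>
     (\<exists>(Q :: (int \<Rightarrow> real) measure) X. prob_space Q \<and> strictly_stationary Q X \<and>
        (\<forall>u v. (\<lambda>l. gen_cov Q X l u v) summable_on UNIV) \<and> g = gen_spectrum Q X)"


section \<open>Admissible sets and piecewise Hoelder conditions\<close>

text \<open>
  The infimum is taken in the extended reals, so that it is \<open>\<infinity>\<close> (and the neighbourhood is empty)
  when \<open>S = {}\<close>; the library function \<open>infdist\<close> would return \<open>0\<close> there.
\<close>

definition S_nbhd :: "real \<Rightarrow> (real \<times> real) set \<Rightarrow> real \<Rightarrow> (real \<times> real) set" where
  "S_nbhd L S \<epsilon> = {p \<in> {-L..L} \<times> {-L..L}. (INF q\<in>S. ereal (dist p q)) \<le> ereal \<epsilon>}"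

definition admissible_set :: "real \<Rightarrow> (real \<times> real) set \<Rightarrow> bool" where
  "admissible_set L S \<longleftrightarrow> closed S \<and> S \<subseteq> {-L..L} \<times> {-L..L} \<and>
     (\<lambda>\<epsilon>. measure lborel (S_nbhd L S \<epsilon>)) \<in> O[at_right 0](\<lambda>\<epsilon>. \<epsilon>)"

definition UBPH ::
    "real \<Rightarrow> ('p::real_normed_vector) set \<Rightarrow> ('p \<Rightarrow> real \<Rightarrow> real \<Rightarrow> real \<Rightarrow> complex) \<Rightarrow>
     (real \<times> real) set \<Rightarrow> real \<Rightarrow> real \<Rightarrow> real \<Rightarrow> real \<Rightarrow> bool" where
  "UBPH L \<Theta> F S \<tau> \<alpha> \<beta> \<gamma> \<longleftrightarrow> (\<exists>C>0.
     (\<forall>\<theta>\<in>\<Theta>. \<forall>w\<in>{0..2 * pi}. \<forall>u\<in>{-L..L}. \<forall>v\<in>{-L..L}. cmod (F \<theta> w u v) \<le> C) \<and>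
     (\<forall>\<epsilon>>0. \<forall>\<theta>\<in>\<Theta>. \<forall>\<theta>'\<in>\<Theta>. \<forall>w\<in>{0..2 * pi}. \<forall>w'\<in>{0..2 * pi}.
        \<forall>(u, v) \<in> {-L..L} \<times> {-L..L} - S_nbhd L S \<epsilon>.
        \<forall>(u', v') \<in> {-L..L} \<times> {-L..L} - S_nbhd L S \<epsilon>.
          cmod (F \<theta> w u v - F \<theta>' w' u' v') \<le>
            C * \<epsilon> powr (- \<tau>) *
              (\<bar>w - w'\<bar> powr \<alpha> + norm ((u, v) - (u', v')) powr \<beta> + norm (\<theta> - \<theta>') powr \<gamma>)))"

definition PH ::
    "real \<Rightarrow> (real \<Rightarrow> real \<Rightarrow> real \<Rightarrow> complex) \<Rightarrow> (real \<times> real) set \<Rightarrow>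
     real \<Rightarrow> real \<Rightarrow> real \<Rightarrow> bool" where
  "PH L g S \<tau> \<alpha> \<beta> \<longleftrightarrow> (\<exists>C>0.
     \<forall>\<epsilon>>0. \<forall>w\<in>{0..2 * pi}. \<forall>w'\<in>{0..2 * pi}.
        \<forall>(u, v) \<in> {-L..L} \<times> {-L..L} - S_nbhd L S \<epsilon>.
        \<forall>(u', v') \<in> {-L..L} \<times> {-L..L} - S_nbhd L S \<epsilon>.
          cmod (g w u v - g w' u' v') \<le>
            C * \<epsilon> powr (- \<tau>) * (\<bar>w - w'\<bar> powr \<alpha> + norm ((u, v) - (u', v')) powr \<beta>))"


section \<open>Divergence and empirical criterion\<close>

definition divergence ::
    "real \<Rightarrow> (real \<Rightarrow> real \<Rightarrow> real \<Rightarrow> complex) \<Rightarrow> (real \<Rightarrow> real \<Rightarrow> real \<Rightarrow> complex) \<Rightarrow> real" where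
  "divergence L f g =
     (LINT w:{0..2 * pi}|lborel. LINT v:{-L..L}|lborel. LINT u:{-L..L}|lborel.
        (cmod (f w u v - g w u v))\<^sup>2)"

definition dft_exp :: "(int \<Rightarrow> 'a \<Rightarrow> real) \<Rightarrow> nat \<Rightarrow> real \<Rightarrow> real \<Rightarrow> 'a \<Rightarrow> complex" where
  "dft_exp Z n w u \<omega> =
     (\<Sum>t = 1..n. iexp (u * Z (int t) \<omega>) * iexp (- (real t * w)))"

definition periodogram :: "(int \<Rightarrow> 'a \<Rightarrow> real) \<Rightarrow> nat \<Rightarrow> 'a \<Rightarrow> real \<Rightarrow> real \<Rightarrow> real \<Rightarrow> complex" where
  "periodogram Z n \<omega> w u v = 1 / (2 * pi * real n) * dft_exp Z n w u \<omega> * dft_exp Z n (- w) v \<omega>"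

definition fourier_freq :: "nat \<Rightarrow> nat \<Rightarrow> real" where
  "fourier_freq n j = 2 * pi * real j / real n"

definition grid_point :: "real \<Rightarrow> nat \<Rightarrow> nat \<Rightarrow> real" where
  "grid_point L m i = - L + 2 * L * real i / real m"

definition emp_divergence ::
    "real \<Rightarrow> nat \<Rightarrow> nat \<Rightarrow> (real \<Rightarrow> real \<Rightarrow> real \<Rightarrow> complex) \<Rightarrow>
     (real \<Rightarrow> real \<Rightarrow> real \<Rightarrow> complex) \<Rightarrow> real" where
  "emp_divergence L m n I g =
     8 * pi * L\<^sup>2 / (real n * (real m)\<^sup>2) *
       (\<Sum>j = 1..n - 1. \<Sum>i1 = 1..m. \<Sum>i2 = 1..m.
          (cmod (I (fourier_freq n j) (grid_point L m i1) (grid_point L m i2)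
               - g (fourier_freq n j) (grid_point L m i1) (grid_point L m i2)))\<^sup>2)"

definition converges_in_probability ::
    "'a measure \<Rightarrow> (nat \<Rightarrow> 'a \<Rightarrow> 'b::metric_space) \<Rightarrow> 'b \<Rightarrow> bool" where
  "converges_in_probability P X c \<longleftrightarrow>
     (\<forall>\<epsilon>>0. (\<lambda>n. measure P {\<omega> \<in> space P. dist (X n \<omega>) c > \<epsilon>}) \<longlonglongrightarrow> 0)"

end

theory Submission
  imports Defs
begin

text \<open>
  The criterion \<open>D\<^sub>n(I\<^sub>n, f\<^sub>\<theta>)\<close> does not approach \<open>D(f, f\<^sub>\<theta>)\<close>, because periodogram ordinates do not converge
  to the spectrum. The identity
  \<open>|I - f\<^sub>\<theta>|\<^sup>2 = |I - f|\<^sup>2 + |f - f\<^sub>\<theta>|\<^sup>2 + 2 Re ((I - f) cnj (f - f\<^sub>\<theta>))\<close>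
  shows what is left to do: its first term does not depend on \<open>\<theta>\<close>, hence the estimator also minimises the
  contrast consisting of the Riemann sum of \<open>|f - f\<^sub>\<theta>|\<^sup>2\<close> and of twice the averaged error
  \<open>Re ((I - f) cnj (f - f\<^sub>\<theta>))\<close>. The contrast is shown to converge to \<open>D(f, f\<^sub>\<theta>)\<close> in probability, uniformly
  enough in \<open>\<theta>\<close> for its minimisers to follow (\<open>argmin_consistent\<close>).

  The averaged error is small in mean square because periodogram errors are nearly uncorrelated
  (\<open>periodogram_error_covariance\<close>). At the frequencies \<open>2\<pi>j/n\<close>, \<open>0 < j < n\<close>, the Fourier transform of a
  constant vanishes, so the exponentials may be centred at no cost. The expectation of a product of four
  centred variables is their fourth cumulant plus three products of covariances
  (\<open>central_moment4_eq_cumulants\<close>). Summability of the cumulants bounds the sum of the fourth cumulants by a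
  multiple of \<open>n\<close>, and makes the covariance of two Fourier transforms bounded unless their frequencies
  cancel modulo \<open>2\<pi>\<close> (\<open>toeplitz_sum_approx\<close>), in which case it is of order \<open>n\<close>. After division by \<open>n\<^sup>2\<close>,
  errors at the frequencies with indices \<open>j\<close> and \<open>k\<close> have covariance of order \<open>1/n\<close>, except on the two
  diagonals \<open>j = k\<close> and \<open>j + k = n\<close>; averaging over all \<open>j\<close> and \<open>k\<close> gives a second moment of order \<open>1/n\<close>.

  The Riemann sums converge by dominated convergence (\<open>grid_sum_tendsto\<close>): the piecewise Hoelder conditions
  make \<open>f\<close> and \<open>f\<^sub>\<theta>\<close> continuous away from the exceptional set \<open>S\<close>, which is a null set because its
  \<open>\<epsilon>\<close>-neighbourhoods have measure \<open>O(\<epsilon>)\<close>. Members of the family are measurable since they are generalized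
  spectra, hence pointwise limits of trigonometric sums.

  The oscillation of the contrast over pairs \<open>\<theta>, \<eta>\<close> of close parameters is dominated by
  \<open>(2|I - f| + 2B) h\<close> averaged over the grid, where \<open>h\<close> is a deterministic bound for \<open>|f\<^sub>\<theta> - f\<^sub>\<eta>|\<close>: a constant on a small neighbourhood of \<open>S\<close>, and
  the Hoelder bound outside. The average of \<open>h\<close> can be made arbitrarily small (\<open>UBPH_grid_modulus\<close>) and
  \<open>|I - f|\<close> has bounded expectation, so Markov's inequality finishes the argument.
\<close>


section \<open>Fourth central moments and cumulants\<close>

text \<open>
  A partition of \<open>insert a A\<close> is determined by the block containing \<open>a\<close> and by a partition of the remaining
  elements. Splitting by that block, rather than inserting \<open>a\<close> into a partition of \<open>A\<close>, reduces sums over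
  partitions of explicit finite sets to sums over power sets, which the simplifier evaluates.
\<close>

lemma sum_partitions_insert:
  fixes g :: "'i set set \<Rightarrow> 'b::comm_monoid_add"
  assumes "finite A" and "a \<notin> A"
  shows "(\<Sum>\<pi> | partition_on (insert a A) \<pi>. g \<pi>) =
    (\<Sum>B\<in>Pow A. \<Sum>\<rho> | partition_on (A - B) \<rho>. g (insert (insert a B) \<rho>))"
proof -
  let ?D = "Sigma (Pow A) (\<lambda>B. {\<rho>. partition_on (A - B) \<rho>})"
  let ?h = "\<lambda>(B, \<rho>). insert (insert a B) \<rho>"
  have fin: "finite {\<rho>. partition_on (A - B) \<rho>}" for B
    using finitely_many_partition_on[of "A - B"] assms by simp
  have nin: "insert a B' \<notin> \<rho>" "a \<notin> C" if "partition_on (A - B) \<rho>" "C \<in> \<rho>" for B B' \<rho> C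
    using that assms unfolding partition_on_def by auto
  have bij: "bij_betw ?h ?D {\<pi>. partition_on (insert a A) \<pi>}"
  proof (rule bij_betw_byWitness[where f' = "\<lambda>\<pi>. ((THE C. C \<in> \<pi> \<and> a \<in> C) - {a}, \<pi> - {THE C. C \<in> \<pi> \<and> a \<in> C})"])
    have the: "(THE C. C \<in> insert (insert a B) \<rho> \<and> a \<in> C) = insert a B"
      if "B \<subseteq> A" "partition_on (A - B) \<rho>" for B \<rho>
      using nin(2)[OF that(2)] by (intro the_equality) auto
    have notin: "insert a B \<notin> \<rho>" if "B \<subseteq> A" "partition_on (A - B) \<rho>" for B \<rho>
      using nin(2)[OF that(2)] by auto
    show "\<forall>p\<in>?D. ((THE C. C \<in> ?h p \<and> a \<in> C) - {a}, ?h p - {THE C. C \<in> ?h p \<and> a \<in> C}) = p"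
      using the notin assms by (auto simp: insert_Diff_if)
    have ex: "\<exists>C. C \<in> \<pi> \<and> a \<in> C \<and> (THE C. C \<in> \<pi> \<and> a \<in> C) = C"
      if "partition_on (insert a A) \<pi>" for \<pi>
    proof -
      have "a \<in> \<Union>\<pi>" using that unfolding partition_on_def by auto
      then obtain C where "C \<in> \<pi>" "a \<in> C" by auto
      moreover have "(THE C. C \<in> \<pi> \<and> a \<in> C) = C"
        using that calculation unfolding partition_on_def disjoint_def by (intro the_equality) auto
      ultimately show ?thesis by auto
    qed
    show "\<forall>\<pi>\<in>{\<pi>. partition_on (insert a A) \<pi>}.
        ?h ((THE C. C \<in> \<pi> \<and> a \<in> C) - {a}, \<pi> - {THE C. C \<in> \<pi> \<and> a \<in> C}) = \<pi>"
    proof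
      fix \<pi> assume "\<pi> \<in> {\<pi>. partition_on (insert a A) \<pi>}"
      then obtain C where "C \<in> \<pi>" "a \<in> C" "(THE C. C \<in> \<pi> \<and> a \<in> C) = C" using ex by blast
      then show "?h ((THE C. C \<in> \<pi> \<and> a \<in> C) - {a}, \<pi> - {THE C. C \<in> \<pi> \<and> a \<in> C}) = \<pi>"
        by (auto simp: insert_absorb)
    qed
    show "?h ` ?D \<subseteq> {\<pi>. partition_on (insert a A) \<pi>}"
    proof clarsimp
      fix B \<rho> assume *: "B \<subseteq> A" "partition_on (A - B) \<rho>"
      have "disjnt (insert a B) (\<Union>\<rho>)"
        using * assms unfolding partition_on_def disjnt_def by auto
      moreover have "insert a A - insert a B = A - B" using assms by auto
      ultimately show "partition_on (insert a A) (insert (insert a B) \<rho>)"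
        using * by (subst partition_on_insert) auto
    qed
    show "(\<lambda>\<pi>. ((THE C. C \<in> \<pi> \<and> a \<in> C) - {a}, \<pi> - {THE C. C \<in> \<pi> \<and> a \<in> C})) `
        {\<pi>. partition_on (insert a A) \<pi>} \<subseteq> ?D"
    proof clarsimp
      fix \<pi> assume p: "partition_on (insert a A) \<pi>"
      then obtain C where C: "C \<in> \<pi>" "a \<in> C" "(THE C. C \<in> \<pi> \<and> a \<in> C) = C" using ex by blast
      have "C \<subseteq> insert a A" using C p unfolding partition_on_def by auto
      have dj: "disjnt C (\<Union>(\<pi> - {C}))"
        using p C unfolding partition_on_def disjnt_def disjoint_def by auto
      have "insert C (\<pi> - {C}) = \<pi>" using C by auto
      then have "partition_on (insert a A - C) (\<pi> - {C})"
        using partition_on_insert[OF dj, of "insert a A"] p by simp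
      moreover have "insert a A - C = A - (C - {a})" using C assms by auto
      ultimately show "(THE C. C \<in> \<pi> \<and> a \<in> C) - {a} \<subseteq> A \<and>
          partition_on (A - ((THE C. C \<in> \<pi> \<and> a \<in> C) - {a})) (\<pi> - {THE C. C \<in> \<pi> \<and> a \<in> C})"
        using C \<open>C \<subseteq> insert a A\<close> by auto
    qed
  qed
  have "(\<Sum>\<pi> | partition_on (insert a A) \<pi>. g \<pi>) = (\<Sum>p\<in>?D. g (?h p))"
    by (rule sum.reindex_bij_betw[OF bij, symmetric])
  also have "\<dots> = (\<Sum>B\<in>Pow A. \<Sum>\<rho> | partition_on (A - B) \<rho>. g (insert (insert a B) \<rho>))"
    using assms fin by (subst sum.Sigma) (auto simp: split_def)
  finally show ?thesis .
qed

text \<open>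
  The Leonov--Shiryaev sum with moments \<open>m\<close> and arbitrary coefficients \<open>c\<close>. Leaving \<open>c\<close> free makes the
  recursion of \<open>partition_sum_insert\<close> possible: detaching one block shifts \<open>c\<close> by one.
\<close>

definition partition_sum :: "(nat \<Rightarrow> complex) \<Rightarrow> ('i set \<Rightarrow> complex) \<Rightarrow> 'i set \<Rightarrow> complex" where
  "partition_sum c m A = (\<Sum>\<pi> | partition_on A \<pi>. c (card \<pi>) * (\<Prod>B\<in>\<pi>. m B))"

lemma partition_sum_empty: "partition_sum c m {} = c 0"
proof -
  have "{\<pi>. partition_on {} \<pi>} = {{} :: 'a set set}" by (auto simp: partition_on_def)
  then show ?thesis by (simp add: partition_sum_def)
qed

lemma partition_sum_insert:
  assumes "finite A" and "a \<notin> A"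
  shows "partition_sum c m (insert a A) =
    (\<Sum>B\<in>Pow A. m (insert a B) * partition_sum (\<lambda>k. c (Suc k)) m (A - B))"
  unfolding partition_sum_def sum_partitions_insert[OF assms] sum_distrib_left
proof (intro sum.cong refl)
  fix B \<rho> assume *: "B \<in> Pow A" "\<rho> \<in> {\<rho>. partition_on (A - B) \<rho>}"
  then have "insert a B \<notin> \<rho>" using assms unfolding partition_on_def by auto
  moreover have "finite \<rho>" using * assms finite_elements[of "A - B" \<rho>] by auto
  ultimately show "c (card (insert (insert a B) \<rho>)) * (\<Prod>C\<in>insert (insert a B) \<rho>. m C) =
      m (insert a B) * (c (Suc (card \<rho>)) * (\<Prod>C\<in>\<rho>. m C))"
    by simp
qed

lemma sum_Pow_insert:
  fixes g :: "'i set \<Rightarrow> 'b::comm_monoid_add"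
  assumes "finite A" and "a \<notin> A"
  shows "(\<Sum>B\<in>Pow (insert a A). g B) = (\<Sum>B\<in>Pow A. g B) + (\<Sum>B\<in>Pow A. g (insert a B))"
proof -
  have "inj_on (insert a) (Pow A)" using assms by (auto simp: inj_on_def)
  moreover have "Pow A \<inter> insert a ` Pow A = {}" using assms by auto
  ultimately show ?thesis
    using assms by (simp add: Pow_insert sum.union_disjoint sum.reindex o_def)
qed

lemma joint_cumulant_partition_sum:
  "joint_cumulant P X I = partition_sum (\<lambda>k. (- 1) ^ (k - 1) * fact (k - 1))
     (\<lambda>B. \<integral>\<omega>. (\<Prod>i\<in>B. X i \<omega>) \<partial>P) I"
  unfolding joint_cumulant_def partition_sum_def ..

lemma partition_sum1: "partition_sum c m {a} = c 1 * m {a}"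
  by (simp add: partition_sum_insert partition_sum_empty)

lemma partition_sum2:
  assumes "a \<noteq> b"
  shows "partition_sum c m {a, b} = c 1 * m {a, b} + c 2 * m {a} * m {b}"
  using assms
  by (simp add: partition_sum_insert partition_sum_empty sum_Pow_insert insert_Diff_if
      algebra_simps numeral_2_eq_2)

lemma partition_sum4:
  assumes "distinct [a, b, c, d]"
  shows "partition_sum k m {a, b, c, d} = k 1 * m {a, b, c, d}
    + k 2 * (m {a} * m {b, c, d} + m {b} * m {a, c, d} + m {c} * m {a, b, d} + m {d} * m {a, b, c}
       + m {a, b} * m {c, d} + m {a, c} * m {b, d} + m {a, d} * m {b, c})
    + k 3 * (m {a, b} * m {c} * m {d} + m {a, c} * m {b} * m {d} + m {a, d} * m {b} * m {c}
       + m {b, c} * m {a} * m {d} + m {b, d} * m {a} * m {c} + m {c, d} * m {a} * m {b})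
    + k 4 * (m {a} * m {b} * m {c} * m {d})"
proof -
  have n: "a \<noteq> b" "a \<noteq> c" "a \<noteq> d" "b \<noteq> c" "b \<noteq> d" "c \<noteq> d"
    "b \<noteq> a" "c \<noteq> a" "d \<noteq> a" "c \<noteq> b" "d \<noteq> b" "d \<noteq> c"
    using assms by auto
  have p3: "partition_sum k m {b, c, d} = k 1 * m {b, c, d}
      + k 2 * (m {b} * m {c, d} + m {c} * m {b, d} + m {d} * m {b, c}) + k 3 * (m {b} * m {c} * m {d})" for k
    using n by (simp add: partition_sum_insert[of _ b] partition_sum1 partition_sum2 partition_sum_empty
        sum_Pow_insert insert_Diff_if algebra_simps numeral_2_eq_2 numeral_3_eq_3)
  show ?thesis
    using n by (simp add: partition_sum_insert[of _ a] p3 partition_sum1 partition_sum2 partition_sum_empty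
        sum_Pow_insert insert_Diff_if algebra_simps numeral_2_eq_2 numeral_3_eq_3 numeral_eq_Suc)
qed

text \<open>
  Cumulants of order at least two ignore constants and the first cumulants of centred variables vanish, so
  only the four-element block and the three pairings survive in the moment-cumulant formula. Both sides are
  expanded here into uncentred moments, where the identity is polynomial.
\<close>

lemma (in prob_space) central_moment4_eq_cumulants:
  fixes X :: "'i \<Rightarrow> 'a \<Rightarrow> complex"
  assumes d: "distinct [a, b, c, d]"
    and meas: "\<And>i. X i \<in> borel_measurable M" and bnd: "\<And>i \<omega>. cmod (X i \<omega>) \<le> 1"
  defines "m \<equiv> \<lambda>i. \<integral>\<omega>. X i \<omega> \<partial>M"
    and "cov \<equiv> \<lambda>i j. (\<integral>\<omega>. X i \<omega> * X j \<omega> \<partial>M) - (\<integral>\<omega>. X i \<omega> \<partial>M) * (\<integral>\<omega>. X j \<omega> \<partial>M)"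
  shows "(\<integral>\<omega>. (X a \<omega> - m a) * (X b \<omega> - m b) * (X c \<omega> - m c) * (X d \<omega> - m d) \<partial>M) =
    joint_cumulant M X {a, b, c, d} + cov a b * cov c d + cov a c * cov b d + cov a d * cov b c"
proof -
  have int: "integrable M f" if "f \<in> borel_measurable M" "\<And>\<omega>. cmod (f \<omega>) \<le> 1" for f :: "'a \<Rightarrow> complex"
    using that by (intro integrable_const_bound[where B = 1]) auto
  note [measurable] = meas
  have i1[simp]: "integrable M (X i)" for i by (rule int) (use bnd in auto)
  have i2[simp]: "integrable M (\<lambda>\<omega>. X i \<omega> * X j \<omega>)" for i j
    by (rule int) (auto simp: norm_mult intro!: mult_le_one bnd)
  have i3[simp]: "integrable M (\<lambda>\<omega>. X i \<omega> * (X j \<omega> * X k \<omega>))" for i j k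
    by (rule int) (auto simp: norm_mult intro!: mult_le_one bnd)
  have i4[simp]: "integrable M (\<lambda>\<omega>. X i \<omega> * (X j \<omega> * (X k \<omega> * X l \<omega>)))" for i j k l
    by (rule int) (auto simp: norm_mult intro!: mult_le_one bnd)
  let ?e2 = "\<lambda>i j. \<integral>\<omega>. X i \<omega> * X j \<omega> \<partial>M"
  let ?e3 = "\<lambda>i j k. \<integral>\<omega>. X i \<omega> * (X j \<omega> * X k \<omega>) \<partial>M"
  let ?e4 = "\<integral>\<omega>. X a \<omega> * (X b \<omega> * (X c \<omega> * X d \<omega>)) \<partial>M"
  have expand: "(X a \<omega> - m a) * (X b \<omega> - m b) * (X c \<omega> - m c) * (X d \<omega> - m d) =
     X a \<omega> * (X b \<omega> * (X c \<omega> * X d \<omega>))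
     - m a * (X b \<omega> * (X c \<omega> * X d \<omega>)) - m b * (X a \<omega> * (X c \<omega> * X d \<omega>))
     - m c * (X a \<omega> * (X b \<omega> * X d \<omega>)) - m d * (X a \<omega> * (X b \<omega> * X c \<omega>))
     + (m a * m b) * (X c \<omega> * X d \<omega>) + (m a * m c) * (X b \<omega> * X d \<omega>) + (m a * m d) * (X b \<omega> * X c \<omega>)
     + (m b * m c) * (X a \<omega> * X d \<omega>) + (m b * m d) * (X a \<omega> * X c \<omega>) + (m c * m d) * (X a \<omega> * X b \<omega>)
     - (m b * m c * m d) * X a \<omega> - (m a * m c * m d) * X b \<omega> - (m a * m b * m d) * X c \<omega>
     - (m a * m b * m c) * X d \<omega> + m a * m b * m c * m d" for \<omega>
    by (simp add: algebra_simps)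
  have e1: "(\<integral>\<omega>. (X a \<omega> - m a) * (X b \<omega> - m b) * (X c \<omega> - m c) * (X d \<omega> - m d) \<partial>M) =
     ?e4
     - m a * ?e3 b c d - m b * ?e3 a c d
     - m c * ?e3 a b d - m d * ?e3 a b c
     + (m a * m b) * ?e2 c d + (m a * m c) * ?e2 b d + (m a * m d) * ?e2 b c
     + (m b * m c) * ?e2 a d + (m b * m d) * ?e2 a c + (m c * m d) * ?e2 a b
     - (m b * m c * m d) * m a - (m a * m c * m d) * m b - (m a * m b * m d) * m c
     - (m a * m b * m c) * m d + m a * m b * m c * m d"
    unfolding expand by (simp add: m_def prob_space)
  have e2: "joint_cumulant M X {a, b, c, d} = ?e4
    - (m a * ?e3 b c d + m b * ?e3 a c d + m c * ?e3 a b d + m d * ?e3 a b c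
       + ?e2 a b * ?e2 c d + ?e2 a c * ?e2 b d + ?e2 a d * ?e2 b c)
    + 2 * (?e2 a b * m c * m d + ?e2 a c * m b * m d + ?e2 a d * m b * m c
       + ?e2 b c * m a * m d + ?e2 b d * m a * m c + ?e2 c d * m a * m b)
    - 6 * (m a * m b * m c * m d)"
    unfolding joint_cumulant_partition_sum partition_sum4[OF d]
    using d by (simp add: m_def fact_numeral)
  have e3: "cov i j = ?e2 i j - m i * m j" for i j by (simp add: cov_def m_def)
  show ?thesis unfolding e1 e2 e3 by (simp add: algebra_simps)
qed

section \<open>Toeplitz sums and sums over Fourier frequencies\<close>

text \<open>
  The inner sum runs over the lags \<open>1 - s, \<dots>, n - s\<close> instead of all integers. A lag \<open>l\<close> is missing for those
  \<open>s \<in> {1..n}\<close> with \<open>l + s \<notin> {1..n}\<close>; there are at most \<open>|l|\<close> of them, so replacing every inner sum by the full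
  series costs at most the sum of \<open>|l| |g l|\<close>, whatever \<open>n\<close> is.
\<close>

lemma toeplitz_sum_approx:
  fixes g c :: "int \<Rightarrow> complex" and n :: int
  assumes S: "\<And>A. finite A \<Longrightarrow> (\<Sum>l\<in>A. (1 + \<bar>real_of_int l\<bar>) * cmod (g l)) \<le> S"
    and c: "\<And>s. cmod (c s) \<le> 1"
  shows "cmod ((\<Sum>s\<in>{1..n}. c s * (\<Sum>t\<in>{1..n}. g (t - s))) - (\<Sum>s\<in>{1..n}. c s) * (\<Sum>\<^sub>\<infinity>l. g l)) \<le> S"
proof -
  have fin: "(\<Sum>l\<in>A. cmod (g l)) \<le> S" "(\<Sum>l\<in>A. \<bar>real_of_int l\<bar> * cmod (g l)) \<le> S" if "finite A" for A
  proof -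
    have "(\<Sum>l\<in>A. cmod (g l)) \<le> (\<Sum>l\<in>A. (1 + \<bar>real_of_int l\<bar>) * cmod (g l))"
      by (intro sum_mono) (simp add: distrib_right)
    then show "(\<Sum>l\<in>A. cmod (g l)) \<le> S" using S[OF that] by simp
    have "(\<Sum>l\<in>A. \<bar>real_of_int l\<bar> * cmod (g l)) \<le> (\<Sum>l\<in>A. (1 + \<bar>real_of_int l\<bar>) * cmod (g l))"
      by (intro sum_mono) (simp add: distrib_right)
    then show "(\<Sum>l\<in>A. \<bar>real_of_int l\<bar> * cmod (g l)) \<le> S" using S[OF that] by simp
  qed
  have "(\<lambda>l. cmod (g l)) summable_on UNIV"
    by (rule nonneg_bdd_above_summable_on) (auto intro!: bdd_aboveI[of _ S] fin)
  then have G: "(g has_sum (\<Sum>\<^sub>\<infinity>l. g l)) UNIV"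
    using abs_summable_summable has_sum_infsum by blast
  have wsum: "(\<lambda>l. \<bar>real_of_int l\<bar> * cmod (g l)) summable_on UNIV"
    by (rule nonneg_bdd_above_summable_on) (auto intro!: bdd_aboveI[of _ S] fin)
  define q where "q s l = (if l + s \<in> {1..n} then 0 else g l)" for s l
  have q: "(q s has_sum ((\<Sum>\<^sub>\<infinity>l. g l) - (\<Sum>t\<in>{1..n}. g (t - s)))) UNIV" for s
  proof -
    have "((\<lambda>l. if l + s \<in> {1..n} then g l else 0) has_sum (\<Sum>t\<in>{1..n}. g (t - s))) UNIV"
    proof (rule has_sum_finite_neutralI[of "(\<lambda>t. t - s) ` {1..n}"])
      show "(\<Sum>t\<in>{1..n}. g (t - s)) = (\<Sum>l\<in>(\<lambda>t. t - s) ` {1..n}. if l + s \<in> {1..n} then g l else 0)"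
        by (subst sum.reindex) (auto simp: inj_on_def)
      show "(if l + s \<in> {1..n} then g l else 0) = 0" if "l \<in> UNIV - (\<lambda>t. t - s) ` {1..n}" for l
      proof -
        have "l + s \<notin> {1..n}"
        proof
          assume "l + s \<in> {1..n}"
          then have "l \<in> (\<lambda>t. t - s) ` {1..n}" by (intro image_eqI[of _ _ "l + s"]) auto
          then show False using that by auto
        qed
        then show ?thesis by (simp only: if_False)
      qed
    qed auto
    then have "((\<lambda>l. - (if l + s \<in> {1..n} then g l else 0)) has_sum - (\<Sum>t\<in>{1..n}. g (t - s))) UNIV"
      by (simp only: has_sum_uminus) simp
    from has_sum_add[OF G this]
    have "((\<lambda>l. g l + - (if l + s \<in> {1..n} then g l else 0)) has_sum
        (\<Sum>\<^sub>\<infinity>l. g l) - (\<Sum>t\<in>{1..n}. g (t - s))) UNIV"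
      by simp
    moreover have "(\<lambda>l. g l + - (if l + s \<in> {1..n} then g l else 0)) = q s"
      by (auto simp: q_def)
    ultimately show ?thesis by (simp only:)
  qed
  have hs: "((\<lambda>l. \<Sum>s\<in>F. c s * q s l) has_sum
      (\<Sum>s\<in>F. c s * ((\<Sum>\<^sub>\<infinity>l. g l) - (\<Sum>t\<in>{1..n}. g (t - s))))) UNIV" if "finite F" for F
    using that
  proof (induction F)
    case (insert s F)
    then show ?case by (simp add: has_sum_add has_sum_cmult_right q)
  qed simp
  have "cmod (\<Sum>s\<in>{1..n}. c s * ((\<Sum>\<^sub>\<infinity>l. g l) - (\<Sum>t\<in>{1..n}. g (t - s)))) \<le>
      (\<Sum>\<^sub>\<infinity>l. \<bar>real_of_int l\<bar> * cmod (g l))"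
  proof -
    have "cmod (\<Sum>s\<in>{1..n}. c s * q s l) \<le> \<bar>real_of_int l\<bar> * cmod (g l)" for l
    proof -
      have "cmod (\<Sum>s\<in>{1..n}. c s * q s l) \<le> (\<Sum>s\<in>{1..n}. cmod (q s l))"
        by (intro sum_norm_le) (use c in \<open>auto simp: norm_mult intro: mult_left_le_one_le\<close>)
      also have "\<dots> = (\<Sum>s\<in>{s\<in>{1..n}. l + s \<notin> {1..n}}. cmod (g l))"
        by (intro sum.mono_neutral_cong_right) (auto simp: q_def)
      also have "\<dots> = real (card {s\<in>{1..n}. l + s \<notin> {1..n}}) * cmod (g l)"
        by simp
      also have "\<dots> \<le> \<bar>real_of_int l\<bar> * cmod (g l)"
      proof (rule mult_right_mono)
        have "card {s\<in>{1..n}. l + s \<notin> {1..n}} \<le> card (if l \<ge> 0 then {n - l + 1..n} else {1..-l})"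
          by (intro card_mono) auto
        then show "real (card {s\<in>{1..n}. l + s \<notin> {1..n}}) \<le> \<bar>real_of_int l\<bar>"
          by (auto split: if_splits)
      qed simp
      finally show ?thesis .
    qed
    then show ?thesis by (intro norm_infsum_le[OF hs has_sum_infsum[OF wsum]]) auto
  qed
  also have "\<dots> \<le> S"
    by (rule infsum_le_finite_sums[OF wsum]) (auto intro: fin)
  finally show ?thesis
    by (subst norm_minus_commute) (simp add: sum_distrib_right sum_subtractf right_diff_distrib)
qed

lemma sum_int_interval: "(\<Sum>t\<in>{1..int n}. g t) = (\<Sum>t = 1..n. g (int t))"
proof -
  have "{1..int n} = int ` {1..n}" using image_int_atLeastAtMost[of 1 n] by simp
  then show ?thesis by (simp add: sum.reindex)
qed

text \<open>
  A full period of a nontrivial root of unity. This removes the mean at nonzero Fourier frequencies and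
  decorrelates distinct ones.
\<close>

lemma sum_iexp_fourier_eq_0:
  fixes m :: int and n :: nat
  assumes "n \<ge> 1" and "\<not> int n dvd m"
  shows "(\<Sum>t\<in>{1..int n}. iexp (- (real_of_int t * (2 * pi * real_of_int m / real n)))) = 0"
proof -
  define z where "z = iexp (- (2 * pi * real_of_int m / real n))"
  have pow: "iexp (- (real t * (2 * pi * real_of_int m / real n))) = z ^ t" for t
    unfolding z_def by (simp add: exp_of_nat_mult[symmetric] algebra_simps)
  have "z \<noteq> 1"
  proof
    assume "z = 1"
    then obtain k :: int where "- (2 * pi * real_of_int m / real n) = of_int (2 * k) * pi"
      unfolding z_def exp_eq_1 by auto
    then have "pi * real_of_int m = pi * real_of_int (- k * int n)"
      using assms by (simp add: field_simps)
    then have "m = - k * int n" by (simp only: mult_cancel_left of_int_eq_iff) simp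
    then show False using assms by simp
  qed
  have "z ^ n = iexp (2 * pi * real_of_int (- m))"
    using assms by (simp add: pow[symmetric])
  also have "\<dots> = 1" by (subst exp_eq_1) (auto intro!: exI[of _ "- m"])
  finally have "z ^ n = 1" .
  have "(\<Sum>t\<in>{1..int n}. iexp (- (real_of_int t * (2 * pi * real_of_int m / real n)))) = (\<Sum>t=1..n. z ^ t)"
    by (simp add: sum_int_interval pow[simplified])
  also have "\<dots> = (\<Sum>t<n. z ^ Suc t)"
    by (rule sum.reindex_bij_witness[of _ Suc "\<lambda>t. t - 1"]) auto
  also have "\<dots> = z * (\<Sum>t<n. z ^ t)" by (simp add: sum_distrib_left)
  also have "\<dots> = 0" using \<open>z \<noteq> 1\<close> \<open>z ^ n = 1\<close> by (simp add: geometric_sum)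
  finally show ?thesis .
qed

lemma sum_product_blocks:
  fixes F G :: "'b \<Rightarrow> 'b \<Rightarrow> complex"
  shows "(\<Sum>a\<in>T. \<Sum>b\<in>T. F a b) * (\<Sum>c\<in>T. \<Sum>d\<in>T. G c d) =
    (\<Sum>a\<in>T. \<Sum>b\<in>T. \<Sum>c\<in>T. \<Sum>d\<in>T. F a b * G c d)"
  unfolding sum_product by (rule sum.cong[OF refl], rule sum.swap)

lemma sum_product_interleave:
  fixes A B C D :: "'b \<Rightarrow> complex"
  shows "(\<Sum>a\<in>T. A a) * (\<Sum>b\<in>T. B b) * ((\<Sum>c\<in>T. C c) * (\<Sum>d\<in>T. D d)) =
    (\<Sum>a\<in>T. \<Sum>b\<in>T. \<Sum>c\<in>T. \<Sum>d\<in>T. A a * B b * (C c * D d))"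
  unfolding sum_product_blocks[symmetric] sum_product ..

lemma (in prob_space) integral_centred_product:
  fixes f g :: "'a \<Rightarrow> complex"
  assumes "integrable M f" "integrable M g" "integrable M (\<lambda>\<omega>. f \<omega> * g \<omega>)"
  shows "(\<integral>\<omega>. (f \<omega> - (\<integral>\<omega>'. f \<omega>' \<partial>M)) * (g \<omega> - (\<integral>\<omega>'. g \<omega>' \<partial>M)) \<partial>M) =
    (\<integral>\<omega>. f \<omega> * g \<omega> \<partial>M) - (\<integral>\<omega>. f \<omega> \<partial>M) * (\<integral>\<omega>. g \<omega> \<partial>M)"
  using assms by (simp add: left_diff_distrib right_diff_distrib prob_space)

section \<open>Moments and cumulant sums of the stationary process\<close>

text \<open>
  A joint cumulant takes an indexed family; this packs four times or frequencies into one indexed by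
  \<open>{1, 2, 3, 4}\<close>.
\<close>

definition quad :: "'b \<Rightarrow> 'b \<Rightarrow> 'b \<Rightarrow> 'b \<Rightarrow> nat \<Rightarrow> 'b" where
  "quad a b c d j = (if j = 1 then a else if j = 2 then b else if j = 3 then c else d)"

lemma quad_simps [simp]:
  "quad a b c d 1 = a" "quad a b c d (Suc 0) = a" "quad a b c d 2 = b" "quad a b c d 3 = c" "quad a b c d 4 = d"
  by (auto simp: quad_def)

lemma atLeastAtMost_1_4: "{1..4::nat} = {1, 2, 3, 4}" by auto

lemma joint_cumulant_cong:
  assumes "\<And>i. i \<in> I \<Longrightarrow> X i = Y i"
  shows "joint_cumulant P X I = joint_cumulant P Y I"
  unfolding joint_cumulant_def
proof (intro sum.cong refl arg_cong2[where f = "(*)"] prod.cong)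
  fix \<pi> B assume "\<pi> \<in> {\<pi>. partition_on I \<pi>}" "B \<in> \<pi>"
  then have "i \<in> I" if "i \<in> B" for i using that unfolding partition_on_def by auto
  then have "(\<lambda>\<omega>. \<Prod>i\<in>B. X i \<omega>) = (\<lambda>\<omega>. \<Prod>i\<in>B. Y i \<omega>)"
    using assms by (auto intro!: prod.cong)
  then show "(\<integral>\<omega>. (\<Prod>i\<in>B. X i \<omega>) \<partial>P) = (\<integral>\<omega>. (\<Prod>i\<in>B. Y i \<omega>) \<partial>P)"
    by (simp only:)
qed

lemma (in prob_space) integrable_bounded:
  fixes f :: "'a \<Rightarrow> complex"
  assumes "f \<in> borel_measurable M" "\<And>\<omega>. cmod (f \<omega>) \<le> B"
  shows "integrable M f"
  using assms by (intro integrable_const_bound[where B = B]) auto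

locale exp_cumulant_process = prob_space P for P :: "'a measure" +
  fixes Z :: "int \<Rightarrow> 'a \<Rightarrow> real"
  assumes stationary: "strictly_stationary P Z"
    and cumulants: "summable_exp_cumulants P Z"
begin

lemma Z_measurable [measurable]: "Z t \<in> borel_measurable P"
  using stationary by (auto simp: strictly_stationary_def)

text \<open>
  The times \<open>t i\<close> may coincide, whereas stationarity speaks of the law at a finite set of distinct times.
  The moment is therefore written as the integral of a function of the coordinates in \<open>t ` I\<close>.
\<close>

lemma exp_moment_shift:
  assumes "finite I"
  shows "(\<integral>\<omega>. (\<Prod>i\<in>I. iexp (u i * Z (t i + h) \<omega>)) \<partial>P) = (\<integral>\<omega>. (\<Prod>i\<in>I. iexp (u i * Z (t i) \<omega>)) \<partial>P)"
proof -
  define J where "J = t ` I"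
  have J: "finite J" "\<And>i. i \<in> I \<Longrightarrow> t i \<in> J" using assms by (auto simp: J_def)
  define H where "H = (\<lambda>x. \<Prod>i\<in>I. iexp (u i * x (t i)))"
  have [measurable]: "H \<in> borel_measurable (Pi\<^sub>M J (\<lambda>_. borel :: real measure))"
    unfolding H_def
  proof (intro borel_measurable_prod)
    fix i assume "i \<in> I"
    then have [measurable]: "(\<lambda>x. x (t i)) \<in> borel_measurable (Pi\<^sub>M J (\<lambda>_. borel :: real measure))"
      using J by (intro measurable_component_singleton)
    show "(\<lambda>x. iexp (u i * x (t i))) \<in> borel_measurable (Pi\<^sub>M J (\<lambda>_. borel :: real measure))"
      by measurable
  qed
  have sh: "(\<integral>\<omega>. (\<Prod>i\<in>I. iexp (u i * Z (t i + k) \<omega>)) \<partial>P) =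
      (\<integral>x. H x \<partial>distr P (Pi\<^sub>M J (\<lambda>_. borel)) (\<lambda>\<omega>. \<lambda>t\<in>J. Z (t + k) \<omega>))" for k
    by (subst integral_distr) (auto simp: H_def J(2) intro!: Bochner_Integration.integral_cong prod.cong)
  have "distr P (Pi\<^sub>M J (\<lambda>_. borel)) (\<lambda>\<omega>. \<lambda>t\<in>J. Z (t + h) \<omega>) =
      distr P (Pi\<^sub>M J (\<lambda>_. borel)) (\<lambda>\<omega>. \<lambda>t\<in>J. Z (t + 0) \<omega>)"
    using stationary J unfolding strictly_stationary_def by auto
  then show ?thesis using sh[of h] sh[of 0] by simp
qed

lemma joint_cumulant_shift:
  assumes "finite I"
  shows "joint_cumulant P (\<lambda>i \<omega>. iexp (u i * Z (t i + h) \<omega>)) I = joint_cumulant P (\<lambda>i \<omega>. iexp (u i * Z (t i) \<omega>)) I"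
  unfolding joint_cumulant_def
proof (intro sum.cong refl arg_cong2[where f = "(*)"] prod.cong)
  fix \<pi> B assume "\<pi> \<in> {\<pi>. partition_on I \<pi>}" "B \<in> \<pi>"
  then have "finite B" using assms finite_subset[of B I] unfolding partition_on_def by auto
  then show "(\<integral>\<omega>. (\<Prod>i\<in>B. iexp (u i * Z (t i + h) \<omega>)) \<partial>P) = (\<integral>\<omega>. (\<Prod>i\<in>B. iexp (u i * Z (t i) \<omega>)) \<partial>P)"
    by (rule exp_moment_shift)
qed

lemma covariance_eq_gen_cov:
  "(\<integral>\<omega>. iexp (u * Z t \<omega>) * iexp (v * Z s \<omega>) \<partial>P) - (\<integral>\<omega>. iexp (u * Z t \<omega>) \<partial>P) * (\<integral>\<omega>. iexp (v * Z s \<omega>) \<partial>P)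
     = gen_cov P Z (t - s) u v"
proof -
  have 1: "(\<integral>\<omega>. iexp (u * Z t \<omega>) \<partial>P) = (\<integral>\<omega>. iexp (u * Z t' \<omega>) \<partial>P)" for u t t'
    using exp_moment_shift[of "{()}" "\<lambda>_. u" "\<lambda>_. t'" "t - t'"] by simp
  have 2: "(\<integral>\<omega>. iexp (u * Z t \<omega>) * iexp (v * Z s \<omega>) \<partial>P) = (\<integral>\<omega>. iexp (u * Z (t - s) \<omega>) * iexp (v * Z 0 \<omega>) \<partial>P)"
    using exp_moment_shift[of "{True, False}" "\<lambda>b. if b then u else v" "\<lambda>b. if b then t - s else 0" s] by simp
  show ?thesis
    unfolding gen_cov_def 2 1[of u t "t - s"] 1[of v s 0]
    by (simp add: exp_add[symmetric] distrib_left)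
qed

text \<open>
  The real-valued form of the summability assumption, with one constant for all frequencies \<open>u\<close>.
\<close>

lemma weighted_cumulant_sums_bounded:
  fixes k :: nat
  assumes "k \<ge> 2"
  obtains C where "\<And>u A. finite A \<Longrightarrow> A \<subseteq> {1..k - 1} \<rightarrow>\<^sub>E (UNIV :: int set) \<Longrightarrow>
     (\<Sum>l\<in>A. (1 + (\<Sum>j = 1..k - 1. \<bar>real_of_int (l j)\<bar>)) *
        cmod (joint_cumulant P (\<lambda>j \<omega>. iexp (u j * Z ((l(k := 0)) j) \<omega>)) {1..k})) \<le> C"
proof -
  define w where "w l = 1 + (\<Sum>j = 1..k - 1. \<bar>real_of_int (l j)\<bar>)" for l :: "nat \<Rightarrow> int"
  define q where "q l u = cmod (joint_cumulant P (\<lambda>j \<omega>. iexp (u j * Z ((l(k := 0)) j) \<omega>)) {1..k})" for l u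
  define f where "f l = ennreal (w l) * (SUP u :: nat \<Rightarrow> real. ennreal (q l u))" for l
  define C where "C = (\<Sum>\<^sub>\<infinity>l \<in> {1..k - 1} \<rightarrow>\<^sub>E (UNIV :: int set). f l)"
  have C: "C < \<infinity>"
    using cumulants assms unfolding summable_exp_cumulants_def C_def f_def w_def q_def by blast
  have nn: "w l \<ge> 0" "q l u \<ge> 0" for l u unfolding w_def q_def by (auto intro!: add_nonneg_nonneg sum_nonneg)
  show thesis
  proof (rule that[of "enn2real C", folded w_def q_def])
    fix u A assume A: "finite A" "A \<subseteq> {1..k - 1} \<rightarrow>\<^sub>E (UNIV :: int set)"
    have "ennreal (\<Sum>l\<in>A. w l * q l u) = (\<Sum>l\<in>A. ennreal (w l) * ennreal (q l u))"
      using nn by (subst sum_ennreal[symmetric]) (auto simp: ennreal_mult)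
    also have "\<dots> \<le> (\<Sum>l\<in>A. f l)"
      unfolding f_def by (intro sum_mono mult_left_mono SUP_upper) auto
    also have "\<dots> \<le> C"
      unfolding C_def using A by (subst nonneg_infsum_complete) (auto intro!: SUP_upper)
    finally show "(\<Sum>l\<in>A. w l * q l u) \<le> enn2real C"
      using enn2real_mono[of "ennreal (\<Sum>l\<in>A. w l * q l u)" C] C nn by (simp add: sum_nonneg)
  qed
qed

lemma gen_cov_weighted_sums_bounded:
  obtains S where "S \<ge> 0" "\<And>u v A. finite A \<Longrightarrow> (\<Sum>l\<in>A. (1 + \<bar>real_of_int l\<bar>) * cmod (gen_cov P Z l u v)) \<le> S"
proof -
  obtain C where C: "\<And>u A. finite A \<Longrightarrow> A \<subseteq> {1..2 - 1 :: nat} \<rightarrow>\<^sub>E (UNIV :: int set) \<Longrightarrow>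
     (\<Sum>l\<in>A. (1 + (\<Sum>j = 1..2 - 1. \<bar>real_of_int (l j)\<bar>)) *
        cmod (joint_cumulant P (\<lambda>j \<omega>. iexp (u j * Z ((l(2 := 0)) j) \<omega>)) {1..2})) \<le> C"
    using weighted_cumulant_sums_bounded[of 2] by blast
  have "(\<Sum>l\<in>A. (1 + \<bar>real_of_int l\<bar>) * cmod (gen_cov P Z l u v)) \<le> C" if "finite A" for u v A
  proof -
    define h where "h l = (\<lambda>j\<in>{1::nat}. l :: int)" for l
    have inj: "inj_on h A" unfolding h_def by (rule inj_onI) (metis restrict_apply' singletonI)
    have cum: "joint_cumulant P (\<lambda>j \<omega>. iexp ((if j = 1 then u else v) * Z (((h l)(2 := 0)) j) \<omega>)) {1..2}
        = gen_cov P Z l u v" for l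
    proof -
      have "{1..2::nat} = {1, 2}" by auto
      then show ?thesis
        unfolding joint_cumulant_partition_sum
        by (simp add: partition_sum2 h_def gen_cov_def exp_add[symmetric] distrib_left)
    qed
    have "(\<Sum>l\<in>A. (1 + \<bar>real_of_int l\<bar>) * cmod (gen_cov P Z l u v)) =
      (\<Sum>l\<in>h ` A. (1 + (\<Sum>j = 1..2 - 1. \<bar>real_of_int (l j)\<bar>)) *
        cmod (joint_cumulant P (\<lambda>j \<omega>. iexp ((if j = 1 then u else v) * Z ((l(2 := 0)) j) \<omega>)) {1..2}))"
      unfolding sum.reindex[OF inj] o_def cum by (simp add: h_def)
    also have "\<dots> \<le> C" using that by (intro C) (auto simp: h_def split: if_splits)
    finally show ?thesis .
  qed
  moreover from this[of "{}"] have "C \<ge> 0" by simp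
  ultimately show thesis using that by blast
qed

text \<open>
  Shifting the last time to zero turns, for each \<open>d\<close>, the sum over the other three times into a sum over
  distinct lag vectors, which summability bounds independently of \<open>d\<close>. The \<open>n\<close> values of \<open>d\<close> give the factor.
\<close>

lemma cumulant4_sums_bounded:
  obtains S where "S \<ge> 0" "\<And>u n. (\<Sum>a\<in>{1..int n}. \<Sum>b\<in>{1..int n}. \<Sum>c\<in>{1..int n}. \<Sum>d\<in>{1..int n}.
     cmod (joint_cumulant P (\<lambda>j \<omega>. iexp (u j * Z (quad a b c d j) \<omega>)) {1, 2, 3, 4})) \<le> real n * S"
proof -
  obtain C where C: "\<And>u A. finite A \<Longrightarrow> A \<subseteq> {1..4 - 1 :: nat} \<rightarrow>\<^sub>E (UNIV :: int set) \<Longrightarrow>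
     (\<Sum>l\<in>A. (1 + (\<Sum>j = 1..4 - 1. \<bar>real_of_int (l j)\<bar>)) *
        cmod (joint_cumulant P (\<lambda>j \<omega>. iexp (u j * Z ((l(4 := 0)) j) \<omega>)) {1..4})) \<le> C"
    using weighted_cumulant_sums_bounded[of 4] by auto
  define T where "T n = {1..int n}" for n
  define q where "q u l = cmod (joint_cumulant P (\<lambda>j \<omega>. iexp (u j * Z (l j) \<omega>)) {1, 2, 3, 4})" for u and l :: "nat \<Rightarrow> int"
  have "(\<Sum>a\<in>T n. \<Sum>b\<in>T n. \<Sum>c\<in>T n. \<Sum>d\<in>T n. q u (quad a b c d)) \<le> real n * C" for u n
  proof -
    have one: "(\<Sum>a\<in>T n. \<Sum>b\<in>T n. \<Sum>c\<in>T n. q u (quad a b c d)) \<le> C" for d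
    proof -
      define h where "h = (\<lambda>(a, b, c). \<lambda>j\<in>{1..4 - 1 :: nat}. quad (a - d) (b - d) (c - d) 0 j)"
      have inj: "inj_on h (T n \<times> T n \<times> T n)"
      proof (rule inj_onI)
        fix p p' assume "h p = h p'"
        moreover obtain a b c a' b' c' where "p = (a, b, c)" "p' = (a', b', c')"
          using prod_cases3 by metis
        moreover have "h (a, b, c) 1 = a - d" "h (a, b, c) 2 = b - d" "h (a, b, c) 3 = c - d" for a b c
          by (simp_all add: h_def)
        ultimately show "p = p'" by (metis diff_add_cancel)
      qed
      have eq: "q u (quad a b c d) = q u ((h (a, b, c))(4 := 0))" for a b c
      proof -
        have "quad a b c d = (\<lambda>j. quad (a - d) (b - d) (c - d) 0 j + d)" by (auto simp: quad_def)
        then have "q u (quad a b c d) = q u (\<lambda>j. quad (a - d) (b - d) (c - d) 0 j + d)" by (rule arg_cong)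
        also have "\<dots> = q u (quad (a - d) (b - d) (c - d) 0)"
          unfolding q_def by (subst joint_cumulant_shift) auto
        also have "\<dots> = q u ((h (a, b, c))(4 := 0))"
          unfolding q_def by (intro arg_cong[where f = cmod] joint_cumulant_cong) (auto simp: h_def quad_def)
        finally show ?thesis .
      qed
      have "(\<Sum>a\<in>T n. \<Sum>b\<in>T n. \<Sum>c\<in>T n. q u (quad a b c d)) = (\<Sum>p\<in>T n \<times> T n \<times> T n. q u ((h p)(4 := 0)))"
        by (simp add: eq sum.cartesian_product split_def)
      also have "\<dots> = (\<Sum>l\<in>h ` (T n \<times> T n \<times> T n). q u (l(4 := 0)))"
        by (simp add: sum.reindex[OF inj])
      also have "\<dots> \<le> (\<Sum>l\<in>h ` (T n \<times> T n \<times> T n). (1 + (\<Sum>j = 1..4 - 1. \<bar>real_of_int (l j)\<bar>)) * q u (l(4 := 0)))"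
        by (intro sum_mono) (simp add: q_def distrib_right sum_nonneg)
      also have "\<dots> \<le> C"
        unfolding q_def atLeastAtMost_1_4[symmetric] by (intro C) (auto simp: h_def T_def)
      finally show ?thesis .
    qed
    have "(\<Sum>a\<in>T n. \<Sum>b\<in>T n. \<Sum>c\<in>T n. \<Sum>d\<in>T n. q u (quad a b c d))
        = (\<Sum>a\<in>T n. \<Sum>b\<in>T n. \<Sum>d\<in>T n. \<Sum>c\<in>T n. q u (quad a b c d))"
      by (rule sum.cong[OF refl], rule sum.cong[OF refl], rule sum.swap)
    also have "\<dots> = (\<Sum>a\<in>T n. \<Sum>d\<in>T n. \<Sum>b\<in>T n. \<Sum>c\<in>T n. q u (quad a b c d))"
      by (rule sum.cong[OF refl], rule sum.swap)
    also have "\<dots> = (\<Sum>d\<in>T n. \<Sum>a\<in>T n. \<Sum>b\<in>T n. \<Sum>c\<in>T n. q u (quad a b c d))"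
      by (rule sum.swap)
    also have "\<dots> \<le> (\<Sum>d\<in>T n. C)" by (intro sum_mono one)
    finally show ?thesis by (simp add: T_def)
  qed
  moreover have "C \<ge> 0" using C[of "{}" "\<lambda>_. 0"] by simp
  ultimately show thesis using that unfolding q_def T_def by blast
qed

end

section \<open>Covariances of periodogram ordinates\<close>

context exp_cumulant_process begin

definition centred_dft :: "nat \<Rightarrow> real \<Rightarrow> real \<Rightarrow> 'a \<Rightarrow> complex" where
  "centred_dft n w u \<omega> = (\<Sum>t\<in>{1..int n}. iexp (- (real_of_int t * w)) *
     (iexp (u * Z t \<omega>) - (\<integral>\<omega>'. iexp (u * Z t \<omega>') \<partial>P)))"

text \<open>
  By \<open>integral_centred_dft2\<close> below, the covariance (without conjugation) of two discrete Fourier transforms.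
\<close>

definition dft_cov :: "nat \<Rightarrow> real \<Rightarrow> real \<Rightarrow> real \<Rightarrow> real \<Rightarrow> complex" where
  "dft_cov n w u x v = (\<Sum>t\<in>{1..int n}. \<Sum>s\<in>{1..int n}.
     (iexp (- (real_of_int t * w)) * iexp (- (real_of_int s * x))) * gen_cov P Z (t - s) u v)"

text \<open>
  By stationarity the means are the same for all times, so their contribution is a multiple of a full period
  of a root of unity.
\<close>

lemma dft_exp_eq_centred_dft:
  fixes m :: int
  assumes "n \<ge> 1" and "\<not> int n dvd m" and w: "w = 2 * pi * real_of_int m / real n"
  shows "dft_exp Z n w u \<omega> = centred_dft n w u \<omega>"
proof -
  have mean: "(\<integral>\<omega>'. iexp (u * Z t \<omega>') \<partial>P) = (\<integral>\<omega>'. iexp (u * Z 0 \<omega>') \<partial>P)" for t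
    using exp_moment_shift[of "{()}" "\<lambda>_. u" "\<lambda>_. 0" t] by simp
  have "centred_dft n w u \<omega> = (\<Sum>t\<in>{1..int n}. iexp (- (real_of_int t * w)) *
      (iexp (u * Z t \<omega>) - (\<integral>\<omega>'. iexp (u * Z 0 \<omega>') \<partial>P)))"
    unfolding centred_dft_def
  proof (intro sum.cong refl)
    fix t
    show "iexp (- (real_of_int t * w)) * (iexp (u * Z t \<omega>) - (\<integral>\<omega>'. iexp (u * Z t \<omega>') \<partial>P)) =
        iexp (- (real_of_int t * w)) * (iexp (u * Z t \<omega>) - (\<integral>\<omega>'. iexp (u * Z 0 \<omega>') \<partial>P))"
      by (simp only: mean[of t])
  qed
  also have "\<dots> = (\<Sum>t\<in>{1..int n}. iexp (- (real_of_int t * w)) * iexp (u * Z t \<omega>))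
      - (\<Sum>t\<in>{1..int n}. iexp (- (real_of_int t * w))) * (\<integral>\<omega>'. iexp (u * Z 0 \<omega>') \<partial>P)"
    unfolding right_diff_distrib sum_subtractf sum_distrib_right ..
  also have "(\<Sum>t\<in>{1..int n}. iexp (- (real_of_int t * w))) = 0"
    unfolding w using assms(1,2) by (rule sum_iexp_fourier_eq_0)
  finally show ?thesis
    by (simp add: sum_int_interval dft_exp_def mult.commute)
qed

lemma cnj_dft_exp: "cnj (dft_exp Z n w u \<omega>) = dft_exp Z n (- w) (- u) \<omega>"
  unfolding dft_exp_def by (simp add: exp_cnj)

lemma norm_exp_sub_mean_le: "cmod (iexp (u * Z t \<omega>) - (\<integral>\<omega>'. iexp (u * Z t \<omega>') \<partial>P)) \<le> 2"
proof -
  have "cmod (\<integral>\<omega>'. iexp (u * Z t \<omega>') \<partial>P) \<le> (\<integral>\<omega>'. cmod (iexp (u * Z t \<omega>')) \<partial>P)"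
    by (rule integral_norm_bound)
  also have "\<dots> = 1" by (simp add: prob_space)
  finally show ?thesis
    by (intro order_trans[OF norm_triangle_ineq4]) simp
qed

lemma norm_iexp_mult: "cmod (iexp x * z) = cmod z"
  by (simp add: norm_mult)

lemma centred_dft_measurable [measurable]: "centred_dft n w u \<in> borel_measurable P"
  unfolding centred_dft_def by measurable

lemma norm_centred_dft_le: "cmod (centred_dft n w u \<omega>) \<le> 2 * real n"
proof -
  have "cmod (centred_dft n w u \<omega>) \<le> (\<Sum>t\<in>{1..int n}. 2)"
    unfolding centred_dft_def
    by (intro sum_norm_le) (simp only: norm_iexp_mult norm_exp_sub_mean_le)
  then show ?thesis by simp
qed

lemma integral_centred_dft2:
  "(\<integral>\<omega>. centred_dft n w u \<omega> * centred_dft n x v \<omega> \<partial>P) = dft_cov n w u x v"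
proof -
  define Y where "Y u t \<omega> = iexp (u * Z t \<omega>) - (\<integral>\<omega>'. iexp (u * Z t \<omega>') \<partial>P)" for u t \<omega>
  have [measurable]: "Y u t \<in> borel_measurable P" for u t unfolding Y_def by measurable
  have bY: "cmod (Y u t \<omega>) \<le> 2" for u t \<omega> unfolding Y_def by (rule norm_exp_sub_mean_le)
  have [simp]: "integrable P (\<lambda>\<omega>. Y u t \<omega> * Y v s \<omega>)" for u t v s
    by (rule integrable_bounded[where B = "2 * 2"], measurable, unfold norm_mult)
      (intro mult_mono bY; simp)
  have i1: "integrable P (\<lambda>\<omega>. iexp (u * Z t \<omega>))" for u t
    by (rule integrable_bounded[where B = 1]) auto
  have i2: "integrable P (\<lambda>\<omega>. iexp (u * Z t \<omega>) * iexp (v * Z s \<omega>))" for u t v s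
    by (rule integrable_bounded[where B = 1]) (auto simp: norm_mult)
  have YY: "(\<integral>\<omega>. Y u t \<omega> * Y v s \<omega> \<partial>P) = gen_cov P Z (t - s) u v" for u t v s
    unfolding covariance_eq_gen_cov[symmetric] Y_def
    by (rule integral_centred_product[OF i1 i1 i2])
  have "centred_dft n w u \<omega> * centred_dft n x v \<omega> = (\<Sum>t\<in>{1..int n}. \<Sum>s\<in>{1..int n}.
     (iexp (- (real_of_int t * w)) * iexp (- (real_of_int s * x))) * (Y u t \<omega> * Y v s \<omega>))" for \<omega>
    unfolding centred_dft_def Y_def[symmetric] sum_product by (intro sum.cong refl) (simp add: mult_ac)
  then show ?thesis
    unfolding dft_cov_def by (simp add: YY)
qed

text \<open>
  The moment identity \<open>central_moment4_eq_cumulants\<close> summed over four times; each pairing factorises into a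
  product of two double sums.
\<close>

lemma integral_centred_dft4:
  "(\<integral>\<omega>. centred_dft n w1 u1 \<omega> * centred_dft n w2 u2 \<omega> * (centred_dft n w3 u3 \<omega> * centred_dft n w4 u4 \<omega>) \<partial>P) =
   (\<Sum>a\<in>{1..int n}. \<Sum>b\<in>{1..int n}. \<Sum>c\<in>{1..int n}. \<Sum>d\<in>{1..int n}.
      (iexp (- (real_of_int a * w1)) * iexp (- (real_of_int b * w2))) *
      (iexp (- (real_of_int c * w3)) * iexp (- (real_of_int d * w4))) *
      joint_cumulant P (\<lambda>j \<omega>. iexp (quad u1 u2 u3 u4 j * Z (quad a b c d j) \<omega>)) {1, 2, 3, 4})
   + dft_cov n w1 u1 w2 u2 * dft_cov n w3 u3 w4 u4
   + dft_cov n w1 u1 w3 u3 * dft_cov n w2 u2 w4 u4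
   + dft_cov n w1 u1 w4 u4 * dft_cov n w2 u2 w3 u3"
proof -
  define T where "T = {1..int n}"
  define Y where "Y u t \<omega> = iexp (u * Z t \<omega>) - (\<integral>\<omega>'. iexp (u * Z t \<omega>') \<partial>P)" for u t \<omega>
  define e where "e t w = iexp (- (real_of_int t * w))" for t w
  define \<kappa> where "\<kappa> a b c d = joint_cumulant P (\<lambda>j \<omega>. iexp (quad u1 u2 u3 u4 j * Z (quad a b c d j) \<omega>)) {1, 2, 3, 4}" for a b c d
  define g where "g l u v = gen_cov P Z l u v" for l u v
  have [measurable]: "Y u t \<in> borel_measurable P" for u t unfolding Y_def by measurable
  have bY: "cmod (Y u t \<omega>) \<le> 2" for u t \<omega> unfolding Y_def by (rule norm_exp_sub_mean_le)
  have [simp]: "integrable P (\<lambda>\<omega>. Y u1 a \<omega> * Y u2 b \<omega> * (Y u3 c \<omega> * Y u4 d \<omega>))" for a b c d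
    by (rule integrable_bounded[where B = "2 * 2 * (2 * 2)"], measurable, unfold norm_mult)
      (intro mult_mono mult_nonneg_nonneg bY; simp)
  have YYYY: "(\<integral>\<omega>. Y u1 a \<omega> * Y u2 b \<omega> * (Y u3 c \<omega> * Y u4 d \<omega>) \<partial>P) = \<kappa> a b c d
     + g (a - b) u1 u2 * g (c - d) u3 u4 + g (a - c) u1 u3 * g (b - d) u2 u4 + g (a - d) u1 u4 * g (b - c) u2 u3"
    for a b c d
    using central_moment4_eq_cumulants[of 1 "2::nat" 3 4 "\<lambda>j \<omega>. iexp (quad u1 u2 u3 u4 j * Z (quad a b c d j) \<omega>)"]
    unfolding Y_def \<kappa>_def g_def quad_simps covariance_eq_gen_cov by (simp add: mult.assoc)
  have "centred_dft n w1 u1 \<omega> * centred_dft n w2 u2 \<omega> * (centred_dft n w3 u3 \<omega> * centred_dft n w4 u4 \<omega>) =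
      (\<Sum>a\<in>T. \<Sum>b\<in>T. \<Sum>c\<in>T. \<Sum>d\<in>T. (e a w1 * e b w2) * (e c w3 * e d w4) *
        (Y u1 a \<omega> * Y u2 b \<omega> * (Y u3 c \<omega> * Y u4 d \<omega>)))" for \<omega>
    unfolding centred_dft_def Y_def[symmetric] T_def[symmetric] e_def[symmetric] sum_product_interleave
    by (intro sum.cong refl) (simp add: mult_ac)
  then have "(\<integral>\<omega>. centred_dft n w1 u1 \<omega> * centred_dft n w2 u2 \<omega> * (centred_dft n w3 u3 \<omega> * centred_dft n w4 u4 \<omega>) \<partial>P) =
      (\<Sum>a\<in>T. \<Sum>b\<in>T. \<Sum>c\<in>T. \<Sum>d\<in>T. (e a w1 * e b w2) * (e c w3 * e d w4) * (\<kappa> a b c d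
     + g (a - b) u1 u2 * g (c - d) u3 u4 + g (a - c) u1 u3 * g (b - d) u2 u4 + g (a - d) u1 u4 * g (b - c) u2 u3))"
    by (simp add: YYYY)
  also have "\<dots> = (\<Sum>a\<in>T. \<Sum>b\<in>T. \<Sum>c\<in>T. \<Sum>d\<in>T. (e a w1 * e b w2) * (e c w3 * e d w4) * \<kappa> a b c d)
     + (\<Sum>a\<in>T. \<Sum>b\<in>T. \<Sum>c\<in>T. \<Sum>d\<in>T. ((e a w1 * e b w2) * g (a - b) u1 u2) * ((e c w3 * e d w4) * g (c - d) u3 u4))
     + (\<Sum>a\<in>T. \<Sum>b\<in>T. \<Sum>c\<in>T. \<Sum>d\<in>T. ((e a w1 * e c w3) * g (a - c) u1 u3) * ((e b w2 * e d w4) * g (b - d) u2 u4))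
     + (\<Sum>a\<in>T. \<Sum>b\<in>T. \<Sum>c\<in>T. \<Sum>d\<in>T. ((e a w1 * e d w4) * g (a - d) u1 u4) * ((e b w2 * e c w3) * g (b - c) u2 u3))"
    unfolding sum.distrib[symmetric] by (intro sum.cong refl) (simp add: algebra_simps)
  also have "(\<Sum>a\<in>T. \<Sum>b\<in>T. \<Sum>c\<in>T. \<Sum>d\<in>T. ((e a w1 * e b w2) * g (a - b) u1 u2) * ((e c w3 * e d w4) * g (c - d) u3 u4))
     = dft_cov n w1 u1 w2 u2 * dft_cov n w3 u3 w4 u4"
    unfolding dft_cov_def g_def[symmetric] e_def[symmetric] T_def[symmetric]
    by (rule sum_product_blocks[symmetric])
  also have "(\<Sum>a\<in>T. \<Sum>b\<in>T. \<Sum>c\<in>T. \<Sum>d\<in>T. ((e a w1 * e c w3) * g (a - c) u1 u3) * ((e b w2 * e d w4) * g (b - d) u2 u4))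
     = dft_cov n w1 u1 w3 u3 * dft_cov n w2 u2 w4 u4"
    unfolding dft_cov_def g_def[symmetric] e_def[symmetric] T_def[symmetric]
    by (simp only: sum_product)
  also have "(\<Sum>a\<in>T. \<Sum>b\<in>T. \<Sum>c\<in>T. \<Sum>d\<in>T. ((e a w1 * e d w4) * g (a - d) u1 u4) * ((e b w2 * e c w3) * g (b - c) u2 u3))
     = dft_cov n w1 u1 w4 u4 * dft_cov n w2 u2 w3 u3"
  proof -
    have "(\<Sum>c\<in>T. \<Sum>d\<in>T. ((e a w1 * e d w4) * g (a - d) u1 u4) * ((e b w2 * e c w3) * g (b - c) u2 u3)) =
      (\<Sum>d\<in>T. \<Sum>c\<in>T. ((e a w1 * e d w4) * g (a - d) u1 u4) * ((e b w2 * e c w3) * g (b - c) u2 u3))" for a b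
      by (rule sum.swap)
    then show ?thesis
      unfolding dft_cov_def g_def[symmetric] e_def[symmetric] T_def[symmetric]
      by (simp only: sum_product)
  qed
  finally show ?thesis unfolding \<kappa>_def e_def T_def .
qed

text \<open>
  Writing \<open>tw + sx = (t - s)w + s(w + x)\<close> exhibits the double sum as a Toeplitz sum with outer coefficients
  \<open>exp (-is(w + x))\<close>. These sum to \<open>n\<close> if \<open>x = -w\<close>, which yields the bias of the periodogram, and to zero if
  \<open>w + x\<close> is a nonzero Fourier frequency modulo \<open>2\<pi>\<close>, which yields decorrelation.
\<close>

lemma dft_cov_approx:
  assumes S: "\<And>A. finite A \<Longrightarrow> (\<Sum>l\<in>A. (1 + \<bar>real_of_int l\<bar>) * cmod (gen_cov P Z l u v)) \<le> S"
  shows "cmod (dft_cov n w u x v - (\<Sum>s\<in>{1..int n}. iexp (- (real_of_int s * (w + x)))) *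
           (2 * pi * gen_spectrum P Z w u v)) \<le> S" (is ?a)
    and "cmod (dft_cov n w u x v) \<le> real n * S" (is ?b)
proof -
  define g where "g l = gen_cov P Z l u v * iexp (- (real_of_int l * w))" for l
  have ng: "cmod (g l) = cmod (gen_cov P Z l u v)" for l by (simp add: g_def norm_mult)
  have "dft_cov n w u x v = (\<Sum>s\<in>{1..int n}. \<Sum>t\<in>{1..int n}.
     (iexp (- (real_of_int t * w)) * iexp (- (real_of_int s * x))) * gen_cov P Z (t - s) u v)"
    unfolding dft_cov_def by (rule sum.swap)
  also have "\<dots> = (\<Sum>s\<in>{1..int n}. iexp (- (real_of_int s * (w + x))) * (\<Sum>t\<in>{1..int n}. g (t - s)))"
    unfolding sum_distrib_left g_def
  proof (intro sum.cong refl)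
    fix s t
    have "iexp (- (real_of_int t * w)) * iexp (- (real_of_int s * x)) =
        iexp (- (real_of_int s * (w + x))) * iexp (- (real_of_int (t - s) * w))"
      unfolding exp_add[symmetric] by (rule arg_cong[where f = exp]) (simp add: algebra_simps)
    then show "iexp (- (real_of_int t * w)) * iexp (- (real_of_int s * x)) * gen_cov P Z (t - s) u v =
       iexp (- (real_of_int s * (w + x))) * (gen_cov P Z (t - s) u v * iexp (- (real_of_int (t - s) * w)))"
      by (simp only: mult_ac)
  qed
  finally have eq: "dft_cov n w u x v =
      (\<Sum>s\<in>{1..int n}. iexp (- (real_of_int s * (w + x))) * (\<Sum>t\<in>{1..int n}. g (t - s)))" .
  have "2 * pi * gen_spectrum P Z w u v = (\<Sum>\<^sub>\<infinity>l. g l)"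
    by (simp add: gen_spectrum_def g_def)
  moreover have "cmod ((\<Sum>s\<in>{1..int n}. iexp (- (real_of_int s * (w + x))) * (\<Sum>t\<in>{1..int n}. g (t - s))) -
      (\<Sum>s\<in>{1..int n}. iexp (- (real_of_int s * (w + x)))) * (\<Sum>\<^sub>\<infinity>l. g l)) \<le> S"
    by (rule toeplitz_sum_approx) (use S in \<open>auto simp: ng\<close>)
  ultimately show ?a unfolding eq by simp
  have "cmod (\<Sum>t\<in>{1..int n}. g (t - s)) \<le> S" for s
  proof -
    have "cmod (\<Sum>t\<in>{1..int n}. g (t - s)) \<le> (\<Sum>t\<in>{1..int n}. cmod (g (t - s)))"
      by (rule norm_sum)
    also have "\<dots> = (\<Sum>l\<in>(\<lambda>t. t - s) ` {1..int n}. cmod (g l))"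
      by (subst sum.reindex) (auto simp: inj_on_def)
    also have "\<dots> \<le> (\<Sum>l\<in>(\<lambda>t. t - s) ` {1..int n}. (1 + \<bar>real_of_int l\<bar>) * cmod (gen_cov P Z l u v))"
      by (intro sum_mono) (simp add: ng distrib_right)
    also have "\<dots> \<le> S" by (rule S) auto
    finally show ?thesis .
  qed
  then have "cmod (dft_cov n w u x v) \<le> (\<Sum>s\<in>{1..int n}. S)"
    unfolding eq by (intro sum_norm_le) (simp add: norm_mult)
  then show ?b by simp
qed

lemma periodogram_measurable [measurable]: "(\<lambda>\<omega>. periodogram Z n \<omega> w u v) \<in> borel_measurable P"
  unfolding periodogram_def dft_exp_def by measurable

lemma norm_periodogram_le: "cmod (periodogram Z n \<omega> w u v) \<le> real n"
proof -
  have "cmod (dft_exp Z n w u \<omega>) \<le> (\<Sum>t = 1..n. 1)" for w u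
    unfolding dft_exp_def by (intro sum_norm_le) (simp add: norm_mult)
  then have d: "cmod (dft_exp Z n w u \<omega>) \<le> real n" for w u by simp
  have "cmod (periodogram Z n \<omega> w u v) \<le> 1 / (2 * pi * real n) * real n * real n"
    unfolding periodogram_def norm_mult by (intro mult_mono d) (auto simp: norm_divide norm_mult)
  also have "\<dots> \<le> real n"
    using pi_gt3 by (cases "n = 0") (auto simp: field_simps)
  finally show ?thesis .
qed

text \<open>
  The product of the two errors has as expectation the covariance of the periodogram ordinates plus the
  product of their biases. The covariance consists of the fourth cumulant term, of order \<open>1/n\<close>, and of two
  pairings \<open>D13 D24\<close> and \<open>D14 D23\<close>, which involve the frequency indices \<open>j - k\<close> and \<open>j + k\<close> and are of order
  \<open>1/n\<^sup>2\<close> unless that index is divisible by \<open>n\<close>. The pairing \<open>D12 D34\<close> is the product of the expectations.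
\<close>

lemma periodogram_error_covariance:
  obtains K where "K \<ge> 0" and "\<And>n j k u v u' v'. j \<in> {1..n - 1} \<Longrightarrow> k \<in> {1..n - 1} \<Longrightarrow>
    cmod (\<integral>\<omega>. (periodogram Z n \<omega> (fourier_freq n j) u v - gen_spectrum P Z (fourier_freq n j) u v) *
      cnj (periodogram Z n \<omega> (fourier_freq n k) u' v' - gen_spectrum P Z (fourier_freq n k) u' v') \<partial>P)
    \<le> K * (1 / real n + of_bool (j = k) + of_bool (j + k = n))"
proof -
  obtain S where S0: "S \<ge> 0" and S: "\<And>u v A. finite A \<Longrightarrow> (\<Sum>l\<in>A. (1 + \<bar>real_of_int l\<bar>) * cmod (gen_cov P Z l u v)) \<le> S"
    by (rule gen_cov_weighted_sums_bounded) blast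
  obtain S4 where S40: "S4 \<ge> 0" and S4: "\<And>u n. (\<Sum>a\<in>{1..int n}. \<Sum>b\<in>{1..int n}. \<Sum>c\<in>{1..int n}. \<Sum>d\<in>{1..int n}.
     cmod (joint_cumulant P (\<lambda>j \<omega>. iexp (u j * Z (quad a b c d j) \<omega>)) {1, 2, 3, 4})) \<le> real n * S4"
    by (rule cumulant4_sums_bounded) blast
  note cov = dft_cov_approx(1)[OF S] and cov_le = dft_cov_approx(2)[OF S]
  define K where "K = S4 + 3 * S\<^sup>2"
  have "cmod (\<integral>\<omega>. (periodogram Z n \<omega> (fourier_freq n j) u v - gen_spectrum P Z (fourier_freq n j) u v) *
      cnj (periodogram Z n \<omega> (fourier_freq n k) u' v' - gen_spectrum P Z (fourier_freq n k) u' v') \<partial>P)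
    \<le> K * (1 / real n + of_bool (j = k) + of_bool (j + k = n))"
    if j: "j \<in> {1..n - 1}" and k: "k \<in> {1..n - 1}" for n j k u v u' v'
  proof -
    have n: "n \<ge> 1" and n0: "real n > 0" using j by auto
    have jk: "0 < j" "j < n" "0 < k" "k < n" using j k n by auto
    define A where "A = 1 / (2 * pi * real n)"
    have "1 * 1 \<le> pi * (real n * 2)" using n pi_gt3 by (intro mult_mono) auto
    then have A: "A \<ge> 0" "A \<le> 1 / real n" "A * real n \<le> 1" "A \<noteq> 0" "A \<le> 1"
      using n pi_gt3 unfolding A_def by (auto simp: field_simps)
    define wj where "wj = fourier_freq n j"
    define wk where "wk = fourier_freq n k"
    have fr: "wj = 2 * pi * real_of_int (int j) / real n" "- wj = 2 * pi * real_of_int (- int j) / real n"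
      "wk = 2 * pi * real_of_int (int k) / real n" "- wk = 2 * pi * real_of_int (- int k) / real n"
      by (simp_all add: wj_def wk_def fourier_freq_def)
    have nd: "\<not> int n dvd int j" "\<not> int n dvd - int j" "\<not> int n dvd int k" "\<not> int n dvd - int k"
      using jk nat_dvd_not_less[of j n] nat_dvd_not_less[of k n] by auto
    \<comment> \<open>The four transforms have frequencies \<open>wj, -wj, -wk, wk\<close>; the last two come from conjugation.\<close>
    define d1 where "d1 = centred_dft n wj u"
    define d2 where "d2 = centred_dft n (- wj) v"
    define d3 where "d3 = centred_dft n (- wk) (- u')"
    define d4 where "d4 = centred_dft n wk (- v')"
    have I1: "periodogram Z n \<omega> wj u v = A * (d1 \<omega> * d2 \<omega>)" for \<omega>
      unfolding periodogram_def d1_def d2_def dft_exp_eq_centred_dft[OF n nd(1) fr(1), symmetric]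
        dft_exp_eq_centred_dft[OF n nd(2) fr(2), symmetric] by (simp add: A_def)
    have I2: "cnj (periodogram Z n \<omega> wk u' v') = A * (d3 \<omega> * d4 \<omega>)" for \<omega>
      unfolding periodogram_def d3_def d4_def dft_exp_eq_centred_dft[OF n nd(3) fr(3), symmetric]
        dft_exp_eq_centred_dft[OF n nd(4) fr(4), symmetric] by (simp add: A_def cnj_dft_exp)
    define f where "f = gen_spectrum P Z wj u v"
    define f' where "f' = gen_spectrum P Z wk u' v'"
    have dmeas [measurable]: "d1 \<in> borel_measurable P" "d2 \<in> borel_measurable P" "d3 \<in> borel_measurable P" "d4 \<in> borel_measurable P"
      unfolding d1_def d2_def d3_def d4_def by measurable
    have db: "cmod (d1 \<omega>) \<le> 2 * real n" "cmod (d2 \<omega>) \<le> 2 * real n" "cmod (d3 \<omega>) \<le> 2 * real n" "cmod (d4 \<omega>) \<le> 2 * real n" for \<omega>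
      unfolding d1_def d2_def d3_def d4_def by (rule norm_centred_dft_le)+
    have i12: "integrable P (\<lambda>\<omega>. d1 \<omega> * d2 \<omega>)"
      by (rule integrable_bounded[where B = "(2 * real n) * (2 * real n)"], measurable, unfold norm_mult)
        (intro mult_mono db; simp)
    have i34: "integrable P (\<lambda>\<omega>. d3 \<omega> * d4 \<omega>)"
      by (rule integrable_bounded[where B = "(2 * real n) * (2 * real n)"], measurable, unfold norm_mult)
        (intro mult_mono db; simp)
    have i1234: "integrable P (\<lambda>\<omega>. d1 \<omega> * d2 \<omega> * (d3 \<omega> * d4 \<omega>))"
      by (rule integrable_bounded[where B = "(2 * real n) * (2 * real n) * ((2 * real n) * (2 * real n))"], measurable, unfold norm_mult)
        (intro mult_mono mult_nonneg_nonneg db; simp)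
    define C where "C = (\<Sum>a\<in>{1..int n}. \<Sum>b\<in>{1..int n}. \<Sum>c\<in>{1..int n}. \<Sum>d\<in>{1..int n}.
      (iexp (- (real_of_int a * wj)) * iexp (- (real_of_int b * (- wj)))) *
      (iexp (- (real_of_int c * (- wk))) * iexp (- (real_of_int d * wk))) *
      joint_cumulant P (\<lambda>j \<omega>. iexp (quad u v (- u') (- v') j * Z (quad a b c d j) \<omega>)) {1, 2, 3, 4})"
    define D12 where "D12 = dft_cov n wj u (- wj) v"
    define D34 where "D34 = dft_cov n (- wk) (- u') wk (- v')"
    define D13 where "D13 = dft_cov n wj u (- wk) (- u')"
    define D24 where "D24 = dft_cov n (- wj) v wk (- v')"
    define D14 where "D14 = dft_cov n wj u wk (- v')"
    define D23 where "D23 = dft_cov n (- wj) v (- wk) (- u')"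
    have e12: "(\<integral>\<omega>. d1 \<omega> * d2 \<omega> \<partial>P) = D12" and e34: "(\<integral>\<omega>. d3 \<omega> * d4 \<omega> \<partial>P) = D34"
      unfolding d1_def d2_def d3_def d4_def D12_def D34_def by (rule integral_centred_dft2)+
    have e1234: "(\<integral>\<omega>. d1 \<omega> * d2 \<omega> * (d3 \<omega> * d4 \<omega>) \<partial>P) = C + D12 * D34 + D13 * D24 + D14 * D23"
      unfolding d1_def d2_def d3_def d4_def D12_def D34_def D13_def D24_def D14_def D23_def C_def
      by (rule integral_centred_dft4)
    have expand: "(A * (d1 \<omega> * d2 \<omega>) - f) * (A * (d3 \<omega> * d4 \<omega>) - cnj f') =
        (A * A) * (d1 \<omega> * d2 \<omega> * (d3 \<omega> * d4 \<omega>)) - (A * cnj f') * (d1 \<omega> * d2 \<omega>) - (f * A) * (d3 \<omega> * d4 \<omega>) + f * cnj f'" for \<omega>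
      by (simp add: algebra_simps)
    have "(\<integral>\<omega>. (A * (d1 \<omega> * d2 \<omega>) - f) * (A * (d3 \<omega> * d4 \<omega>) - cnj f') \<partial>P) =
        (A * A) * (C + D12 * D34 + D13 * D24 + D14 * D23) - (A * cnj f') * D12 - (f * A) * D34 + f * cnj f'"
      unfolding expand using i12 i34 i1234
      by (simp add: e12 e34 e1234 prob_space)
    also have "\<dots> = (A * A) * C + (A * D13) * (A * D24) + (A * D14) * (A * D23) + (A * D12 - f) * (A * D34 - cnj f')"
      by (simp add: algebra_simps)
    finally have main: "(\<integral>\<omega>. (A * (d1 \<omega> * d2 \<omega>) - f) * (A * (d3 \<omega> * d4 \<omega>) - cnj f') \<partial>P) =
       (A * A) * C + (A * D13) * (A * D24) + (A * D14) * (A * D23) + (A * D12 - f) * (A * D34 - cnj f')" .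
    have bC: "cmod ((A * A) * C) \<le> S4 * (1 / real n)"
    proof -
      have "cmod C \<le> (\<Sum>a\<in>{1..int n}. \<Sum>b\<in>{1..int n}. \<Sum>c\<in>{1..int n}. \<Sum>d\<in>{1..int n}.
         cmod (joint_cumulant P (\<lambda>j \<omega>. iexp (quad u v (- u') (- v') j * Z (quad a b c d j) \<omega>)) {1, 2, 3, 4}))"
        unfolding C_def by (intro sum_norm_le) (simp add: norm_mult)
      also have "\<dots> \<le> real n * S4" by (rule S4)
      finally have "cmod ((A * A) * C) \<le> (A * A) * (real n * S4)"
        using A by (simp add: norm_mult mult_left_mono)
      also have "\<dots> = (A * real n) * A * S4" by simp
      also have "\<dots> \<le> 1 * (1 / real n) * S4" using A S40 by (intro mult_mono) auto
      finally show ?thesis by simp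
    qed
    have bD: "cmod (A * dft_cov n w x w' x') \<le> S" for w x w' x'
    proof -
      have "cmod (A * dft_cov n w x w' x') \<le> A * (real n * S)"
        using cov_le A by (simp add: norm_mult mult_left_mono)
      also have "\<dots> \<le> 1 * S" using A S0 by (simp only: mult.assoc[symmetric] mult_right_mono)
      finally show ?thesis by simp
    qed
    have bD0: "cmod (A * dft_cov n w x w' x') \<le> S * A" if "w + w' = 2 * pi * real_of_int m / real n" "\<not> int n dvd m" for w x w' x' m
    proof -
      have "cmod (dft_cov n w x w' x') \<le> S"
        using cov[of n w x w' x'] sum_iexp_fourier_eq_0[OF n that(2)] by (simp add: that(1))
      then show ?thesis using A by (simp add: norm_mult mult_right_mono)
    qed
    have AA: "S * A * (S * A) \<le> S\<^sup>2 * (1 / real n)"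
    proof -
      have "S * A * (S * A) = S\<^sup>2 * (A * A)" by (simp add: power2_eq_square)
      also have "A * A \<le> 1 * (1 / real n)" using A by (intro mult_mono) auto
      finally show ?thesis by (simp add: mult_left_mono)
    qed
    have SS: "0 \<le> S * S / real n" using S0 by simp
    have b1: "cmod ((A * D13) * (A * D24)) \<le> S\<^sup>2 * (1 / real n + of_bool (j = k))"
    proof (cases "j = k")
      case True
      have "cmod ((A * D13) * (A * D24)) \<le> S * S"
        unfolding D13_def D24_def by (rule order_trans[OF eq_refl[OF norm_mult]], intro mult_mono bD) (use S0 in auto)
      moreover have "S\<^sup>2 * (1 / real n + of_bool (j = k)) = S * S / real n + S * S"
        using True by (simp add: power2_eq_square distrib_left)
      ultimately show ?thesis using SS by linarith
    next
      case False
      have nd1: "\<not> int n dvd int j - int k"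
        using dvd_imp_le_int[of "int j - int k" "int n"] False jk by linarith
      then have nd2: "\<not> int n dvd - (int j - int k)" by (simp only: dvd_minus_iff) simp
      have s1: "wj + - wk = 2 * pi * real_of_int (int j - int k) / real n"
        "- wj + wk = 2 * pi * real_of_int (- (int j - int k)) / real n"
        by (simp_all add: wj_def wk_def fourier_freq_def diff_divide_distrib right_diff_distrib)
      have "cmod ((A * D13) * (A * D24)) \<le> (S * A) * (S * A)"
        unfolding D13_def D24_def
        by (rule order_trans[OF eq_refl[OF norm_mult]], intro mult_mono bD0[OF s1(1) nd1] bD0[OF s1(2) nd2])
          (use S0 A in auto)
      then show ?thesis using False AA by simp
    qed
    have b2: "cmod ((A * D14) * (A * D23)) \<le> S\<^sup>2 * (1 / real n + of_bool (j + k = n))"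
    proof (cases "j + k = n")
      case True
      have "cmod ((A * D14) * (A * D23)) \<le> S * S"
        unfolding D14_def D23_def by (rule order_trans[OF eq_refl[OF norm_mult]], intro mult_mono bD) (use S0 in auto)
      moreover have "S\<^sup>2 * (1 / real n + of_bool (j + k = n)) = S * S / real n + S * S"
        using True by (simp add: power2_eq_square distrib_left)
      ultimately show ?thesis using SS by linarith
    next
      case False
      \<comment> \<open>Since \<open>0 < j + k < 2n\<close>, the only multiple of \<open>n\<close> that \<open>j + k\<close> can be is \<open>n\<close> itself.\<close>
      have "\<not> int n dvd int j + int k"
      proof
        assume "int n dvd int j + int k"
        then obtain q where q: "int j + int k = int n * q" by auto
        have "0 < int n * q" "int n * q < int n * 2" using jk by (simp_all add: q[symmetric])
        then have "q > 0" "q < 2" using n by (simp_all add: zero_less_mult_iff)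
        then have "q = 1" by simp
        with q False show False by simp
      qed
      note nd1 = this
      then have nd2: "\<not> int n dvd - (int j + int k)" by (simp only: dvd_minus_iff) simp
      have s1: "wj + wk = 2 * pi * real_of_int (int j + int k) / real n"
        "- wj + - wk = 2 * pi * real_of_int (- (int j + int k)) / real n"
        by (simp_all add: wj_def wk_def fourier_freq_def add_divide_distrib diff_divide_distrib distrib_left right_diff_distrib)
      have "cmod ((A * D14) * (A * D23)) \<le> (S * A) * (S * A)"
        unfolding D14_def D23_def
        by (rule order_trans[OF eq_refl[OF norm_mult]], intro mult_mono bD0[OF s1(1) nd1] bD0[OF s1(2) nd2])
          (use S0 A in auto)
      then show ?thesis using False AA by simp
    qed
    have bias: "cmod (A * dft_cov n w x (- w) y - gen_spectrum P Z w x y) \<le> S * A" for w x y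
    proof -
      have "A * (of_nat n * (2 * pi * gen_spectrum P Z w x y)) = gen_spectrum P Z w x y"
        using n0 by (simp add: A_def)
      then have "A * dft_cov n w x (- w) y - gen_spectrum P Z w x y = A * (dft_cov n w x (- w) y - of_nat n * (2 * pi * gen_spectrum P Z w x y))"
        by (simp only: right_diff_distrib)
      also have "cmod \<dots> \<le> A * S"
        using cov[of n w x "- w" y] A by (simp add: norm_mult mult_left_mono)
      finally show ?thesis by (simp add: mult.commute)
    qed
    have D34: "D34 = cnj (dft_cov n wk u' (- wk) v')"
    proof -
      note dft = integral_centred_dft2[symmetric]
        dft_exp_eq_centred_dft[OF n nd(3) fr(3), symmetric] dft_exp_eq_centred_dft[OF n nd(4) fr(4), symmetric]
      have "D34 = (\<integral>\<omega>. cnj (dft_exp Z n wk u' \<omega> * dft_exp Z n (- wk) v' \<omega>) \<partial>P)"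
        unfolding D34_def dft complex_cnj_mult cnj_dft_exp minus_minus ..
      also have "\<dots> = cnj (\<integral>\<omega>. dft_exp Z n wk u' \<omega> * dft_exp Z n (- wk) v' \<omega> \<partial>P)"
        by (rule Bochner_Integration.integral_cnj)
      finally show ?thesis unfolding dft .
    qed
    have "cmod (A * D34 - cnj f') \<le> S * A"
      using bias[of wk u' v'] unfolding D34 f'_def
      by (metis complex_cnj_complex_of_real complex_cnj_diff complex_cnj_mult complex_mod_cnj)
    then have b3: "cmod ((A * D12 - f) * (A * D34 - cnj f')) \<le> S\<^sup>2 * (1 / real n)"
      using bias[of wj u v] S0 A(1) unfolding norm_mult D12_def f_def
      by (intro order_trans[OF mult_mono AA]) auto
    have "cmod (\<integral>\<omega>. (A * (d1 \<omega> * d2 \<omega>) - f) * (A * (d3 \<omega> * d4 \<omega>) - cnj f') \<partial>P) \<le>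
       S4 * (1 / real n) + S\<^sup>2 * (1 / real n + of_bool (j = k)) + S\<^sup>2 * (1 / real n + of_bool (j + k = n)) + S\<^sup>2 * (1 / real n)"
      unfolding main by (intro order_trans[OF norm_triangle_ineq] add_mono bC b1 b2 b3)
    also have "\<dots> \<le> K * (1 / real n + of_bool (j = k) + of_bool (j + k = n))"
      using S40 unfolding K_def by (simp add: algebra_simps)
    finally show ?thesis
      unfolding wj_def[symmetric] wk_def[symmetric] complex_cnj_diff I1 I2 f_def[symmetric] f'_def[symmetric] .
  qed
  moreover have "K \<ge> 0" using S40 by (simp add: K_def)
  ultimately show thesis using that by blast
qed

text \<open>
  The approximation of \<open>dft_cov\<close> at \<open>n = 1\<close> and \<open>x = -w\<close> already bounds the spectrum.
\<close>

lemma gen_spectrum_bounded: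
  obtains K where "\<And>w u v. cmod (gen_spectrum P Z w u v) \<le> K"
proof -
  obtain S where S0: "S \<ge> 0" and S: "\<And>u v A. finite A \<Longrightarrow> (\<Sum>l\<in>A. (1 + \<bar>real_of_int l\<bar>) * cmod (gen_cov P Z l u v)) \<le> S"
    by (rule gen_cov_weighted_sums_bounded) blast
  have "cmod (gen_spectrum P Z w u v) \<le> S" for w u v
  proof -
    have one: "(\<Sum>s\<in>{1..int 1}. iexp (- (real_of_int s * (w + - w)))) = 1" by simp
    have "cmod (dft_cov 1 w u (- w) v - 2 * pi * gen_spectrum P Z w u v) \<le> S"
      using dft_cov_approx(1)[of u v S 1 w "- w", OF S] by (simp only: one mult_1)
    moreover have "cmod (dft_cov 1 w u (- w) v) \<le> S"
      using dft_cov_approx(2)[of u v S 1 w "- w", OF S] by (simp only: of_nat_1 mult_1)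
    moreover have "cmod (2 * pi * gen_spectrum P Z w u v) \<le> cmod (dft_cov 1 w u (- w) v)
        + cmod (dft_cov 1 w u (- w) v - 2 * pi * gen_spectrum P Z w u v)"
      by (rule norm_triangle_sub[of "2 * pi * gen_spectrum P Z w u v" "dft_cov 1 w u (- w) v", unfolded norm_minus_commute[of _ "dft_cov 1 w u (- w) v"]])
    ultimately have "cmod (2 * pi * gen_spectrum P Z w u v) \<le> S + S" by linarith
    then have "(2 * pi) * cmod (gen_spectrum P Z w u v) \<le> 2 * S" by (simp add: norm_mult)
    moreover have "2 * cmod (gen_spectrum P Z w u v) \<le> (2 * pi) * cmod (gen_spectrum P Z w u v)"
      using pi_gt3 by (intro mult_right_mono) auto
    ultimately show ?thesis by simp
  qed
  then show thesis using that by blast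
qed

lemma gen_cov_summable: "(\<lambda>l. gen_cov P Z l u v) summable_on UNIV"
proof -
  obtain S where S: "\<And>u v A. finite A \<Longrightarrow> (\<Sum>l\<in>A. (1 + \<bar>real_of_int l\<bar>) * cmod (gen_cov P Z l u v)) \<le> S"
    by (rule gen_cov_weighted_sums_bounded) blast
  have "(\<Sum>l\<in>A. cmod (gen_cov P Z l u v)) \<le> S" if "finite A" for A
  proof -
    have "(\<Sum>l\<in>A. cmod (gen_cov P Z l u v)) \<le> (\<Sum>l\<in>A. (1 + \<bar>real_of_int l\<bar>) * cmod (gen_cov P Z l u v))"
      by (intro sum_mono) (simp add: distrib_right)
    then show ?thesis using S[OF that, of u v] by simp
  qed
  then have "(\<lambda>l. cmod (gen_cov P Z l u v)) summable_on UNIV"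
    by (intro nonneg_bdd_above_summable_on bdd_aboveI[of _ S]) auto
  then show ?thesis by (rule abs_summable_summable)
qed

end

section \<open>Exceptional sets, piecewise Hoelder functions and measurability of spectra\<close>

text \<open>
  For nonempty \<open>S\<close> the infimum of distances is \<open>infdist\<close>, whose continuity makes the neighbourhoods closed and
  whose triangle inequality nests them.
\<close>

lemma mem_S_nbhd_iff:
  "p \<in> S_nbhd L S \<epsilon> \<longleftrightarrow> p \<in> {-L..L} \<times> {-L..L} \<and> S \<noteq> {} \<and> infdist p S \<le> \<epsilon>"
proof (cases "S = {}")
  case True
  then show ?thesis by (simp add: S_nbhd_def top_ereal_def)
next
  case False
  have "ereal (infdist p S) = (INF q\<in>S. ereal (dist p q))"
    using ereal_Inf'[of "dist p ` S"] False
    by (auto simp: infdist_def image_image intro!: bdd_belowI[of _ 0])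
  then show ?thesis using False by (simp add: S_nbhd_def flip: ereal_less_eq(3))
qed

lemma S_nbhd_eq: "S_nbhd L S \<epsilon> = (if S = {} then {} else ({-L..L} \<times> {-L..L}) \<inter> {p. infdist p S \<le> \<epsilon>})"
  by (auto simp: mem_S_nbhd_iff)

lemma closed_S_nbhd: "closed (S_nbhd L S \<epsilon>)"
  unfolding S_nbhd_eq by (auto intro!: closed_Int closed_Times closed_Collect_le continuous_intros)

lemma S_nbhd_subset_box: "S_nbhd L S \<epsilon> \<subseteq> {-L..L} \<times> {-L..L}"
  by (auto simp: S_nbhd_def)

lemma square_cbox: "{-L..L} \<times> {-L..L} = cbox (-L, -L) (L, L :: real)"
  by (simp add: cbox_Pair_eq)

lemma S_nbhd_lmeasurable: "S_nbhd L S \<epsilon> \<in> fmeasurable lborel"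
proof (rule fmeasurableI2)
  show "{-L..L} \<times> {-L..L} \<in> fmeasurable (lborel :: (real \<times> real) measure)"
    unfolding square_cbox by (rule fmeasurable_cbox)
  show "S_nbhd L S \<epsilon> \<in> sets lborel" using closed_S_nbhd by auto
qed (rule S_nbhd_subset_box)

lemma measure_S_nbhd_tendsto_0:
  assumes "admissible_set L S"
  shows "((\<lambda>\<epsilon>. measure lborel (S_nbhd L S \<epsilon>)) \<longlongrightarrow> 0) (at_right 0)"
proof -
  have "(\<lambda>\<epsilon>. measure lborel (S_nbhd L S \<epsilon>)) \<in> O[at_right 0](\<lambda>\<epsilon>. \<epsilon>)"
    using assms by (simp add: admissible_set_def)
  then obtain c where "\<forall>\<^sub>F \<epsilon> in at_right 0. norm (measure lborel (S_nbhd L S \<epsilon>)) \<le> c * norm \<epsilon>"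
    by (rule landau_o.bigE)
  moreover have "((\<lambda>\<epsilon>::real. c * norm \<epsilon>) \<longlongrightarrow> 0) (at_right 0)"
    by (intro tendsto_mult_right_zero tendsto_norm_zero tendsto_ident_at)
  ultimately show ?thesis by (rule Lim_null_comparison)
qed

lemma admissible_set_null:
  assumes "admissible_set L S"
  shows "S \<in> null_sets lborel"
proof -
  have S: "closed S" "S \<subseteq> {-L..L} \<times> {-L..L}" using assms by (auto simp: admissible_set_def)
  have sub: "S \<subseteq> S_nbhd L S \<epsilon>" if "\<epsilon> > 0" for \<epsilon>
    using S that by (auto simp: mem_S_nbhd_iff infdist_zero)
  have Sm: "S \<in> fmeasurable lborel"
    using S sub[of 1] by (intro fmeasurableI2[OF S_nbhd_lmeasurable[of L S 1]]) auto
  have "measure lborel S \<le> 0"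
  proof (rule tendsto_lowerbound[OF measure_S_nbhd_tendsto_0[OF assms]])
    show "\<forall>\<^sub>F \<epsilon> in at_right 0. measure lborel S \<le> measure lborel (S_nbhd L S \<epsilon>)"
      using eventually_at_right_less
      by eventually_elim (intro measure_mono_fmeasurable sub S_nbhd_lmeasurable, use Sm in \<open>auto simp: fmeasurable_def\<close>)
  qed simp
  then have "measure lborel S = 0" by (simp add: measure_le_0_iff)
  then show ?thesis using Sm by (auto simp: null_sets_def fmeasurable_def emeasure_eq_ennreal_measure)
qed

text \<open>
  A point outside the closed set \<open>S\<close> has positive distance from it. With \<open>\<epsilon>\<close> half that distance, the Hoelder
  bound applies to the limit and to almost all members of the sequence.
\<close>

lemma PH_tendsto:
  fixes g :: "real \<Rightarrow> real \<Rightarrow> real \<Rightarrow> complex"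
  assumes PH: "PH L g S \<tau> \<alpha> \<beta>" and "\<alpha> > 0" "\<beta> > 0" and "closed S"
    and pt: "w \<in> {0..2 * pi}" "(u, v) \<in> {-L..L} \<times> {-L..L}" "(u, v) \<notin> S"
    and sq: "\<And>k. W k \<in> {0..2 * pi}" "\<And>k. (U k, V k) \<in> {-L..L} \<times> {-L..L}"
    and lim: "W \<longlonglongrightarrow> w" "U \<longlonglongrightarrow> u" "V \<longlonglongrightarrow> v"
  shows "(\<lambda>k. g (W k) (U k) (V k)) \<longlonglongrightarrow> g w u v"
proof -
  define \<epsilon> where "\<epsilon> = (if S = {} then 1 else infdist (u, v) S / 2)"
  have pos: "infdist (u, v) S > 0" if "S \<noteq> {}"
  proof -
    have "infdist (u, v) S \<noteq> 0"
      using in_closed_iff_infdist_zero[OF \<open>closed S\<close> that, of "(u, v)"] pt(3) by simp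
    then show ?thesis using infdist_nonneg[of "(u, v)" S] by linarith
  qed
  then have "\<epsilon> > 0" by (simp add: \<epsilon>_def)
  define A where "A = {-L..L} \<times> {-L..L} - S_nbhd L S \<epsilon>"
  obtain C where "C > 0" and C0: "\<forall>\<epsilon>>0. \<forall>w\<in>{0..2 * pi}. \<forall>w'\<in>{0..2 * pi}.
      \<forall>(u, v)\<in>{-L..L} \<times> {-L..L} - S_nbhd L S \<epsilon>. \<forall>(u', v')\<in>{-L..L} \<times> {-L..L} - S_nbhd L S \<epsilon>.
      cmod (g w u v - g w' u' v') \<le> C * \<epsilon> powr (- \<tau>) * (\<bar>w - w'\<bar> powr \<alpha> + norm ((u, v) - (u', v')) powr \<beta>)"
    using PH unfolding PH_def by (elim exE conjE) (rule that)
  note C = C0[THEN spec, THEN mp, OF \<open>\<epsilon> > 0\<close>, folded A_def]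
  have hoelder: "cmod (g w1 u1 v1 - g w2 u2 v2) \<le> C * \<epsilon> powr (- \<tau>) * (\<bar>w1 - w2\<bar> powr \<alpha> + norm ((u1, v1) - (u2, v2)) powr \<beta>)"
    if "w1 \<in> {0..2 * pi}" "w2 \<in> {0..2 * pi}" "(u1, v1) \<in> A" "(u2, v2) \<in> A" for w1 w2 u1 v1 u2 v2
    using bspec[OF bspec[OF bspec[OF bspec[OF C that(1)] that(2)] that(3), unfolded prod.case] that(4)] by simp
  have out: "(u, v) \<in> A"
    using pt pos by (auto simp: A_def mem_S_nbhd_iff \<epsilon>_def)
  have limUV: "(\<lambda>k. (U k, V k)) \<longlonglongrightarrow> (u, v)" using lim by (intro tendsto_Pair)
  have "\<forall>\<^sub>F k in sequentially. (U k, V k) \<in> A"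
  proof (cases "S = {}")
    case True
    then show ?thesis using sq by (auto simp: A_def mem_S_nbhd_iff)
  next
    case False
    have "(\<lambda>k. infdist (U k, V k) S) \<longlonglongrightarrow> infdist (u, v) S"
      by (intro tendsto_infdist limUV)
    then have "\<forall>\<^sub>F k in sequentially. \<epsilon> < infdist (U k, V k) S"
      by (rule order_tendstoD(1)) (use pos[OF False] False in \<open>simp add: \<epsilon>_def\<close>)
    then show ?thesis by (rule eventually_mono) (use sq in \<open>simp add: A_def mem_S_nbhd_iff\<close>)
  qed
  then have ev: "\<forall>\<^sub>F k in sequentially. cmod (g (W k) (U k) (V k) - g w u v) \<le>
      C * \<epsilon> powr (- \<tau>) * (\<bar>W k - w\<bar> powr \<alpha> + norm ((U k, V k) - (u, v)) powr \<beta>)"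
    by (rule eventually_mono) (intro hoelder sq pt out)
  have lim0: "(\<lambda>k. C * \<epsilon> powr (- \<tau>) * (\<bar>W k - w\<bar> powr \<alpha> + norm ((U k, V k) - (u, v)) powr \<beta>)) \<longlonglongrightarrow>
      C * \<epsilon> powr (- \<tau>) * (0 + 0)"
  proof (intro tendsto_intros)
    have "(\<lambda>k. \<bar>W k - w\<bar>) \<longlonglongrightarrow> 0" using lim(1) by (simp add: LIM_zero tendsto_rabs_zero)
    then show "(\<lambda>k. \<bar>W k - w\<bar> powr \<alpha>) \<longlonglongrightarrow> 0" using \<open>\<alpha> > 0\<close> by (intro tendsto_zero_powrI[where b = \<alpha>]) auto
    have "(\<lambda>k. norm ((U k, V k) - (u, v))) \<longlonglongrightarrow> 0" using limUV by (intro tendsto_norm_zero LIM_zero)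
    then show "(\<lambda>k. norm ((U k, V k) - (u, v)) powr \<beta>) \<longlonglongrightarrow> 0" using \<open>\<beta> > 0\<close> by (intro tendsto_zero_powrI[where b = \<beta>]) auto
  qed
  then have "(\<lambda>k. C * \<epsilon> powr (- \<tau>) * (\<bar>W k - w\<bar> powr \<alpha> + norm ((U k, V k) - (u, v)) powr \<beta>)) \<longlonglongrightarrow> 0"
    by (simp only: add_0_right mult_zero_right)
  with ev have "(\<lambda>k. g (W k) (U k) (V k) - g w u v) \<longlonglongrightarrow> 0"
    by (rule Lim_null_comparison)
  then show ?thesis by (rule LIM_zero_cancel)
qed

text \<open>
  The covariances depend measurably on \<open>(u, v)\<close> as integrals with parameters, and the series is the pointwise
  limit of its symmetric partial sums. The Hoelder conditions alone would not give Borel measurability on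
  the exceptional set.
\<close>

lemma gen_spectrum_borel_measurable:
  assumes "prob_space Q" "strictly_stationary Q X"
    and summ: "\<And>u v. (\<lambda>l. gen_cov Q X l u v) summable_on UNIV"
  shows "(\<lambda>x. gen_spectrum Q X (fst x) (fst (snd x)) (snd (snd x))) \<in> borel_measurable borel"
proof -
  interpret prob_space Q by fact
  have "\<forall>t. X t \<in> borel_measurable Q"
    using assms(2) unfolding strictly_stationary_def by (rule conjunct1)
  then have [measurable]: "X t \<in> borel_measurable Q" for t by (rule spec)
  have [measurable]: "(\<lambda>p. X t (snd p)) \<in> borel_measurable ((borel :: (real \<times> real \<times> real) measure) \<Otimes>\<^sub>M Q)" for t
    by (rule measurable_compose[OF measurable_snd]) measurable
  have exp_meas: "(\<lambda>x. \<integral>\<omega>. iexp (a x * X l \<omega> + b x * X 0 \<omega>) \<partial>Q) \<in> borel_measurable borel"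
    if [measurable]: "a \<in> borel_measurable borel" "b \<in> borel_measurable borel"
    for l and a b :: "real \<times> real \<times> real \<Rightarrow> real"
  proof (rule borel_measurable_lebesgue_integral)
    have [measurable]: "(\<lambda>p. a (fst p)) \<in> borel_measurable (borel \<Otimes>\<^sub>M Q)" "(\<lambda>p. b (fst p)) \<in> borel_measurable (borel \<Otimes>\<^sub>M Q)"
      by (rule measurable_compose[OF measurable_fst that(1)] measurable_compose[OF measurable_fst that(2)])+
    show "(\<lambda>(x, \<omega>). iexp (a x * X l \<omega> + b x * X 0 \<omega>)) \<in> borel_measurable (borel \<Otimes>\<^sub>M Q)"
      unfolding split_beta by measurable
  qed
  have c [measurable]: "(\<lambda>x. fst (snd x)) \<in> borel_measurable (borel :: (real \<times> real \<times> real) measure)"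
    "(\<lambda>x. snd (snd x)) \<in> borel_measurable (borel :: (real \<times> real \<times> real) measure)"
    by (intro borel_measurable_continuous_onI continuous_intros)+
  have zero: "(\<lambda>x. 0) \<in> borel_measurable (borel :: (real \<times> real \<times> real) measure)" by (rule borel_measurable_const)
  have cov: "(\<lambda>x. gen_cov Q X l (fst (snd x)) (snd (snd x))) \<in> borel_measurable (borel :: (real \<times> real \<times> real) measure)" for l
    unfolding gen_cov_def
    by (intro borel_measurable_diff borel_measurable_times exp_meas[OF c]
        exp_meas[OF c(1) zero, simplified mult_zero_left add_0_right] exp_meas[OF c(2) zero, simplified mult_zero_left add_0_right])
  have osc: "(\<lambda>x. iexp (- (real_of_int l * fst x))) \<in> borel_measurable (borel :: (real \<times> real \<times> real) measure)" for l
    by (intro borel_measurable_continuous_onI continuous_intros)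
  define G where "G n x = (\<Sum>l\<in>{- int n..int n}. gen_cov Q X l (fst (snd x)) (snd (snd x)) * iexp (- (real_of_int l * fst x)))"
    for n and x :: "real \<times> real \<times> real"
  have exh: "filterlim (\<lambda>n. {- int n..int n}) (finite_subsets_at_top UNIV) sequentially"
    unfolding filterlim_finite_subsets_at_top
  proof (intro allI impI)
    fix A :: "int set" assume "finite A \<and> A \<subseteq> UNIV"
    then have fin: "finite ((\<lambda>l. nat \<bar>l\<bar>) ` A)" by simp
    show "\<forall>\<^sub>F n in sequentially. finite {- int n..int n} \<and> A \<subseteq> {- int n..int n} \<and> {- int n..int n} \<subseteq> UNIV"
      using eventually_ge_at_top[of "Max ((\<lambda>l. nat \<bar>l\<bar>) ` A)"]
    proof eventually_elim
      case (elim n)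
      have "nat \<bar>l\<bar> \<le> n" if "l \<in> A" for l
        using Max_ge[OF fin, of "nat \<bar>l\<bar>"] that elim by fastforce
      then have "A \<subseteq> {- int n..int n}" by fastforce
      then show ?case by simp
    qed
  qed
  have lim: "(\<lambda>n. G n x) \<longlonglongrightarrow> (\<Sum>\<^sub>\<infinity>l. gen_cov Q X l (fst (snd x)) (snd (snd x)) * iexp (- (real_of_int l * fst x)))" for x
  proof -
    have "(\<lambda>l. cmod (gen_cov Q X l (fst (snd x)) (snd (snd x)))) summable_on UNIV"
      using summ[of "fst (snd x)" "snd (snd x)"] by (simp add: summable_on_iff_abs_summable_on_complex)
    then have "(\<lambda>l. gen_cov Q X l (fst (snd x)) (snd (snd x)) * iexp (- (real_of_int l * fst x))) summable_on UNIV"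
      using abs_summable_summable[where f = "\<lambda>l. gen_cov Q X l (fst (snd x)) (snd (snd x)) * iexp (- (real_of_int l * fst x))"] by (simp add: norm_mult)
    then have "(sum (\<lambda>l. gen_cov Q X l (fst (snd x)) (snd (snd x)) * iexp (- (real_of_int l * fst x))) \<longlongrightarrow>
        (\<Sum>\<^sub>\<infinity>l. gen_cov Q X l (fst (snd x)) (snd (snd x)) * iexp (- (real_of_int l * fst x)))) (finite_subsets_at_top UNIV)"
      using has_sum_infsum unfolding has_sum_def by blast
    from filterlim_compose[OF this exh] show ?thesis unfolding G_def .
  qed
  have [measurable]: "G n \<in> borel_measurable borel" for n
    unfolding G_def by (intro borel_measurable_sum borel_measurable_times cov osc)
  have "(\<lambda>x. \<Sum>\<^sub>\<infinity>l. gen_cov Q X l (fst (snd x)) (snd (snd x)) * iexp (- (real_of_int l * fst x))) \<in> borel_measurable borel"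
    by (rule borel_measurable_LIMSEQ_metric[OF _ lim]) measurable
  then show ?thesis unfolding gen_spectrum_def by (intro borel_measurable_times borel_measurable_const)
qed

section \<open>Riemann sums over the frequency grid\<close>

lemma emeasure_lborel_Times:
  fixes A :: "'a::euclidean_space set" and B :: "'b::euclidean_space set"
  assumes "A \<in> sets borel" "B \<in> sets borel"
  shows "emeasure lborel (A \<times> B) = emeasure lborel A * emeasure lborel B"
  using assms by (simp add: lborel_prod[symmetric] lborel.emeasure_pair_measure_Times)

definition spectral_box :: "real \<Rightarrow> (real \<times> real \<times> real) set" where
  "spectral_box L = {0..2 * pi} \<times> {-L..L} \<times> {-L..L}"

lemma spectral_box_lmeasurable: "spectral_box L \<in> fmeasurable lborel"
proof -
  have "spectral_box L = cbox (0, -L, -L) (2 * pi, L, L)"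
    by (simp add: spectral_box_def cbox_Pair_eq)
  then show ?thesis by (simp only: fmeasurable_cbox)
qed

lemma integrable_on_spectral_box:
  fixes q :: "real \<times> real \<times> real \<Rightarrow> real"
  assumes [measurable]: "q \<in> borel_measurable borel" and bnd: "\<And>x. x \<in> spectral_box L \<Longrightarrow> \<bar>q x\<bar> \<le> K"
  shows "integrable lborel (\<lambda>x. indicat_real (spectral_box L) x * q x)"
  unfolding real_scaleR_def[symmetric] using spectral_box_lmeasurable[of L] bnd
  by (intro integrableI_bounded_set_indicator[where B = K]) (auto simp: fmeasurable_def)

text \<open>
  Fubini's theorem, in the order \<open>w\<close>, \<open>u\<close>, \<open>v\<close> of the arguments of \<open>f\<close>; the two inner integrals of the
  divergence are thereby exchanged.
\<close>

lemma divergence_eq_box_integral: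
  fixes f g :: "real \<Rightarrow> real \<Rightarrow> real \<Rightarrow> complex"
  assumes f: "(\<lambda>x. f (fst x) (fst (snd x)) (snd (snd x))) \<in> borel_measurable borel"
    and g: "(\<lambda>x. g (fst x) (fst (snd x)) (snd (snd x))) \<in> borel_measurable borel"
    and bnd: "\<And>w u v. (w, u, v) \<in> spectral_box L \<Longrightarrow> (cmod (f w u v - g w u v))\<^sup>2 \<le> K"
  shows "divergence L f g = (\<integral>x. indicat_real (spectral_box L) x *
     (cmod (f (fst x) (fst (snd x)) (snd (snd x)) - g (fst x) (fst (snd x)) (snd (snd x))))\<^sup>2 \<partial>lborel)"
proof -
  define q where "q x = (cmod (f (fst x) (fst (snd x)) (snd (snd x)) - g (fst x) (fst (snd x)) (snd (snd x))))\<^sup>2" for x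
  define h where "h x = indicat_real (spectral_box L) x * q x" for x
  have q [measurable]: "q \<in> borel_measurable borel"
    unfolding q_def
    by (rule borel_measurable_power[OF measurable_compose[OF borel_measurable_diff[OF f g] borel_measurable_norm]])
  have "integrable lborel h"
    unfolding h_def by (rule integrable_on_spectral_box[OF q, where K = K]) (auto simp: q_def bnd)
  then have int3: "integrable (lborel \<Otimes>\<^sub>M lborel) h" by (simp add: lborel_prod)
  have int2: "integrable (lborel \<Otimes>\<^sub>M lborel) (case_prod (\<lambda>u v. h (w, u, v)))" for w
  proof -
    have [measurable]: "(\<lambda>p. q (w, p)) \<in> borel_measurable borel"
      by (rule measurable_compose[OF _ q]) (simp add: borel_measurable_Pair)
    have "integrable lborel (\<lambda>p. indicat_real ({-L..L} \<times> {-L..L}) p *\<^sub>R (indicat_real {0..2 * pi} w * q (w, p)))"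
    proof (rule integrableI_bounded_set_indicator[where B = K])
      show "{-L..L} \<times> {-L..L} \<in> sets lborel" "emeasure lborel ({-L..L} \<times> {-L..L} :: (real \<times> real) set) < \<infinity>"
        unfolding square_cbox using fmeasurable_cbox[of "(-L, -L)" "(L, L)"] by (auto simp: fmeasurable_def)
      have "norm (indicat_real {0..2 * pi} w * q (w, p)) \<le> K" if p: "p \<in> {-L..L} \<times> {-L..L}" for p
      proof -
        obtain u v where uv: "p = (u, v)" by (cases p)
        have "0 \<le> (cmod (f 0 u v - g 0 u v))\<^sup>2" by simp
        also have "\<dots> \<le> K" using p by (intro bnd) (auto simp: uv spectral_box_def)
        finally have "0 \<le> K" .
        then show ?thesis
          using bnd[of w u v] p by (auto simp: uv indicator_def q_def spectral_box_def)
      qed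
      then show "AE p in lborel. p \<in> {-L..L} \<times> {-L..L} \<longrightarrow> norm (indicat_real {0..2 * pi} w * q (w, p)) \<le> K"
        by (intro AE_I2 impI)
    qed measurable
    moreover have "(\<lambda>p. indicat_real ({-L..L} \<times> {-L..L}) p *\<^sub>R (indicat_real {0..2 * pi} w * q (w, p))) = case_prod (\<lambda>u v. h (w, u, v))"
      by (auto simp: h_def spectral_box_def indicator_def)
    ultimately show ?thesis by (simp add: lborel_prod)
  qed
  have "divergence L f g = (\<integral>w. (\<integral>v. (\<integral>u. h (w, u, v) \<partial>lborel) \<partial>lborel) \<partial>lborel)"
    unfolding divergence_def set_lebesgue_integral_def real_scaleR_def
  proof (intro Bochner_Integration.integral_cong refl)
    fix w :: real
    have "(\<integral>u. h (w, u, v) \<partial>lborel) = indicat_real {0..2 * pi} w *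
       (indicat_real {-L..L} v * (\<integral>u. indicat_real {-L..L} u * (cmod (f w u v - g w u v))\<^sup>2 \<partial>lborel))" for v
      unfolding integral_mult_right_zero[symmetric]
      by (intro Bochner_Integration.integral_cong refl) (auto simp: h_def q_def spectral_box_def indicator_def)
    then show "indicat_real {0..2 * pi} w * (\<integral>v. indicat_real {-L..L} v *
        (\<integral>u. indicat_real {-L..L} u * (cmod (f w u v - g w u v))\<^sup>2 \<partial>lborel) \<partial>lborel) =
       (\<integral>v. (\<integral>u. h (w, u, v) \<partial>lborel) \<partial>lborel)"
      by simp
  qed
  also have "\<dots> = (\<integral>w. (\<integral>p. h (w, p) \<partial>(lborel \<Otimes>\<^sub>M lborel)) \<partial>lborel)"
    by (simp only: lborel_pair.integral_snd[OF int2] case_prod_unfold prod.collapse)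
  also have "\<dots> = (\<integral>w. (\<integral>p. h (w, p) \<partial>lborel) \<partial>lborel)"
    by (simp add: lborel_prod)
  also have "\<dots> = (\<integral>x. h x \<partial>(lborel \<Otimes>\<^sub>M lborel))"
    by (rule lborel_pair.integral_fst'[OF int3])
  finally show ?thesis by (simp add: lborel_prod h_def q_def)
qed

definition grid_sum :: "real \<Rightarrow> nat \<Rightarrow> nat \<Rightarrow> (real \<Rightarrow> real \<Rightarrow> real \<Rightarrow> real) \<Rightarrow> real" where
  "grid_sum L m n g = 8 * pi * L\<^sup>2 / (real n * (real m)\<^sup>2) *
     (\<Sum>j = 1..n - 1. \<Sum>i1 = 1..m. \<Sum>i2 = 1..m. g (fourier_freq n j) (grid_point L m i1) (grid_point L m i2))"

definition grid_cell :: "real \<Rightarrow> nat \<Rightarrow> nat \<Rightarrow> nat \<Rightarrow> nat \<Rightarrow> nat \<Rightarrow> (real \<times> real \<times> real) set" where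
  "grid_cell L m n j i1 i2 = {fourier_freq n (j - 1)<..fourier_freq n j} \<times>
     {grid_point L m (i1 - 1)<..grid_point L m i1} \<times> {grid_point L m (i2 - 1)<..grid_point L m i2}"

text \<open>
  The step function that takes on each cell the value of \<open>g\<close> at the upper corner; its integral is
  \<open>grid_sum\<close>, so that convergence theorems for integrals apply to the sums.
\<close>

definition grid_step :: "real \<Rightarrow> nat \<Rightarrow> nat \<Rightarrow> (real \<Rightarrow> real \<Rightarrow> real \<Rightarrow> real) \<Rightarrow> real \<times> real \<times> real \<Rightarrow> real" where
  "grid_step L m n g x = (\<Sum>j = 1..n - 1. \<Sum>i1 = 1..m. \<Sum>i2 = 1..m.
     indicat_real (grid_cell L m n j i1 i2) x * g (fourier_freq n j) (grid_point L m i1) (grid_point L m i2))"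

lemma fourier_freq_pred: "j \<ge> 1 \<Longrightarrow> fourier_freq n (j - 1) = fourier_freq n j - 2 * pi / real n"
  by (simp add: fourier_freq_def of_nat_diff diff_divide_distrib right_diff_distrib)

lemma grid_point_pred: "i \<ge> 1 \<Longrightarrow> grid_point L m (i - 1) = grid_point L m i - 2 * L / real m"
  by (simp add: grid_point_def of_nat_diff diff_divide_distrib right_diff_distrib)

lemma
  assumes "j \<ge> 1" "i1 \<ge> 1" "i2 \<ge> 1" "L > 0"
  shows grid_cell_lmeasurable: "grid_cell L m n j i1 i2 \<in> fmeasurable lborel"
    and measure_grid_cell: "measure lborel (grid_cell L m n j i1 i2) = 8 * pi * L\<^sup>2 / (real n * (real m)\<^sup>2)"
proof -
  have mult3: "ennreal a * (ennreal b * ennreal b) = ennreal (a * (b * b))" if "a \<ge> 0" "b \<ge> 0" for a b :: real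
    using that by (simp add: ennreal_mult)
  have em: "emeasure lborel (grid_cell L m n j i1 i2) = ennreal (2 * pi / real n) * (ennreal (2 * L / real m) * ennreal (2 * L / real m))"
    using assms unfolding grid_cell_def
    by (simp add: emeasure_lborel_Times borel_Times fourier_freq_pred[simplified] grid_point_pred[simplified])
  also have "\<dots> = ennreal (2 * pi / real n * (2 * L / real m * (2 * L / real m)))"
    using assms by (intro mult3) auto
  also have "2 * pi / real n * (2 * L / real m * (2 * L / real m)) = 8 * pi * L\<^sup>2 / (real n * (real m)\<^sup>2)"
    by (simp add: power2_eq_square)
  finally have em: "emeasure lborel (grid_cell L m n j i1 i2) = ennreal (8 * pi * L\<^sup>2 / (real n * (real m)\<^sup>2))" .
  have "grid_cell L m n j i1 i2 \<in> sets borel"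
    unfolding grid_cell_def by (intro borel_Times) auto
  with em show "grid_cell L m n j i1 i2 \<in> fmeasurable lborel" by (simp add: fmeasurable_def)
  show "measure lborel (grid_cell L m n j i1 i2) = 8 * pi * L\<^sup>2 / (real n * (real m)\<^sup>2)"
    by (rule measure_eq_emeasure_eq_ennreal[OF _ em]) simp
qed

lemma
  assumes "L > 0"
  shows integrable_grid_step: "integrable lborel (grid_step L m n g)"
    and integral_grid_step: "integral\<^sup>L lborel (grid_step L m n g) = grid_sum L m n g"
proof -
  have cell: "has_bochner_integral lborel (\<lambda>x. indicat_real (grid_cell L m n j i1 i2) x * c) (8 * pi * L\<^sup>2 / (real n * (real m)\<^sup>2) * c)"
    if "j \<in> {1..n - 1}" "i1 \<in> {1..m}" "i2 \<in> {1..m}" for j i1 i2 c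
    using grid_cell_lmeasurable[of j i1 i2 L m n] measure_grid_cell[of j i1 i2 L m n] that assms
    by (intro has_bochner_integral_mult_left) (auto simp: fmeasurable_def has_bochner_integral_iff)
  have "has_bochner_integral lborel (grid_step L m n g) (grid_sum L m n g)"
    unfolding grid_step_def grid_sum_def sum_distrib_left
    by (intro has_bochner_integral_sum cell)
  then show "integrable lborel (grid_step L m n g)" "integral\<^sup>L lborel (grid_step L m n g) = grid_sum L m n g"
    by (simp_all add: has_bochner_integral_iff)
qed

lemma interval_index_unique:
  fixes h x a :: real
  assumes "h > 0" "a + h * real j - h < x" "x \<le> a + h * real j" "a + h * real j' - h < x" "x \<le> a + h * real j'"
  shows "j = j'"
proof -
  have "h * (real j - 1) < h * real j'" "h * (real j' - 1) < h * real j"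
    using assms by (simp_all add: right_diff_distrib)
  then have "real j - 1 < real j'" "real j' - 1 < real j" using assms(1) by simp_all
  then show ?thesis by linarith
qed

lemma interval_index_exists:
  fixes h x a :: real
  assumes "h > 0" "a < x" "x \<le> a + h * real N"
  shows "\<exists>j\<in>{1..N}. a + h * real j - h < x \<and> x \<le> a + h * real j"
proof -
  define y where "y = (x - a) / h"
  have x: "x = a + h * y" using assms by (simp add: y_def)
  have y: "0 < y" "y \<le> real N" using assms by (simp_all add: y_def field_simps)
  define j where "j = nat \<lceil>y\<rceil>"
  have rj: "real j = of_int \<lceil>y\<rceil>" using y by (simp add: j_def)
  have "real j - 1 < y" "y \<le> real j" unfolding rj using ceiling_correct[of y] by auto
  moreover have "j \<in> {1..N}" using y by (simp add: j_def nat_le_iff le_nat_iff ceiling_le_iff)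
  moreover have "h * real j < h * (1 + y)" "h * y \<le> h * real j"
    using \<open>real j - 1 < y\<close> \<open>y \<le> real j\<close> assms(1) by (intro mult_strict_left_mono mult_left_mono; simp)+
  ultimately show ?thesis
    by (intro bexI[of _ j]) (auto simp: x distrib_left)
qed

lemma grid_step_eq:
  assumes "L > 0" "j \<in> {1..n - 1}" "i1 \<in> {1..m}" "i2 \<in> {1..m}" "x \<in> grid_cell L m n j i1 i2"
  shows "grid_step L m n g x = g (fourier_freq n j) (grid_point L m i1) (grid_point L m i2)"
proof -
  obtain w u v where x: "x = (w, u, v)" by (cases x)
  have pos: "2 * pi / real n > 0" "2 * L / real m > 0" using assms by auto
  have freq: "fourier_freq n k = 0 + 2 * pi / real n * real k" "grid_point L m k = - L + 2 * L / real m * real k" for k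
    by (simp_all add: fourier_freq_def grid_point_def)
  have ind: "indicat_real (grid_cell L m n j' k1 k2) x = (if j' = j \<and> k1 = i1 \<and> k2 = i2 then 1 else 0)"
    if r: "j' \<in> {1..n - 1}" "k1 \<in> {1..m}" "k2 \<in> {1..m}" for j' k1 k2
  proof -
    have uniq: "j' = j \<and> k1 = i1 \<and> k2 = i2" if "x \<in> grid_cell L m n j' k1 k2"
    proof -
      have "fourier_freq n j' - 2 * pi / real n < w" "w \<le> fourier_freq n j'" "fourier_freq n j - 2 * pi / real n < w" "w \<le> fourier_freq n j"
        "grid_point L m k1 - 2 * L / real m < u" "u \<le> grid_point L m k1" "grid_point L m i1 - 2 * L / real m < u" "u \<le> grid_point L m i1"
        "grid_point L m k2 - 2 * L / real m < v" "v \<le> grid_point L m k2" "grid_point L m i2 - 2 * L / real m < v" "v \<le> grid_point L m i2"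
        using that assms r by (auto simp: x grid_cell_def fourier_freq_pred[simplified] grid_point_pred[simplified])
      note b = this[unfolded freq]
      show ?thesis
        using interval_index_unique[OF pos(1) b(1-4)] interval_index_unique[OF pos(2) b(5-8)]
          interval_index_unique[OF pos(2) b(9-12)] by simp
    qed
    show ?thesis
    proof (cases "x \<in> grid_cell L m n j' k1 k2")
      case True
      then show ?thesis using uniq by (simp only: indicator_simps) simp
    next
      case False
      then have "\<not> (j' = j \<and> k1 = i1 \<and> k2 = i2)" using assms(5) by blast
      with False show ?thesis by (simp only: indicator_simps if_False not_False_eq_True)
    qed
  qed
  have "grid_step L m n g x = (\<Sum>j' = 1..n - 1. \<Sum>k1 = 1..m. \<Sum>k2 = 1..m.
     (if k2 = i2 then if k1 = i1 then if j' = j then g (fourier_freq n j) (grid_point L m i1) (grid_point L m i2) else 0 else 0 else 0))"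
    unfolding grid_step_def by (intro sum.cong refl) (simp add: ind)
  also have "\<dots> = g (fourier_freq n j) (grid_point L m i1) (grid_point L m i2)"
    using assms by simp
  finally show ?thesis .
qed

lemma grid_cell_bounds:
  assumes "L > 0" "j \<in> {1..n - 1}" "i1 \<in> {1..m}" "i2 \<in> {1..m}"
  shows "fourier_freq n j \<in> {0..2 * pi}" "grid_point L m i1 \<in> {-L..L}" "grid_point L m i2 \<in> {-L..L}"
    and "grid_cell L m n j i1 i2 \<subseteq> spectral_box L"
    and "(w, u, v) \<in> grid_cell L m n j i1 i2 \<Longrightarrow>
      \<bar>fourier_freq n j - w\<bar> \<le> 2 * pi / real n \<and> \<bar>grid_point L m i1 - u\<bar> \<le> 2 * L / real m \<and> \<bar>grid_point L m i2 - v\<bar> \<le> 2 * L / real m"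
proof -
  have f: "0 \<le> fourier_freq n k \<and> fourier_freq n k \<le> 2 * pi" if "k \<le> n" for k
    using that by (cases "n = 0") (auto simp: fourier_freq_def field_simps)
  have p: "- L \<le> grid_point L m k \<and> grid_point L m k \<le> L" if "k \<le> m" for k
    using that assms(1) by (cases "m = 0") (auto simp: grid_point_def field_simps)
  show "fourier_freq n j \<in> {0..2 * pi}" "grid_point L m i1 \<in> {-L..L}" "grid_point L m i2 \<in> {-L..L}"
    using f[of j] p[of i1] p[of i2] assms by auto
  show "grid_cell L m n j i1 i2 \<subseteq> spectral_box L"
  proof -
    have "j \<le> n" "j - 1 \<le> n" "i1 \<le> m" "i1 - 1 \<le> m" "i2 \<le> m" "i2 - 1 \<le> m" using assms by auto
    note f[OF this(1)] f[OF this(2)] p[OF this(3)] p[OF this(4)] p[OF this(5)] p[OF this(6)]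
    then show ?thesis unfolding grid_cell_def spectral_box_def by fastforce
  qed
  show "\<bar>fourier_freq n j - w\<bar> \<le> 2 * pi / real n \<and> \<bar>grid_point L m i1 - u\<bar> \<le> 2 * L / real m \<and> \<bar>grid_point L m i2 - v\<bar> \<le> 2 * L / real m"
    if "(w, u, v) \<in> grid_cell L m n j i1 i2"
    using that assms by (auto simp: grid_cell_def fourier_freq_pred[simplified] grid_point_pred[simplified])
qed

lemma grid_step_cases:
  assumes "L > 0"
  obtains (outside) "\<And>g. grid_step L m n g x = 0"
  | (cell) j i1 i2 where "j \<in> {1..n - 1}" "i1 \<in> {1..m}" "i2 \<in> {1..m}" "x \<in> grid_cell L m n j i1 i2"
      "\<And>g. grid_step L m n g x = g (fourier_freq n j) (grid_point L m i1) (grid_point L m i2)"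
proof (cases "\<exists>j\<in>{1..n - 1}. \<exists>i1\<in>{1..m}. \<exists>i2\<in>{1..m}. x \<in> grid_cell L m n j i1 i2")
  case True
  then show ?thesis using grid_step_eq[OF assms] cell by blast
next
  case False
  then have "grid_step L m n g x = 0" for g
    unfolding grid_step_def by (intro sum.neutral ballI) auto
  then show ?thesis by (rule outside)
qed

text \<open>
  The cell containing the point exists for large \<open>n\<close>: a frequency \<open>w < 2\<pi>\<close> is eventually at most
  \<open>2\<pi>(n - 1)/n\<close>, the last frequency of the sum. Its upper corner converges to the point.
\<close>

lemma grid_step_tendsto:
  assumes L: "L > 0" and M: "filterlim M at_top sequentially"
    and w: "0 < w" "w < 2 * pi" and u: "-L < u" "u \<le> L" and v: "-L < v" "v \<le> L"
    and cont: "\<And>W U V. (\<And>k. W k \<in> {0..2 * pi}) \<Longrightarrow> (\<And>k. (U k, V k) \<in> {-L..L} \<times> {-L..L}) \<Longrightarrow>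
      W \<longlonglongrightarrow> w \<Longrightarrow> U \<longlonglongrightarrow> u \<Longrightarrow> V \<longlonglongrightarrow> v \<Longrightarrow> (\<lambda>k. g (W k) (U k) (V k)) \<longlonglongrightarrow> g w u v"
  shows "(\<lambda>n. grid_step L (M n) n g (w, u, v)) \<longlonglongrightarrow> g w u v"
proof -
  define Q where "Q n = (\<lambda>(j, i1, i2). j \<in> {1..n - 1} \<and> i1 \<in> {1..M n} \<and> i2 \<in> {1..M n} \<and> (w, u, v) \<in> grid_cell L (M n) n j i1 i2)" for n
  have lim: "(\<lambda>n. 2 * pi / real n) \<longlonglongrightarrow> 0" "(\<lambda>n. 2 * L / real (M n)) \<longlonglongrightarrow> 0"
    by (intro tendsto_divide_0[OF tendsto_const] filterlim_at_top_imp_at_infinity filterlim_real_sequentially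
        filterlim_compose[OF filterlim_real_sequentially M])+
  have ex: "\<forall>\<^sub>F n in sequentially. \<exists>t. Q n t"
  proof -
    have "\<forall>\<^sub>F n in sequentially. 2 * pi / real n < 2 * pi - w" using lim(1) w by (intro order_tendstoD(2)) auto
    moreover have "\<forall>\<^sub>F n in sequentially. M n \<ge> 1" using M by (auto simp: filterlim_at_top)
    ultimately show ?thesis using eventually_ge_at_top[of 2]
    proof eventually_elim
      case (elim n)
      have freq: "fourier_freq n k = 0 + 2 * pi / real n * real k" "grid_point L (M n) k = - L + 2 * L / real (M n) * real k" for k
        by (simp_all add: fourier_freq_def grid_point_def)
      have "2 * pi / real n * real (n - 1) = 2 * pi - 2 * pi / real n"
        using elim by (simp add: of_nat_diff field_simps)
      then have "\<exists>j\<in>{1..n - 1}. 0 + 2 * pi / real n * real j - 2 * pi / real n < w \<and> w \<le> 0 + 2 * pi / real n * real j"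
        using elim w by (intro interval_index_exists) auto
      then obtain j where j: "j \<in> {1..n - 1}" "fourier_freq n j - 2 * pi / real n < w" "w \<le> fourier_freq n j"
        unfolding freq by blast
      have gp: "\<exists>i\<in>{1..M n}. grid_point L (M n) i - 2 * L / real (M n) < y \<and> y \<le> grid_point L (M n) i"
        if "- L < y" "y \<le> L" for y
        unfolding freq using elim L that by (intro interval_index_exists) auto
      obtain i1 where i1: "i1 \<in> {1..M n}" "grid_point L (M n) i1 - 2 * L / real (M n) < u" "u \<le> grid_point L (M n) i1"
        using gp[OF u] by blast
      obtain i2 where i2: "i2 \<in> {1..M n}" "grid_point L (M n) i2 - 2 * L / real (M n) < v" "v \<le> grid_point L (M n) i2"
        using gp[OF v] by blast
      from j i1 i2 have "Q n (j, i1, i2)"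
        by (auto simp: Q_def grid_cell_def fourier_freq_pred[simplified] grid_point_pred[simplified])
      then show ?case by blast
    qed
  qed
  define T where "T n = (SOME t. Q n t)" for n
  define W where "W n = (if \<exists>t. Q n t then fourier_freq n (fst (T n)) else w)" for n
  define U where "U n = (if \<exists>t. Q n t then grid_point L (M n) (fst (snd (T n))) else u)" for n
  define V where "V n = (if \<exists>t. Q n t then grid_point L (M n) (snd (snd (T n))) else v)" for n
  have QT: "fst (T n) \<in> {1..n - 1}" "fst (snd (T n)) \<in> {1..M n}" "snd (snd (T n)) \<in> {1..M n}"
      "(w, u, v) \<in> grid_cell L (M n) n (fst (T n)) (fst (snd (T n))) (snd (snd (T n)))" if "\<exists>t. Q n t" for n
  proof -
    have "Q n (T n)" unfolding T_def by (rule someI_ex[OF that])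
    then show "fst (T n) \<in> {1..n - 1}" "fst (snd (T n)) \<in> {1..M n}" "snd (snd (T n)) \<in> {1..M n}"
      "(w, u, v) \<in> grid_cell L (M n) n (fst (T n)) (fst (snd (T n))) (snd (snd (T n)))"
      by (simp_all add: Q_def split_beta)
  qed
  have box: "W n \<in> {0..2 * pi}" "(U n, V n) \<in> {-L..L} \<times> {-L..L}" for n
    using grid_cell_bounds(1-3)[OF L QT(1-3)[of n]] w u v by (auto simp: W_def U_def V_def)
  have dist: "\<bar>W n - w\<bar> \<le> 2 * pi / real n" "\<bar>U n - u\<bar> \<le> 2 * L / real (M n)" "\<bar>V n - v\<bar> \<le> 2 * L / real (M n)" for n
    using grid_cell_bounds(5)[OF L QT[of n]] L by (auto simp: W_def U_def V_def)
  have null: "X \<longlonglongrightarrow> x" if "\<And>n. \<bar>X n - x\<bar> \<le> e n" "e \<longlonglongrightarrow> 0" for X e :: "nat \<Rightarrow> real" and x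
    by (rule LIM_zero_cancel, rule Lim_null_comparison[OF _ that(2)]) (simp add: that(1))
  have "(\<lambda>k. g (W k) (U k) (V k)) \<longlonglongrightarrow> g w u v"
    by (intro cont box null[OF dist(1) lim(1)] null[OF dist(2) lim(2)] null[OF dist(3) lim(2)])
  moreover have "\<forall>\<^sub>F n in sequentially. g (W n) (U n) (V n) = grid_step L (M n) n g (w, u, v)"
    using ex by (rule eventually_mono) (simp add: W_def U_def V_def grid_step_eq[OF L QT])
  ultimately show ?thesis by (rule Lim_transform_eventually)
qed

text \<open>
  Dominated convergence for the step functions. The limit may fail only on the null set where a coordinate
  lies on the part of the boundary that the half-open cells miss or where \<open>(u, v) \<in> S\<close>.
\<close>

lemma grid_sum_tendsto:
  fixes g :: "real \<Rightarrow> real \<Rightarrow> real \<Rightarrow> real"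
  assumes L: "L > 0" and M: "filterlim M at_top sequentially"
    and meas: "(\<lambda>x. g (fst x) (fst (snd x)) (snd (snd x))) \<in> borel_measurable borel"
    and bnd: "\<And>w u v. (w, u, v) \<in> spectral_box L \<Longrightarrow> \<bar>g w u v\<bar> \<le> K"
    and S: "S \<in> null_sets lborel"
    and cont: "\<And>w u v W U V. w \<in> {0..2 * pi} \<Longrightarrow> (u, v) \<in> {-L..L} \<times> {-L..L} \<Longrightarrow> (u, v) \<notin> S \<Longrightarrow>
      (\<And>k. W k \<in> {0..2 * pi}) \<Longrightarrow> (\<And>k. (U k, V k) \<in> {-L..L} \<times> {-L..L}) \<Longrightarrow>
      W \<longlonglongrightarrow> w \<Longrightarrow> U \<longlonglongrightarrow> u \<Longrightarrow> V \<longlonglongrightarrow> v \<Longrightarrow> (\<lambda>k. g (W k) (U k) (V k)) \<longlonglongrightarrow> g w u v"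
  shows "(\<lambda>n. grid_sum L (M n) n g) \<longlonglongrightarrow>
     (\<integral>x. indicat_real (spectral_box L) x * g (fst x) (fst (snd x)) (snd (snd x)) \<partial>lborel)"
  unfolding integral_grid_step[OF L, symmetric]
proof (rule integral_dominated_convergence[where w = "\<lambda>x. indicat_real (spectral_box L) x * K"])
  have [measurable]: "spectral_box L \<in> sets borel" using spectral_box_lmeasurable[of L] by (simp add: fmeasurable_def)
  show "(\<lambda>x. indicat_real (spectral_box L) x * g (fst x) (fst (snd x)) (snd (snd x))) \<in> borel_measurable lborel"
  proof -
    have "(\<lambda>x. indicat_real (spectral_box L) x * g (fst x) (fst (snd x)) (snd (snd x))) \<in> borel_measurable borel"
      by (rule borel_measurable_times[OF _ meas]) measurable
    then show ?thesis by simp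
  qed
  show "grid_step L (M n) n g \<in> borel_measurable lborel" for n
    using integrable_grid_step[OF L] by (rule borel_measurable_integrable)
  show "integrable lborel (\<lambda>x. indicat_real (spectral_box L) x * K)"
    by (rule integrable_on_spectral_box[where K = "\<bar>K\<bar>"]) auto
  show "AE x in lborel. norm (grid_step L (M n) n g x) \<le> indicat_real (spectral_box L) x * K" for n
  proof (rule AE_I2)
    fix x
    have K: "0 \<le> K" if "x \<in> spectral_box L"
      using bnd[of "fst x" "fst (snd x)" "snd (snd x)"] that by simp
    show "norm (grid_step L (M n) n g x) \<le> indicat_real (spectral_box L) x * K"
    proof (rule grid_step_cases[OF L, of "M n" n x])
      assume "\<And>g. grid_step L (M n) n g x = 0"
      then show ?thesis using K by (simp add: indicator_def)
    next
      fix j i1 i2 assume *: "j \<in> {1..n - 1}" "i1 \<in> {1..M n}" "i2 \<in> {1..M n}" "x \<in> grid_cell L (M n) n j i1 i2"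
        "\<And>g. grid_step L (M n) n g x = g (fourier_freq n j) (grid_point L (M n) i1) (grid_point L (M n) i2)"
      have "x \<in> spectral_box L" using grid_cell_bounds(4)[OF L *(1-3)] *(4) by blast
      moreover have "\<bar>g (fourier_freq n j) (grid_point L (M n) i1) (grid_point L (M n) i2)\<bar> \<le> K"
        using grid_cell_bounds(1-3)[OF L *(1-3)] by (intro bnd) (simp add: spectral_box_def)
      ultimately show ?thesis by (simp add: *(5))
    qed
  qed
  have N: "{0, 2 * pi} \<times> UNIV \<union> UNIV \<times> S \<union> UNIV \<times> ({-L} \<times> UNIV) \<union> UNIV \<times> (UNIV \<times> {-L})
      \<in> null_sets (lborel :: (real \<times> real \<times> real) measure)"
    using S by (intro null_sets.Un; simp add: null_sets_def borel_Times emeasure_lborel_Times emeasure_lborel_countable)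
  show "AE x in lborel. (\<lambda>n. grid_step L (M n) n g x) \<longlonglongrightarrow> indicat_real (spectral_box L) x * g (fst x) (fst (snd x)) (snd (snd x))"
  proof (rule AE_I'[OF N], rule subsetI)
    fix x
    assume x: "x \<in> {x \<in> space lborel. \<not> (\<lambda>n. grid_step L (M n) n g x) \<longlonglongrightarrow> indicat_real (spectral_box L) x * g (fst x) (fst (snd x)) (snd (snd x))}"
    obtain w u v where xe: "x = (w, u, v)" by (cases x)
    have no: "\<not> (\<lambda>n. grid_step L (M n) n g (w, u, v)) \<longlonglongrightarrow> indicat_real (spectral_box L) (w, u, v) * g w u v"
      using x by (simp add: xe)
    have "(w, u, v) \<in> {0, 2 * pi} \<times> UNIV \<union> UNIV \<times> S \<union> UNIV \<times> ({-L} \<times> UNIV) \<union> UNIV \<times> (UNIV \<times> {-L})"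
    proof (rule ccontr)
      assume out: "\<not> ?thesis"
      show False
      proof (cases "(w, u, v) \<in> spectral_box L")
        case True
        with out have r: "0 < w" "w < 2 * pi" "-L < u" "u \<le> L" "-L < v" "v \<le> L" "(u, v) \<notin> S"
          by (auto simp: spectral_box_def less_le)
        have "(\<lambda>n. grid_step L (M n) n g (w, u, v)) \<longlonglongrightarrow> g w u v"
          by (rule grid_step_tendsto[OF L M r(1-6)], rule cont) (use r in auto)
        with no True show False by simp
      next
        case False
        have "grid_step L (M n) n g (w, u, v) = 0" for n
          by (rule grid_step_cases[OF L, of "M n" n "(w, u, v)"]) (use False grid_cell_bounds(4)[OF L] in blast)+
        with no False show False by simp
      qed
    qed
    then show "x \<in> {0, 2 * pi} \<times> UNIV \<union> UNIV \<times> S \<union> UNIV \<times> ({-L} \<times> UNIV) \<union> UNIV \<times> (UNIV \<times> {-L})"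
      by (simp only: xe)
  qed
qed

lemma grid_sum_mono:
  assumes "L > 0"
    and "\<And>w u v. w \<in> {0..2 * pi} \<Longrightarrow> (u, v) \<in> {-L..L} \<times> {-L..L} \<Longrightarrow> g w u v \<le> h w u v"
  shows "grid_sum L m n g \<le> grid_sum L m n h"
  unfolding grid_sum_def
proof (intro mult_left_mono sum_mono)
  fix j i1 i2 assume "j \<in> {1..n - 1}" "i1 \<in> {1..m}" "i2 \<in> {1..m}"
  from grid_cell_bounds(1-3)[OF assms(1) this]
  show "g (fourier_freq n j) (grid_point L m i1) (grid_point L m i2) \<le> h (fourier_freq n j) (grid_point L m i1) (grid_point L m i2)"
    by (intro assms(2)) auto
qed (use assms(1) in simp)

lemma grid_sum_const_le:
  assumes "c \<ge> 0"
  shows "grid_sum L m n (\<lambda>w u v. c) \<le> 8 * pi * L\<^sup>2 * c"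
proof (cases "n = 0 \<or> m = 0")
  case True
  then show ?thesis using assms by (auto simp: grid_sum_def)
next
  case False
  have "grid_sum L m n (\<lambda>w u v. c) = 8 * pi * L\<^sup>2 / (real n * (real m)\<^sup>2) * (real (n - 1) * (real m)\<^sup>2 * c)"
    by (simp add: grid_sum_def power2_eq_square)
  also have "\<dots> \<le> 8 * pi * L\<^sup>2 / (real n * (real m)\<^sup>2) * (real n * (real m)\<^sup>2 * c)"
    using assms by (intro mult_left_mono mult_right_mono) auto
  also have "\<dots> = 8 * pi * L\<^sup>2 * c" using False by simp
  finally show ?thesis .
qed

lemma grid_sum_add: "grid_sum L m n (\<lambda>w u v. g w u v + h w u v) = grid_sum L m n g + grid_sum L m n h"
  unfolding grid_sum_def by (simp only: sum.distrib distrib_left)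

lemma grid_sum_cmult: "grid_sum L m n (\<lambda>w u v. c * g w u v) = c * grid_sum L m n g"
  unfolding grid_sum_def by (simp only: sum_distrib_left mult.left_commute)

lemma grid_sum_diff: "grid_sum L m n (\<lambda>w u v. g w u v - h w u v) = grid_sum L m n g - grid_sum L m n h"
  unfolding grid_sum_def by (simp only: sum_subtractf right_diff_distrib)

text \<open>
  A cell whose corner lies in the \<open>\<epsilon>\<close>-neighbourhood of \<open>S\<close> is contained in the \<open>2\<epsilon>\<close>-neighbourhood, as the
  diameter of its projection to the \<open>(u, v)\<close>-plane is at most \<open>4L/m \<le> \<epsilon>\<close>.
\<close>

lemma grid_sum_S_nbhd_le:
  assumes L: "L > 0" and m: "4 * L / real m \<le> \<epsilon>"
  shows "grid_sum L m n (\<lambda>w u v. indicat_real (S_nbhd L S \<epsilon>) (u, v)) \<le> 2 * pi * measure lborel (S_nbhd L S (2 * \<epsilon>))"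
proof -
  define N where "N = {0..2 * pi} \<times> S_nbhd L S (2 * \<epsilon>)"
  have em: "emeasure lborel N = ennreal (2 * pi) * emeasure lborel (S_nbhd L S (2 * \<epsilon>))"
    unfolding N_def using closed_S_nbhd by (subst emeasure_lborel_Times) auto
  also have "\<dots> = ennreal (2 * pi * measure lborel (S_nbhd L S (2 * \<epsilon>)))"
    using emeasure_eq_ennreal_measure[of lborel "S_nbhd L S (2 * \<epsilon>)"] S_nbhd_lmeasurable[of L S "2 * \<epsilon>"]
    by (simp add: ennreal_mult fmeasurable_def less_top)
  finally have em: "emeasure lborel N = ennreal (2 * pi * measure lborel (S_nbhd L S (2 * \<epsilon>)))" .
  have Nm: "N \<in> sets lborel" unfolding N_def using closed_S_nbhd by (auto intro!: borel_Times)
  have "grid_sum L m n (\<lambda>w u v. indicat_real (S_nbhd L S \<epsilon>) (u, v)) =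
      (\<integral>x. grid_step L m n (\<lambda>w u v. indicat_real (S_nbhd L S \<epsilon>) (u, v)) x \<partial>lborel)"
    by (rule integral_grid_step[OF L, symmetric])
  also have "\<dots> \<le> (\<integral>x. indicat_real N x \<partial>lborel)"
  proof (rule integral_mono[OF integrable_grid_step[OF L]])
    show "integrable lborel (indicat_real N)" using em Nm by (intro integrable_real_indicator) auto
    fix x
    show "grid_step L m n (\<lambda>w u v. indicat_real (S_nbhd L S \<epsilon>) (u, v)) x \<le> indicat_real N x"
    proof (rule grid_step_cases[OF L, of m n x])
      assume "\<And>g. grid_step L m n g x = 0"
      then show ?thesis by simp
    next
      fix j i1 i2 assume *: "j \<in> {1..n - 1}" "i1 \<in> {1..m}" "i2 \<in> {1..m}" "x \<in> grid_cell L m n j i1 i2"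
        "\<And>g. grid_step L m n g x = g (fourier_freq n j) (grid_point L m i1) (grid_point L m i2)"
      obtain w u v where x: "x = (w, u, v)" by (cases x)
      have box: "(w, u, v) \<in> spectral_box L" using grid_cell_bounds(4)[OF L *(1-3)] *(4) x by blast
      have "x \<in> N" if *: "(grid_point L m i1, grid_point L m i2) \<in> S_nbhd L S \<epsilon>"
      proof -
        have d: "\<bar>grid_point L m i1 - u\<bar> \<le> 2 * L / real m" "\<bar>grid_point L m i2 - v\<bar> \<le> 2 * L / real m"
          using grid_cell_bounds(5)[OF L \<open>j \<in> _\<close> \<open>i1 \<in> _\<close> \<open>i2 \<in> _\<close>, of w u v] \<open>x \<in> grid_cell L m n j i1 i2\<close> by (simp_all add: x)
        have "dist (u, v) (grid_point L m i1, grid_point L m i2) \<le> dist u (grid_point L m i1) + dist v (grid_point L m i2)"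
          unfolding dist_Pair_Pair by (rule sqrt_sum_squares_le_sum) auto
        also have "\<dots> \<le> 2 * L / real m + 2 * L / real m"
          using d by (intro add_mono) (simp_all add: dist_real_def abs_minus_commute)
        also have "\<dots> \<le> \<epsilon>" using m by simp
        finally have "dist (u, v) (grid_point L m i1, grid_point L m i2) \<le> \<epsilon>" .
        moreover have "infdist (u, v) S \<le> infdist (grid_point L m i1, grid_point L m i2) S + dist (u, v) (grid_point L m i1, grid_point L m i2)"
          by (rule infdist_triangle)
        ultimately show ?thesis using * box by (simp add: N_def x mem_S_nbhd_iff spectral_box_def)
      qed
      then show ?thesis unfolding *(5) by (simp add: indicator_def)
    qed
  qed
  also have "\<dots> = 2 * pi * measure lborel (S_nbhd L S (2 * \<epsilon>))"
    using measure_eq_emeasure_eq_ennreal[OF _ em] Nm by simp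
  finally show ?thesis .
qed

section \<open>Averages of periodogram errors\<close>

text \<open>
  Sesquilinear expansion of the squared modulus; boundedness of the variables makes the products integrable.
\<close>

lemma (in prob_space) norm_square_weighted_sum_expectation_le:
  fixes e :: "'i \<Rightarrow> 'a \<Rightarrow> complex" and c :: "'i \<Rightarrow> complex"
  assumes "finite X"
    and meas: "\<And>x. e x \<in> borel_measurable M" and bnd: "\<And>x \<omega>. cmod (e x \<omega>) \<le> K"
    and c: "\<And>x. x \<in> X \<Longrightarrow> cmod (c x) \<le> b"
    and cov: "\<And>x y. x \<in> X \<Longrightarrow> y \<in> X \<Longrightarrow> cmod (\<integral>\<omega>. e x \<omega> * cnj (e y \<omega>) \<partial>M) \<le> \<kappa> x y"
  shows "(\<integral>\<omega>. (cmod (\<Sum>x\<in>X. c x * e x \<omega>))\<^sup>2 \<partial>M) \<le> b\<^sup>2 * (\<Sum>x\<in>X. \<Sum>y\<in>X. \<kappa> x y)"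
proof -
  have [measurable]: "e x \<in> borel_measurable M" for x by (rule meas)
  have [measurable]: "cnj \<in> borel_measurable borel"
    by (intro borel_measurable_continuous_onI continuous_intros)
  have int: "integrable M (\<lambda>\<omega>. e x \<omega> * cnj (e y \<omega>))" for x y
  proof (rule integrable_bounded)
    show "cmod (e x \<omega> * cnj (e y \<omega>)) \<le> K * K" for \<omega>
      unfolding norm_mult complex_mod_cnj using bnd[of x \<omega>] bnd[of y \<omega>]
      by (intro mult_mono) (auto intro: order_trans[OF norm_ge_zero])
  qed measurable
  have eq: "complex_of_real ((cmod (\<Sum>x\<in>X. c x * e x \<omega>))\<^sup>2) = (\<Sum>x\<in>X. \<Sum>y\<in>X. (c x * cnj (c y)) * (e x \<omega> * cnj (e y \<omega>)))" for \<omega>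
    unfolding complex_norm_square cnj_sum complex_cnj_mult sum_product
    by (intro sum.cong refl) (simp only: mult_ac)
  have "complex_of_real (\<integral>\<omega>. (cmod (\<Sum>x\<in>X. c x * e x \<omega>))\<^sup>2 \<partial>M) =
      (\<integral>\<omega>. complex_of_real ((cmod (\<Sum>x\<in>X. c x * e x \<omega>))\<^sup>2) \<partial>M)"
    by (rule integral_complex_of_real[symmetric])
  also have "\<dots> = (\<Sum>x\<in>X. \<Sum>y\<in>X. (c x * cnj (c y)) * (\<integral>\<omega>. e x \<omega> * cnj (e y \<omega>) \<partial>M))"
    unfolding eq using int by simp
  finally have main: "complex_of_real (\<integral>\<omega>. (cmod (\<Sum>x\<in>X. c x * e x \<omega>))\<^sup>2 \<partial>M) = \<dots>" .
  have "(\<integral>\<omega>. (cmod (\<Sum>x\<in>X. c x * e x \<omega>))\<^sup>2 \<partial>M) \<le> cmod (complex_of_real (\<integral>\<omega>. (cmod (\<Sum>x\<in>X. c x * e x \<omega>))\<^sup>2 \<partial>M))"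
    by (simp only: norm_of_real abs_ge_self)
  also have "\<dots> \<le> (\<Sum>x\<in>X. \<Sum>y\<in>X. b\<^sup>2 * \<kappa> x y)"
    unfolding main
  proof (intro sum_norm_le)
    fix x y assume xy: "x \<in> X" "y \<in> X"
    have "0 \<le> b" using c[OF xy(1)] norm_ge_zero order_trans by blast
    show "cmod (c x * cnj (c y) * (\<integral>\<omega>. e x \<omega> * cnj (e y \<omega>) \<partial>M)) \<le> b\<^sup>2 * \<kappa> x y"
      unfolding norm_mult complex_mod_cnj power2_eq_square
      by (intro mult_mono c cov xy mult_nonneg_nonneg norm_ge_zero \<open>0 \<le> b\<close>)
  qed
  finally show ?thesis by (simp only: sum_distrib_left)
qed

context exp_cumulant_process begin

text \<open>
  For each of the \<open>(n - 1) m\<^sup>2\<close> grid points, the sum of \<open>1/n + [j = k] + [j + k = n]\<close> over all grid points with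
  frequency index \<open>k\<close> is at most \<open>3 m\<^sup>2\<close>, and the weights are of order \<open>1/(n m\<^sup>2)\<close>. The second moment of the
  average is therefore of order \<open>1/n\<close>, uniformly in \<open>m\<close>.
\<close>

lemma periodogram_error_bounds:
  obtains K where "K \<ge> 0"
    and "\<And>n m L a B. m \<ge> 1 \<Longrightarrow> (\<And>w u v. w \<in> {0..2 * pi} \<Longrightarrow> (u, v) \<in> {-L..L} \<times> {-L..L} \<Longrightarrow> cmod (a w u v) \<le> B) \<Longrightarrow> n \<ge> 1 \<Longrightarrow> L > 0 \<Longrightarrow>
      (\<integral>\<omega>. (grid_sum L m n (\<lambda>w u v. Re ((periodogram Z n \<omega> w u v - gen_spectrum P Z w u v) * cnj (a w u v))))\<^sup>2 \<partial>P)
        \<le> K * (L ^ 4 * B\<^sup>2) / real n"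
    and "\<And>n j u v. j \<in> {1..n - 1} \<Longrightarrow>
      (\<integral>\<omega>. cmod (periodogram Z n \<omega> (fourier_freq n j) u v - gen_spectrum P Z (fourier_freq n j) u v) \<partial>P) \<le> K"
proof -
  obtain K where K0: "K \<ge> 0" and K: "\<And>n j k u v u' v'. j \<in> {1..n - 1} \<Longrightarrow> k \<in> {1..n - 1} \<Longrightarrow>
    cmod (\<integral>\<omega>. (periodogram Z n \<omega> (fourier_freq n j) u v - gen_spectrum P Z (fourier_freq n j) u v) *
      cnj (periodogram Z n \<omega> (fourier_freq n k) u' v' - gen_spectrum P Z (fourier_freq n k) u' v') \<partial>P)
    \<le> K * (1 / real n + of_bool (j = k) + of_bool (j + k = n))"
    by (rule periodogram_error_covariance) blast
  obtain G where G: "\<And>w u v. cmod (gen_spectrum P Z w u v) \<le> G"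
    by (rule gen_spectrum_bounded) blast
  define e where "e n w u v \<omega> = periodogram Z n \<omega> w u v - gen_spectrum P Z w u v" for n w u v \<omega>
  have e_meas: "e n w u v \<in> borel_measurable P" for n w u v
    unfolding e_def by (intro borel_measurable_diff periodogram_measurable borel_measurable_const)
  have e_bnd: "cmod (e n w u v \<omega>) \<le> real n + G" for n w u v \<omega>
    unfolding e_def by (rule order_trans[OF norm_triangle_ineq4 add_mono[OF norm_periodogram_le G]])
  note cov = K[folded e_def]
  define K1 where "K1 = 192 * pi\<^sup>2 * K"
  have second: "(\<integral>\<omega>. (grid_sum L m n (\<lambda>w u v. Re (e n w u v \<omega> * cnj (a w u v))))\<^sup>2 \<partial>P) \<le> K1 * (L ^ 4 * B\<^sup>2) / real n"
    if m: "m \<ge> 1" and n: "n \<ge> 1" and L: "L > 0" and a: "\<And>w u v. w \<in> {0..2 * pi} \<Longrightarrow> (u, v) \<in> {-L..L} \<times> {-L..L} \<Longrightarrow> cmod (a w u v) \<le> B" for n m L a B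
  proof -
    define \<Delta> where "\<Delta> = 8 * pi * L\<^sup>2 / (real n * (real m)\<^sup>2)"
    have "\<Delta> \<ge> 0" by (simp add: \<Delta>_def)
    define X where "X = {1..n - 1} \<times> {1..m} \<times> {1..m}"
    define E where "E = (\<lambda>(j, i1, i2). e n (fourier_freq n j) (grid_point L m i1) (grid_point L m i2))"
    define c where "c = (\<lambda>(j, i1, i2). complex_of_real \<Delta> * cnj (a (fourier_freq n j) (grid_point L m i1) (grid_point L m i2)))"
    define \<kappa> where "\<kappa> = (\<lambda>(j, i1 :: nat, i2 :: nat) (k, k1 :: nat, k2 :: nat). K * (1 / real n + of_bool (j = k) + of_bool (j + k = n)))"
    have gs: "grid_sum L m n (\<lambda>w u v. Re (e n w u v \<omega> * cnj (a w u v))) = Re (\<Sum>x\<in>X. c x * E x \<omega>)" for \<omega>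
    proof -
      have "grid_sum L m n (\<lambda>w u v. Re (e n w u v \<omega> * cnj (a w u v))) = (\<Sum>x\<in>X. Re (c x * E x \<omega>))"
        unfolding grid_sum_def \<Delta>_def[symmetric] X_def sum.cartesian_product sum_distrib_left
        by (intro sum.cong refl) (auto simp: c_def E_def algebra_simps)
      then show ?thesis by (simp only: Re_sum)
    qed
    have cE: "cmod (c x) \<le> \<Delta> * B" if "x \<in> X" for x
    proof -
      obtain j i1 i2 where x: "x = (j, i1, i2)" by (cases x)
      have r: "j \<in> {1..n - 1}" "i1 \<in> {1..m}" "i2 \<in> {1..m}" using that by (auto simp: X_def x)
      from grid_cell_bounds(1-3)[OF L r]
      have "cmod (a (fourier_freq n j) (grid_point L m i1) (grid_point L m i2)) \<le> B" by (intro a) auto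
      then show ?thesis using \<open>\<Delta> \<ge> 0\<close> by (simp add: c_def x norm_mult mult_left_mono)
    qed
    have sumk: "(\<Sum>k = 1..n - 1. 1 / real n + of_bool (j = k) + of_bool (j + k = n)) \<le> (3 :: real)" for j
    proof -
      have "(\<Sum>k = 1..n - 1. 1 / real n) \<le> (1::real)" using n by (simp add: field_simps)
      moreover have delta: "(\<Sum>k = 1..n - 1. of_bool (i = k)) \<le> (1::real)" for i
        unfolding of_bool_def by (subst sum.delta') auto
      moreover have "(\<Sum>k = 1..n - 1. of_bool (j + k = n)) \<le> (1::real)"
      proof -
        have "(\<Sum>k = 1..n - 1. of_bool (j + k = n)) \<le> (\<Sum>k = 1..n - 1. of_bool (n - j = k) :: real)"
          by (intro sum_mono) auto
        also have "\<dots> \<le> 1" by (rule delta)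
        finally show ?thesis .
      qed
      ultimately show ?thesis using delta[of j] unfolding sum.distrib by linarith
    qed
    have "(\<integral>\<omega>. (cmod (\<Sum>x\<in>X. c x * E x \<omega>))\<^sup>2 \<partial>P) \<le> (\<Delta> * B)\<^sup>2 * (\<Sum>x\<in>X. \<Sum>y\<in>X. \<kappa> x y)"
    proof (rule norm_square_weighted_sum_expectation_le[where K = "real n + G"])
      show "finite X" by (simp add: X_def)
      show "E x \<in> borel_measurable P" for x unfolding E_def by (cases x) (simp add: e_meas)
      show "cmod (E x \<omega>) \<le> real n + G" for x \<omega> unfolding E_def by (cases x) (simp add: e_bnd)
      show "cmod (\<integral>\<omega>. E x \<omega> * cnj (E y \<omega>) \<partial>P) \<le> \<kappa> x y" if "x \<in> X" "y \<in> X" for x y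
        using that unfolding E_def \<kappa>_def X_def by (cases x; cases y) (simp add: cov)
    qed (rule cE)
    also have "(\<Sum>x\<in>X. \<Sum>y\<in>X. \<kappa> x y) \<le> (\<Sum>x\<in>X. K * 3 * (real m)\<^sup>2)"
    proof (rule sum_mono)
      fix x assume "x \<in> X"
      obtain j i1 i2 where x: "x = (j, i1, i2)" by (cases x)
      have "(\<Sum>y\<in>X. \<kappa> x y) = (\<Sum>k = 1..n - 1. \<Sum>k1 = 1..m. \<Sum>k2 = 1..m. K * (1 / real n + of_bool (j = k) + of_bool (j + k = n)))"
        unfolding X_def sum.cartesian_product by (intro sum.cong refl) (auto simp: \<kappa>_def x)
      also have "\<dots> = K * (\<Sum>k = 1..n - 1. 1 / real n + of_bool (j = k) + of_bool (j + k = n)) * (real m)\<^sup>2"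
        by (simp add: sum_distrib_left sum_distrib_right power2_eq_square mult_ac)
      also have "\<dots> \<le> K * 3 * (real m)\<^sup>2"
        using sumk K0 by (intro mult_right_mono mult_left_mono) auto
      finally show "(\<Sum>y\<in>X. \<kappa> x y) \<le> K * 3 * (real m)\<^sup>2" .
    qed
    also have "\<dots> \<le> real n * (real m)\<^sup>2 * (K * 3 * (real m)\<^sup>2)"
    proof -
      have "real (card X) \<le> real n * (real m)\<^sup>2" by (simp add: X_def power2_eq_square mult_right_mono)
      then show ?thesis using K0 by (simp add: mult_right_mono)
    qed
    also have "(\<Delta> * B)\<^sup>2 * (real n * (real m)\<^sup>2 * (K * 3 * (real m)\<^sup>2)) = K1 * (L ^ 4 * B\<^sup>2) / real n"
      using m n by (simp add: \<Delta>_def K1_def field_simps power2_eq_square power4_eq_xxxx)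
    finally have norm_le: "(\<integral>\<omega>. (cmod (\<Sum>x\<in>X. c x * E x \<omega>))\<^sup>2 \<partial>P) \<le> K1 * (L ^ 4 * B\<^sup>2) / real n"
      by (simp add: mult_left_mono)
    have meas: "(\<lambda>\<omega>. \<Sum>x\<in>X. c x * E x \<omega>) \<in> borel_measurable P"
      unfolding E_def split_beta by (intro borel_measurable_sum borel_measurable_times borel_measurable_const e_meas)
    define Q where "Q = (\<Sum>x\<in>X. cmod (c x) * (real n + G))"
    have Qb: "cmod (\<Sum>x\<in>X. c x * E x \<omega>) \<le> Q" for \<omega>
      unfolding Q_def E_def split_beta
      by (intro sum_norm_le) (simp add: norm_mult mult_left_mono e_bnd)
    have "(\<integral>\<omega>. (grid_sum L m n (\<lambda>w u v. Re (e n w u v \<omega> * cnj (a w u v))))\<^sup>2 \<partial>P) \<le> (\<integral>\<omega>. (cmod (\<Sum>x\<in>X. c x * E x \<omega>))\<^sup>2 \<partial>P)"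
    proof (rule integral_mono_AE')
      have "(cmod (\<Sum>x\<in>X. c x * E x \<omega>))\<^sup>2 \<le> Q\<^sup>2" for \<omega>
        using Qb by (intro power_mono) auto
      then show "integrable P (\<lambda>\<omega>. (cmod (\<Sum>x\<in>X. c x * E x \<omega>))\<^sup>2)"
        using meas by (intro integrable_const_bound[where B = "Q\<^sup>2"]) (auto intro!: AE_I2)
      show "AE \<omega> in P. (grid_sum L m n (\<lambda>w u v. Re (e n w u v \<omega> * cnj (a w u v))))\<^sup>2 \<le> (cmod (\<Sum>x\<in>X. c x * E x \<omega>))\<^sup>2"
        unfolding gs by (intro AE_I2 abs_le_square_iff[THEN iffD1]) (simp only: abs_Re_le_cmod abs_norm_cancel)
    qed auto
    with norm_le show ?thesis by linarith
  qed
  have first: "(\<integral>\<omega>. cmod (e n (fourier_freq n j) u v \<omega>) \<partial>P) \<le> 1 + 3 * K" if j: "j \<in> {1..n - 1}" for n j u v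
  proof -
    define E where "E = e n (fourier_freq n j) u v"
    have E_meas [measurable]: "E \<in> borel_measurable P" and Eb: "\<And>\<omega>. cmod (E \<omega>) \<le> real n + G"
      unfolding E_def by (rule e_meas, rule e_bnd)
    have i1: "integrable P (\<lambda>\<omega>. cmod (E \<omega>))"
      by (rule integrable_const_bound[where B = "real n + G"]) (simp_all add: Eb)
    have "(cmod (E \<omega>))\<^sup>2 \<le> (real n + G)\<^sup>2" for \<omega>
      using Eb by (intro power_mono) auto
    then have i2: "integrable P (\<lambda>\<omega>. (cmod (E \<omega>))\<^sup>2)"
      by (intro integrable_const_bound[where B = "(real n + G)\<^sup>2"]) simp_all
    have "complex_of_real (\<integral>\<omega>. (cmod (E \<omega>))\<^sup>2 \<partial>P) = (\<integral>\<omega>. E \<omega> * cnj (E \<omega>) \<partial>P)"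
      unfolding integral_complex_of_real[symmetric] complex_norm_square ..
    then have "(\<integral>\<omega>. (cmod (E \<omega>))\<^sup>2 \<partial>P) \<le> cmod (\<integral>\<omega>. E \<omega> * cnj (E \<omega>) \<partial>P)"
      by (metis abs_ge_self norm_of_real)
    also have "\<dots> \<le> K * (1 / real n + of_bool (j = j) + of_bool (j + j = n))"
      unfolding E_def by (rule cov[OF j j])
    also have "\<dots> \<le> K * 3"
    proof (rule mult_left_mono[OF _ K0])
      have "n \<ge> 1" using j by auto
      then have "1 / real n \<le> 1" by simp
      then show "1 / real n + of_bool (j = j) + of_bool (j + j = n) \<le> 3" by simp
    qed
    finally have sq: "(\<integral>\<omega>. (cmod (E \<omega>))\<^sup>2 \<partial>P) \<le> K * 3" .
    have "(\<integral>\<omega>. cmod (E \<omega>) \<partial>P) \<le> (\<integral>\<omega>. 1 + (cmod (E \<omega>))\<^sup>2 \<partial>P)"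
    proof (rule integral_mono[OF i1])
      show "integrable P (\<lambda>\<omega>. 1 + (cmod (E \<omega>))\<^sup>2)" using i2 by simp
      show "cmod (E \<omega>) \<le> 1 + (cmod (E \<omega>))\<^sup>2" for \<omega>
      proof -
        have "2 * cmod (E \<omega>) \<le> (cmod (E \<omega>))\<^sup>2 + 1"
          using zero_le_power2[of "cmod (E \<omega>) - 1"] by (simp add: power2_diff)
        then show ?thesis using norm_ge_zero[of "E \<omega>"] by linarith
      qed
    qed
    also have "\<dots> = 1 + (\<integral>\<omega>. (cmod (E \<omega>))\<^sup>2 \<partial>P)" using i2 by (simp add: prob_space)
    finally show ?thesis using sq unfolding E_def by simp
  qed
  have "K1 \<ge> 0" using K0 by (simp add: K1_def)
  show thesis
  proof (rule that[of "max K1 (1 + 3 * K)", folded e_def])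
    show "0 \<le> max K1 (1 + 3 * K)" using \<open>K1 \<ge> 0\<close> by simp
    show "(\<integral>\<omega>. cmod (e n (fourier_freq n j) u v \<omega>) \<partial>P) \<le> max K1 (1 + 3 * K)" if "j \<in> {1..n - 1}" for n j u v
      using first[OF that, of u v] by simp
    fix n m :: nat and L B :: real and a :: "real \<Rightarrow> real \<Rightarrow> real \<Rightarrow> complex"
    assume *: "m \<ge> 1" "\<And>w u v. w \<in> {0..2 * pi} \<Longrightarrow> (u, v) \<in> {-L..L} \<times> {-L..L} \<Longrightarrow> cmod (a w u v) \<le> B" "n \<ge> 1" "L > 0"
    have "(\<integral>\<omega>. (grid_sum L m n (\<lambda>w u v. Re (e n w u v \<omega> * cnj (a w u v))))\<^sup>2 \<partial>P) \<le> K1 * (L ^ 4 * B\<^sup>2) / real n"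
      by (rule second) fact+
    also have "\<dots> \<le> max K1 (1 + 3 * K) * (L ^ 4 * B\<^sup>2) / real n"
      by (intro divide_right_mono mult_right_mono) auto
    finally show "(\<integral>\<omega>. (grid_sum L m n (\<lambda>w u v. Re (e n w u v \<omega> * cnj (a w u v))))\<^sup>2 \<partial>P) \<le> max K1 (1 + 3 * K) * (L ^ 4 * B\<^sup>2) / real n" .
  qed
qed

end

lemma (in prob_space) prob_le_of_second_moment:
  fixes X :: "'a \<Rightarrow> real"
  assumes [measurable]: "X \<in> borel_measurable M" and bnd: "\<And>\<omega>. \<bar>X \<omega>\<bar> \<le> Q"
    and "c > 0" and sq: "(\<integral>\<omega>. (X \<omega>)\<^sup>2 \<partial>M) \<le> V"
  shows "prob {\<omega> \<in> space M. c < \<bar>X \<omega>\<bar>} \<le> V / c\<^sup>2"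
proof -
  have "(X \<omega>)\<^sup>2 \<le> Q\<^sup>2" for \<omega>
    using power_mono[OF bnd abs_ge_zero, where n = 2] by simp
  then have int: "integrable M (\<lambda>\<omega>. (X \<omega>)\<^sup>2)"
    by (intro integrable_const_bound[where B = "Q\<^sup>2"]) simp_all
  have "prob {\<omega> \<in> space M. c < \<bar>X \<omega>\<bar>} \<le> prob {\<omega> \<in> space M. c\<^sup>2 \<le> (X \<omega>)\<^sup>2}"
  proof (rule finite_measure_mono)
    show "{\<omega> \<in> space M. c < \<bar>X \<omega>\<bar>} \<subseteq> {\<omega> \<in> space M. c\<^sup>2 \<le> (X \<omega>)\<^sup>2}"
    proof safe
      fix \<omega> assume "c < \<bar>X \<omega>\<bar>"
      then have "c\<^sup>2 \<le> \<bar>X \<omega>\<bar>\<^sup>2" using \<open>c > 0\<close> by (intro power_mono) simp_all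
      then show "c\<^sup>2 \<le> (X \<omega>)\<^sup>2" by (simp only: power2_abs)
    qed
  qed measurable
  also have "\<dots> \<le> (\<integral>\<omega>. (X \<omega>)\<^sup>2 \<partial>M) / c\<^sup>2"
    using int \<open>c > 0\<close> by (intro integral_Markov_inequality_measure[where A = "{}"]) auto
  also have "\<dots> \<le> V / c\<^sup>2" using sq by (intro divide_right_mono) auto
  finally show ?thesis .
qed

lemma grid_sum_measurable:
  assumes "\<And>w u v. g w u v \<in> borel_measurable M"
  shows "(\<lambda>\<omega>. grid_sum L m n (\<lambda>w u v. g w u v \<omega>)) \<in> borel_measurable M"
  unfolding grid_sum_def by (intro borel_measurable_times borel_measurable_const borel_measurable_sum assms)

lemma integral_grid_sum_le:
  fixes g :: "real \<Rightarrow> real \<Rightarrow> real \<Rightarrow> 'a \<Rightarrow> real"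
  assumes "\<And>w u v. integrable M (g w u v)"
    and "\<And>j u v. j \<in> {1..n - 1} \<Longrightarrow> (\<integral>\<omega>. g (fourier_freq n j) u v \<omega> \<partial>M) \<le> h u v"
  shows "(\<integral>\<omega>. grid_sum L m n (\<lambda>w u v. g w u v \<omega>) \<partial>M) \<le> grid_sum L m n (\<lambda>w u v. h u v)"
proof -
  have "(\<integral>\<omega>. grid_sum L m n (\<lambda>w u v. g w u v \<omega>) \<partial>M) = grid_sum L m n (\<lambda>w u v. \<integral>\<omega>. g w u v \<omega> \<partial>M)"
    unfolding grid_sum_def using assms(1)
    by (simp add: Bochner_Integration.integral_sum Bochner_Integration.integrable_sum)
  also have "\<dots> \<le> grid_sum L m n (\<lambda>w u v. h u v)"
    unfolding grid_sum_def by (intro mult_left_mono sum_mono assms(2)) simp_all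
  finally show ?thesis .
qed

section \<open>Oscillation of the criterion in the parameter\<close>

lemma emp_divergence_eq_grid_sum:
  "emp_divergence L m n I g = grid_sum L m n (\<lambda>w u v. (cmod (I w u v - g w u v))\<^sup>2)"
  unfolding emp_divergence_def grid_sum_def ..

lemma UBPH_imp_PH:
  assumes "UBPH L \<Theta> F S \<tau> \<alpha> \<beta> \<gamma>" and "\<theta> \<in> \<Theta>"
  shows "PH L (F \<theta>) S \<tau> \<alpha> \<beta>"
proof -
  obtain C where "C > 0" and C: "\<forall>\<epsilon>>0. \<forall>\<theta>\<in>\<Theta>. \<forall>\<theta>'\<in>\<Theta>. \<forall>w\<in>{0..2 * pi}. \<forall>w'\<in>{0..2 * pi}.
        \<forall>(u, v) \<in> {-L..L} \<times> {-L..L} - S_nbhd L S \<epsilon>.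
        \<forall>(u', v') \<in> {-L..L} \<times> {-L..L} - S_nbhd L S \<epsilon>.
          cmod (F \<theta> w u v - F \<theta>' w' u' v') \<le>
            C * \<epsilon> powr (- \<tau>) *
              (\<bar>w - w'\<bar> powr \<alpha> + norm ((u, v) - (u', v')) powr \<beta> + norm (\<theta> - \<theta>') powr \<gamma>)"
    using assms(1) unfolding UBPH_def by (elim exE conjE) (rule that)
  have zero: "norm (\<theta> - \<theta>) powr \<gamma> = 0" by simp
  show ?thesis
    unfolding PH_def
  proof (intro exI[of _ C] conjI allI impI)
    show "C > 0" by fact
  qed (rule bspec[OF bspec[OF C[THEN spec, THEN mp] assms(2)] assms(2), unfolded zero add_0_right])
qed

lemma UBPH_bounded:
  assumes "UBPH L \<Theta> F S \<tau> \<alpha> \<beta> \<gamma>"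
  obtains C where "C > 0"
    and "\<And>\<theta> w u v. \<theta> \<in> \<Theta> \<Longrightarrow> w \<in> {0..2 * pi} \<Longrightarrow> (u, v) \<in> {-L..L} \<times> {-L..L} \<Longrightarrow> cmod (F \<theta> w u v) \<le> C"
proof -
  obtain C where "C > 0" and C: "\<forall>\<theta>\<in>\<Theta>. \<forall>w\<in>{0..2 * pi}. \<forall>u\<in>{-L..L}. \<forall>v\<in>{-L..L}. cmod (F \<theta> w u v) \<le> C"
    using assms unfolding UBPH_def by (elim exE conjE) (rule that)
  then show thesis by (intro that[of C]) auto
qed

text \<open>
  The bound \<open>h\<close> does not depend on the frequency or on the two parameters: \<open>2C\<close> near \<open>S\<close> and
  \<open>C \<epsilon>\<^sup>-\<^sup>\<tau> \<delta>\<^sup>\<gamma>\<close> elsewhere. Its grid average is made small by choosing first \<open>\<epsilon>\<close>, so that the neighbourhood of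
  \<open>S\<close> carries little mass, and then \<open>\<delta>\<close>.
\<close>

lemma UBPH_grid_modulus:
  fixes F :: "'p::real_normed_vector \<Rightarrow> real \<Rightarrow> real \<Rightarrow> real \<Rightarrow> complex"
  assumes UBPH: "UBPH L \<Theta> F S \<tau> \<alpha> \<beta> \<gamma>" and "\<gamma> > 0" and S: "admissible_set L S"
    and L: "L > 0" and M: "filterlim M at_top sequentially" and "\<kappa> > 0"
  obtains \<delta> and h :: "real \<Rightarrow> real \<Rightarrow> real" where "\<delta> > 0" "\<And>u v. h u v \<ge> 0"
    and "\<And>\<theta> \<theta>' w u v. \<theta> \<in> \<Theta> \<Longrightarrow> \<theta>' \<in> \<Theta> \<Longrightarrow> dist \<theta> \<theta>' < \<delta> \<Longrightarrow> w \<in> {0..2 * pi} \<Longrightarrow>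
        (u, v) \<in> {-L..L} \<times> {-L..L} \<Longrightarrow> cmod (F \<theta> w u v - F \<theta>' w u v) \<le> h u v"
    and "\<forall>\<^sub>F n in sequentially. grid_sum L (M n) n (\<lambda>w u v. h u v) \<le> \<kappa>"
proof -
  obtain C where "C > 0" and bnd: "\<forall>\<theta>\<in>\<Theta>. \<forall>w\<in>{0..2 * pi}. \<forall>u\<in>{-L..L}. \<forall>v\<in>{-L..L}. cmod (F \<theta> w u v) \<le> C"
    and C: "\<forall>\<epsilon>>0. \<forall>\<theta>\<in>\<Theta>. \<forall>\<theta>'\<in>\<Theta>. \<forall>w\<in>{0..2 * pi}. \<forall>w'\<in>{0..2 * pi}.
        \<forall>(u, v) \<in> {-L..L} \<times> {-L..L} - S_nbhd L S \<epsilon>.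
        \<forall>(u', v') \<in> {-L..L} \<times> {-L..L} - S_nbhd L S \<epsilon>.
          cmod (F \<theta> w u v - F \<theta>' w' u' v') \<le>
            C * \<epsilon> powr (- \<tau>) *
              (\<bar>w - w'\<bar> powr \<alpha> + norm ((u, v) - (u', v')) powr \<beta> + norm (\<theta> - \<theta>') powr \<gamma>)"
    using UBPH unfolding UBPH_def by (elim exE conjE) (rule that)
  have "\<forall>\<^sub>F \<epsilon> in at_right 0. measure lborel (S_nbhd L S \<epsilon>) < \<kappa> / (8 * pi * C)"
    using measure_S_nbhd_tendsto_0[OF S] by (rule order_tendstoD(2)) (use \<open>\<kappa> > 0\<close> \<open>C > 0\<close> in simp)
  then obtain e where "e > 0" and e: "\<forall>\<epsilon>>0. \<epsilon> < e \<longrightarrow> measure lborel (S_nbhd L S \<epsilon>) < \<kappa> / (8 * pi * C)"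
    unfolding eventually_at_right_field by blast
  define \<epsilon> where "\<epsilon> = e / 4"
  have "\<epsilon> > 0" using \<open>e > 0\<close> by (simp add: \<epsilon>_def)
  have small: "measure lborel (S_nbhd L S (2 * \<epsilon>)) < \<kappa> / (8 * pi * C)"
    using e \<open>e > 0\<close> by (simp add: \<epsilon>_def)
  define c where "c = C * \<epsilon> powr (- \<tau>)"
  have "c > 0" using \<open>C > 0\<close> \<open>\<epsilon> > 0\<close> by (simp add: c_def)
  \<comment> \<open>Chosen such that the constant \<open>c \<delta>\<^sup>\<gamma>\<close> contributes at most \<open>\<kappa>/2\<close> to the grid average; the factor
  \<open>8\<pi>L\<^sup>2\<close> is the volume of the box.\<close>
  define \<delta> where "\<delta> = (\<kappa> / (2 * (8 * pi * L\<^sup>2 * c))) powr (1 / \<gamma>)"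
  have base: "\<kappa> / (2 * (8 * pi * L\<^sup>2 * c)) > 0" using \<open>\<kappa> > 0\<close> \<open>c > 0\<close> L by simp
  have "\<delta> > 0"
    unfolding \<delta>_def by (rule powr_gt_zero[THEN iffD2, OF less_imp_neq[OF base, symmetric]])
  have \<delta>_powr: "\<delta> powr \<gamma> = \<kappa> / (2 * (8 * pi * L\<^sup>2 * c))"
  proof -
    have "1 / \<gamma> * \<gamma> = 1" using \<open>\<gamma> > 0\<close> by simp
    then show ?thesis unfolding \<delta>_def powr_powr using powr_one[OF less_imp_le[OF base]] by (simp only:)
  qed
  define h where "h u v = 2 * C * indicat_real (S_nbhd L S \<epsilon>) (u, v) + c * \<delta> powr \<gamma>" for u v
  show thesis
  proof (rule that[of \<delta> h])
    show "\<delta> > 0" by fact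
    show "h u v \<ge> 0" for u v using \<open>C > 0\<close> \<open>c > 0\<close> by (simp add: h_def)
    fix \<theta> \<theta>' w u v
    assume *: "\<theta> \<in> \<Theta>" "\<theta>' \<in> \<Theta>" "dist \<theta> \<theta>' < \<delta>" "w \<in> {0..2 * pi}" "(u, v) \<in> {-L..L} \<times> {-L..L}"
    show "cmod (F \<theta> w u v - F \<theta>' w u v) \<le> h u v"
    proof (cases "(u, v) \<in> S_nbhd L S \<epsilon>")
      case True
      have "cmod (F \<theta> w u v) \<le> C" "cmod (F \<theta>' w u v) \<le> C"
        using bnd * by auto
      then have "cmod (F \<theta> w u v - F \<theta>' w u v) \<le> 2 * C"
        using norm_triangle_ineq4[of "F \<theta> w u v" "F \<theta>' w u v"] by linarith
      moreover have "c * \<delta> powr \<gamma> \<ge> 0" using \<open>c > 0\<close> by simp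
      ultimately show ?thesis using True by (simp add: h_def)
    next
      case False
      then have out: "(u, v) \<in> {-L..L} \<times> {-L..L} - S_nbhd L S \<epsilon>" using *(5) by blast
      have "norm (\<theta> - \<theta>') powr \<gamma> \<le> \<delta> powr \<gamma>"
        using *(3) \<open>\<gamma> > 0\<close> by (intro powr_mono2) (auto simp: dist_norm)
      have "cmod (F \<theta> w u v - F \<theta>' w u v) \<le> c * norm (\<theta> - \<theta>') powr \<gamma>"
        using bspec[OF bspec[OF bspec[OF bspec[OF bspec[OF bspec[OF C[THEN spec, THEN mp, OF \<open>\<epsilon> > 0\<close>] *(1)] *(2)] *(4)] *(4)] out, unfolded prod.case] out]
        by (simp add: c_def)
      also have "\<dots> \<le> c * \<delta> powr \<gamma>" using \<open>c > 0\<close> \<open>norm (\<theta> - \<theta>') powr \<gamma> \<le> \<delta> powr \<gamma>\<close> by (simp add: mult_left_mono)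
      finally show ?thesis using False by (simp add: h_def)
    qed
  next
    have "(\<lambda>n. 4 * L / real (M n)) \<longlonglongrightarrow> 0"
      by (intro tendsto_divide_0[OF tendsto_const] filterlim_at_top_imp_at_infinity
          filterlim_compose[OF filterlim_real_sequentially M])
    then have "\<forall>\<^sub>F n in sequentially. 4 * L / real (M n) < \<epsilon>"
      by (rule order_tendstoD(2)) (rule \<open>\<epsilon> > 0\<close>)
    then show "\<forall>\<^sub>F n in sequentially. grid_sum L (M n) n (\<lambda>w u v. h u v) \<le> \<kappa>"
    proof (rule eventually_mono)
      fix n assume n: "4 * L / real (M n) < \<epsilon>"
      have "grid_sum L (M n) n (\<lambda>w u v. h u v) =
          2 * C * grid_sum L (M n) n (\<lambda>w u v. indicat_real (S_nbhd L S \<epsilon>) (u, v)) + grid_sum L (M n) n (\<lambda>w u v. c * \<delta> powr \<gamma>)"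
        unfolding h_def grid_sum_add grid_sum_cmult ..
      also have "\<dots> \<le> 2 * C * (2 * pi * measure lborel (S_nbhd L S (2 * \<epsilon>))) + 8 * pi * L\<^sup>2 * (c * \<delta> powr \<gamma>)"
        using \<open>C > 0\<close> \<open>c > 0\<close> n by (intro add_mono mult_left_mono grid_sum_S_nbhd_le[OF L] grid_sum_const_le) auto
      also have "2 * C * (2 * pi * measure lborel (S_nbhd L S (2 * \<epsilon>))) \<le> 2 * C * (2 * pi * (\<kappa> / (8 * pi * C)))"
        using small \<open>C > 0\<close> by (intro mult_left_mono) auto
      also have "2 * C * (2 * pi * (\<kappa> / (8 * pi * C))) = \<kappa> / 2" using \<open>C > 0\<close> by simp
      also have "8 * pi * L\<^sup>2 * (c * \<delta> powr \<gamma>) = \<kappa> / 2"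
        unfolding \<delta>_powr using \<open>c > 0\<close> L by simp
      finally show "grid_sum L (M n) n (\<lambda>w u v. h u v) \<le> \<kappa>" by simp
    qed
  qed
qed

text \<open>
  The factorisation \<open>x\<^sup>2 - y\<^sup>2 = (x + y)(x - y)\<close>; measuring the first factor from \<open>f\<close> bounds the oscillation
  of the criterion by the error \<open>z - f\<close>, of which only the expectation is controlled.
\<close>

lemma square_distance_diff_le:
  fixes z a b f :: complex
  assumes "cmod (f - a) \<le> B" "cmod (f - b) \<le> B" "cmod (a - b) \<le> h"
  shows "\<bar>(cmod (z - a))\<^sup>2 - (cmod (z - b))\<^sup>2\<bar> \<le> (2 * cmod (z - f) + 2 * B) * h"
proof -
  have "cmod (z - a) \<le> cmod (z - f) + B" "cmod (z - b) \<le> cmod (z - f) + B"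
    using norm_triangle_ineq[of "z - f" "f - a"] norm_triangle_ineq[of "z - f" "f - b"] assms by simp_all
  then have sum: "cmod (z - a) + cmod (z - b) \<le> 2 * cmod (z - f) + 2 * B" by simp
  have diff: "\<bar>cmod (z - a) - cmod (z - b)\<bar> \<le> h"
    using norm_triangle_ineq3[of "z - a" "z - b"] assms(3) by (simp add: norm_minus_commute)
  have "\<bar>(cmod (z - a))\<^sup>2 - (cmod (z - b))\<^sup>2\<bar> = (cmod (z - a) + cmod (z - b)) * \<bar>cmod (z - a) - cmod (z - b)\<bar>"
    by (simp add: power2_eq_square square_diff_square_factored abs_mult)
  also have "\<dots> \<le> (2 * cmod (z - f) + 2 * B) * h"
  proof (rule mult_mono[OF sum diff])
    show "0 \<le> 2 * cmod (z - f) + 2 * B"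
      using sum norm_ge_zero[of "z - a"] norm_ge_zero[of "z - b"] by linarith
  qed simp
  finally show ?thesis .
qed

text \<open>
  With \<open>z\<close> a periodogram ordinate, \<open>f\<close> the true and \<open>a\<close> a candidate spectrum: the right-hand side is the
  contrast that the estimator minimises.
\<close>

lemma square_distance_expand:
  fixes z f a :: complex
  shows "(cmod (z - a))\<^sup>2 - (cmod (z - f))\<^sup>2 = (cmod (f - a))\<^sup>2 + 2 * Re ((z - f) * cnj (f - a))"
  by (simp only: cmod_power2) (simp add: power2_eq_square algebra_simps)

lemma abs_grid_sum_le:
  assumes "L > 0"
    and "\<And>w u v. w \<in> {0..2 * pi} \<Longrightarrow> (u, v) \<in> {-L..L} \<times> {-L..L} \<Longrightarrow> \<bar>g w u v\<bar> \<le> h w u v"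
  shows "\<bar>grid_sum L m n g\<bar> \<le> grid_sum L m n h"
proof -
  have "grid_sum L m n g \<le> grid_sum L m n h"
    by (rule grid_sum_mono[OF assms(1)]) (use assms(2) in \<open>force dest: abs_le_D1\<close>)
  moreover have "grid_sum L m n (\<lambda>w u v. -1 * g w u v) \<le> grid_sum L m n h"
    by (rule grid_sum_mono[OF assms(1)]) (use assms(2) in \<open>force dest: abs_le_D2\<close>)
  ultimately show ?thesis unfolding grid_sum_cmult by simp
qed

section \<open>Consistency of minimisers of a random criterion\<close>

text \<open>
  Away from \<open>\<theta>\<^sub>0\<close> the limit criterion exceeds its minimum by some \<open>5\<kappa>\<close>, by compactness. A finite net transfers
  the pointwise convergence at its points to the estimator: one \<open>\<kappa>\<close> is spent on the oscillation of \<open>A\<close>, one on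
  that of \<open>a\<close>, and one each on the convergence at the net point and at \<open>\<theta>\<^sub>0\<close>. The oscillation of \<open>A\<close> is bounded
  through random variables \<open>R n\<close> because a supremum over \<open>\<theta>\<close> need not be measurable.
\<close>

lemma (in prob_space) argmin_consistent:
  fixes A :: "nat \<Rightarrow> 'p::metric_space \<Rightarrow> 'a \<Rightarrow> real" and a :: "'p \<Rightarrow> real"
  assumes "compact \<Theta>" and cont: "continuous_on \<Theta> a" and \<theta>\<^sub>0: "\<theta>\<^sub>0 \<in> \<Theta>"
    and strict: "\<And>\<theta>. \<theta> \<in> \<Theta> \<Longrightarrow> \<theta> \<noteq> \<theta>\<^sub>0 \<Longrightarrow> a \<theta>\<^sub>0 < a \<theta>"
    and meas: "\<And>n \<theta>. \<theta> \<in> \<Theta> \<Longrightarrow> A n \<theta> \<in> borel_measurable M"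
    and ptw: "\<And>\<theta> \<kappa>. \<theta> \<in> \<Theta> \<Longrightarrow> \<kappa> > 0 \<Longrightarrow> (\<lambda>n. prob {\<omega> \<in> space M. \<kappa> < \<bar>A n \<theta> \<omega> - a \<theta>\<bar>}) \<longlonglongrightarrow> 0"
    and osc: "\<And>\<kappa> \<rho>. \<kappa> > 0 \<Longrightarrow> \<rho> > 0 \<Longrightarrow> \<exists>\<delta>>0. \<exists>R. (\<forall>n. R n \<in> borel_measurable M) \<and>
        (\<forall>\<^sub>F n in sequentially. prob {\<omega> \<in> space M. \<kappa> < R n \<omega>} \<le> \<rho>) \<and>
        (\<forall>n\<ge>1. \<forall>\<omega>\<in>space M. \<forall>\<theta>\<in>\<Theta>. \<forall>\<theta>'\<in>\<Theta>. dist \<theta> \<theta>' < \<delta> \<longrightarrow> \<bar>A n \<theta> \<omega> - A n \<theta>' \<omega>\<bar> \<le> R n \<omega>)"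
    and est: "\<And>n \<omega>. n \<ge> 1 \<Longrightarrow> \<omega> \<in> space M \<Longrightarrow> est n \<omega> \<in> \<Theta> \<and> A n (est n \<omega>) \<omega> \<le> A n \<theta>\<^sub>0 \<omega>"
  shows "converges_in_probability M est \<theta>\<^sub>0"
  unfolding converges_in_probability_def
proof (intro allI impI)
  fix \<eta> :: real assume "\<eta> > 0"
  define far where "far = \<Theta> - ball \<theta>\<^sub>0 \<eta>"
  have "compact far" unfolding far_def using \<open>compact \<Theta>\<close> open_ball by (rule compact_diff)
  obtain \<kappa> where "\<kappa> > 0" and gap: "\<And>\<theta>. \<theta> \<in> far \<Longrightarrow> a \<theta>\<^sub>0 + 5 * \<kappa> \<le> a \<theta>"
  proof (cases "far = {}")
    case True
    then show thesis using that[of 1] by simp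
  next
    case False
    have "continuous_on far a" using cont by (rule continuous_on_subset) (auto simp: far_def)
    then obtain m where m: "m \<in> far" "\<And>\<theta>. \<theta> \<in> far \<Longrightarrow> a m \<le> a \<theta>"
      using continuous_attains_inf[OF \<open>compact far\<close> False] by blast
    have "a \<theta>\<^sub>0 < a m" using m(1) \<open>\<eta> > 0\<close> by (intro strict) (auto simp: far_def)
    show thesis
    proof (rule that[of "(a m - a \<theta>\<^sub>0) / 5"])
      fix \<theta> assume "\<theta> \<in> far"
      from m(2)[OF this] show "a \<theta>\<^sub>0 + 5 * ((a m - a \<theta>\<^sub>0) / 5) \<le> a \<theta>" by (simp add: field_simps)
    qed (use \<open>a \<theta>\<^sub>0 < a m\<close> in simp)
  qed
  show "(\<lambda>n. prob {\<omega> \<in> space M. \<eta> < dist (est n \<omega>) \<theta>\<^sub>0}) \<longlonglongrightarrow> 0"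
  proof (rule tendstoI)
    fix \<rho> :: real assume "\<rho> > 0"
    have "\<rho> / 2 > 0" using \<open>\<rho> > 0\<close> by simp
    from osc[OF \<open>\<kappa> > 0\<close> this] obtain \<delta> R where "\<delta> > 0" and R_meas: "\<forall>n. R n \<in> borel_measurable M"
      and R_prob: "\<forall>\<^sub>F n in sequentially. prob {\<omega> \<in> space M. \<kappa> < R n \<omega>} \<le> \<rho> / 2"
      and R: "\<forall>n\<ge>1. \<forall>\<omega>\<in>space M. \<forall>\<theta>\<in>\<Theta>. \<forall>\<theta>'\<in>\<Theta>. dist \<theta> \<theta>' < \<delta> \<longrightarrow> \<bar>A n \<theta> \<omega> - A n \<theta>' \<omega>\<bar> \<le> R n \<omega>"
      by (elim exE conjE) (rule that)
    obtain d where "d > 0" and d: "\<And>\<theta> \<theta>'. \<theta> \<in> \<Theta> \<Longrightarrow> \<theta>' \<in> \<Theta> \<Longrightarrow> dist \<theta>' \<theta> < d \<Longrightarrow> dist (a \<theta>') (a \<theta>) < \<kappa>"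
      using compact_uniformly_continuous[OF cont \<open>compact \<Theta>\<close>] \<open>\<kappa> > 0\<close> unfolding uniformly_continuous_on_def by blast
    have cover: "\<Theta> \<subseteq> (\<Union>\<theta>\<in>\<Theta>. ball \<theta> (min \<delta> d))"
    proof
      fix \<theta> assume "\<theta> \<in> \<Theta>"
      moreover have "\<theta> \<in> ball \<theta> (min \<delta> d)" using \<open>\<delta> > 0\<close> \<open>d > 0\<close> by (simp only: centre_in_ball min_less_iff_conj)
      ultimately show "\<theta> \<in> (\<Union>\<theta>\<in>\<Theta>. ball \<theta> (min \<delta> d))" by (rule UN_I)
    qed
    obtain net where net: "finite net" "net \<subseteq> \<Theta>" "\<Theta> \<subseteq> (\<Union>\<theta>\<in>net. ball \<theta> (min \<delta> d))"
      by (rule compactE_image[OF \<open>compact \<Theta>\<close> open_ball cover]) (rule that)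
    define N where "N = insert \<theta>\<^sub>0 net"
    have N: "finite N" "N \<subseteq> \<Theta>" using net \<theta>\<^sub>0 by (auto simp: N_def)
    define bad where "bad n \<theta> = {\<omega> \<in> space M. \<kappa> < \<bar>A n \<theta> \<omega> - a \<theta>\<bar>}" for n \<theta>
    define badR where "badR n = {\<omega> \<in> space M. \<kappa> < R n \<omega>}" for n
    have bad_meas: "bad n \<theta> \<in> sets M" if "\<theta> \<in> N" for n \<theta>
    proof -
      have [measurable]: "A n \<theta> \<in> borel_measurable M" using meas that N by blast
      show ?thesis unfolding bad_def by measurable
    qed
    have badR_meas: "badR n \<in> sets M" for n
    proof -
      have [measurable]: "R n \<in> borel_measurable M" using R_meas by blast
      show ?thesis unfolding badR_def by measurable
    qed
    have sub: "{\<omega> \<in> space M. \<eta> < dist (est n \<omega>) \<theta>\<^sub>0} \<subseteq> (\<Union>\<theta>\<in>N. bad n \<theta>) \<union> badR n" if "n \<ge> 1" for n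
    proof (rule subsetI, rule ccontr)
      fix \<omega> assume "\<omega> \<in> {\<omega> \<in> space M. \<eta> < dist (est n \<omega>) \<theta>\<^sub>0}"
      then have \<omega>: "\<omega> \<in> space M" and dist: "\<eta> < dist (est n \<omega>) \<theta>\<^sub>0" by auto
      assume good: "\<omega> \<notin> (\<Union>\<theta>\<in>N. bad n \<theta>) \<union> badR n"
      define t where "t = est n \<omega>"
      have t: "t \<in> \<Theta>" "A n t \<omega> \<le> A n \<theta>\<^sub>0 \<omega>" using est[OF that \<omega>] by (auto simp: t_def)
      have "t \<in> far" using t dist by (auto simp: far_def t_def dist_commute)
      obtain s where s: "s \<in> net" "dist s t < min \<delta> d" using net(3) t(1) by auto
      then have "s \<in> N" "s \<in> \<Theta>" using net by (auto simp: N_def)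
      have "\<bar>A n s \<omega> - a s\<bar> \<le> \<kappa>" "\<bar>A n \<theta>\<^sub>0 \<omega> - a \<theta>\<^sub>0\<bar> \<le> \<kappa>" "R n \<omega> \<le> \<kappa>"
        using good \<omega> \<open>s \<in> N\<close> by (auto simp: bad_def badR_def N_def)
      moreover have "\<bar>A n s \<omega> - A n t \<omega>\<bar> \<le> R n \<omega>"
        using R[THEN spec, THEN mp, OF that] \<omega> \<open>s \<in> \<Theta>\<close> t(1) s(2) by simp
      moreover have "dist (a s) (a t) < \<kappa>" using s(2) by (intro d[OF t(1) \<open>s \<in> \<Theta>\<close>]) simp
      moreover have "a \<theta>\<^sub>0 + 5 * \<kappa> \<le> a t" by (rule gap) fact
      ultimately show False using t(2) \<open>\<kappa> > 0\<close> unfolding dist_real_def by linarith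
    qed
    have bound: "prob {\<omega> \<in> space M. \<eta> < dist (est n \<omega>) \<theta>\<^sub>0} \<le> (\<Sum>\<theta>\<in>N. prob (bad n \<theta>)) + prob (badR n)" if "n \<ge> 1" for n
    proof -
      have U: "(\<Union>\<theta>\<in>N. bad n \<theta>) \<in> sets M" using N bad_meas by auto
      have "prob {\<omega> \<in> space M. \<eta> < dist (est n \<omega>) \<theta>\<^sub>0} \<le> prob ((\<Union>\<theta>\<in>N. bad n \<theta>) \<union> badR n)"
        using U badR_meas by (intro finite_measure_mono sub that) auto
      also have "\<dots> \<le> prob (\<Union>\<theta>\<in>N. bad n \<theta>) + prob (badR n)"
        using U badR_meas by (rule measure_Un_le)
      also have "prob (\<Union>\<theta>\<in>N. bad n \<theta>) \<le> (\<Sum>\<theta>\<in>N. prob (bad n \<theta>))"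
        using N bad_meas by (intro finite_measure_subadditive_finite) auto
      finally show ?thesis by simp
    qed
    have "(\<lambda>n. \<Sum>\<theta>\<in>N. prob (bad n \<theta>)) \<longlonglongrightarrow> 0"
      unfolding bad_def using N ptw \<open>\<kappa> > 0\<close> by (intro tendsto_null_sum) auto
    then have "\<forall>\<^sub>F n in sequentially. (\<Sum>\<theta>\<in>N. prob (bad n \<theta>)) < \<rho> / 2"
      by (rule order_tendstoD(2)) (use \<open>\<rho> > 0\<close> in simp)
    moreover note R_prob[folded badR_def]
    moreover note eventually_ge_at_top[of 1]
    ultimately show "\<forall>\<^sub>F n in sequentially. dist (prob {\<omega> \<in> space M. \<eta> < dist (est n \<omega>) \<theta>\<^sub>0}) 0 < \<rho>"
    proof eventually_elim
      case (elim n)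
      then show ?case using bound[of n] by (simp add: dist_real_def)
    qed
  qed
qed

section \<open>Consistency of the minimum divergence estimator\<close>

theorem theorem4p1:
  fixes P :: "'a measure"
    and Z :: "int \<Rightarrow> 'a \<Rightarrow> real"
    and L :: real
    and \<Theta> :: "(real ^ 'd) set"
    and F :: "real ^ 'd \<Rightarrow> real \<Rightarrow> real \<Rightarrow> real \<Rightarrow> complex"
    and S :: "(real \<times> real) set"
    and \<tau> \<alpha> \<beta> \<gamma> \<tau>' \<alpha>' \<beta>' :: real
    and M :: "nat \<Rightarrow> nat"
    and \<theta>\<^sub>0 :: "real ^ 'd"
    and est :: "nat \<Rightarrow> 'a \<Rightarrow> real ^ 'd"
  assumes "prob_space P"
    and "strictly_stationary P Z"
    and "summable_exp_cumulants P Z"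
    and "L > 0"
    and family: "\<And>\<theta>. \<theta> \<in> \<Theta> \<Longrightarrow> is_gen_spectrum (F \<theta>)"
    and "compact \<Theta>"
    and identifiable: "\<And>\<theta> \<theta>'. \<theta> \<in> \<Theta> \<Longrightarrow> \<theta>' \<in> \<Theta> \<Longrightarrow>
          (\<forall>w\<in>{0..2 * pi}. \<forall>u\<in>{-L..L}. \<forall>v\<in>{-L..L}. F \<theta> w u v = F \<theta>' w u v) \<Longrightarrow> \<theta> = \<theta>'"
    and "admissible_set L S"
    and "\<alpha> \<in> {0<..1}" "\<beta> \<in> {0<..1}" "\<gamma> \<in> {0<..1}" "\<tau> \<ge> 0"
    and "UBPH L \<Theta> F S \<tau> \<alpha> \<beta> \<gamma>"
    and "\<alpha>' \<in> {0<..1}" "\<beta>' \<in> {0<..1}" "\<tau>' \<ge> 0"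
    and "PH L (gen_spectrum P Z) S \<tau>' \<alpha>' \<beta>'"
    and "\<And>n. n \<ge> 1 \<Longrightarrow> M n > 0"
    and "filterlim M at_top sequentially"
    and minimizer: "is_arg_min (\<lambda>\<theta>. divergence L (gen_spectrum P Z) (F \<theta>)) (\<lambda>\<theta>. \<theta> \<in> \<Theta>) \<theta>\<^sub>0"
    and unique: "\<And>\<theta>. is_arg_min (\<lambda>\<theta>. divergence L (gen_spectrum P Z) (F \<theta>)) (\<lambda>\<theta>. \<theta> \<in> \<Theta>) \<theta>
          \<Longrightarrow> \<theta> = \<theta>\<^sub>0"
    and "\<And>n. n \<ge> 1 \<Longrightarrow> est n \<in> borel_measurable P"
    and estimator: "\<And>n \<omega>. n \<ge> 1 \<Longrightarrow> \<omega> \<in> space P \<Longrightarrow>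
          is_arg_min (\<lambda>\<theta>. emp_divergence L (M n) n (periodogram Z n \<omega>) (F \<theta>)) (\<lambda>\<theta>. \<theta> \<in> \<Theta>) (est n \<omega>)"
  shows "converges_in_probability P est \<theta>\<^sub>0"
proof -
  interpret exp_cumulant_process P Z
    using assms(1-3) by (intro exp_cumulant_process.intro exp_cumulant_process_axioms.intro)
  note L = \<open>L > 0\<close> and M = \<open>filterlim M at_top sequentially\<close> and UBPH = \<open>UBPH L \<Theta> F S \<tau> \<alpha> \<beta> \<gamma>\<close>
  have closed_S: "closed S" using \<open>admissible_set L S\<close> by (simp only: admissible_set_def)
  define f where "f = gen_spectrum P Z"
  define I where "I n \<omega> = periodogram Z n \<omega>" for n \<omega>
  define a where "a \<theta> = divergence L f (F \<theta>)" for \<theta>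
  obtain G where G: "\<And>w u v. cmod (f w u v) \<le> G"
    unfolding f_def by (rule gen_spectrum_bounded) blast
  obtain C where "C > 0" and C: "\<And>\<theta> w u v. \<theta> \<in> \<Theta> \<Longrightarrow> w \<in> {0..2 * pi} \<Longrightarrow> (u, v) \<in> {-L..L} \<times> {-L..L} \<Longrightarrow> cmod (F \<theta> w u v) \<le> C"
    using UBPH_bounded[OF UBPH] by blast
  define B where "B = G + C"
  have B: "cmod (f w u v - F \<theta> w u v) \<le> B"
    if "\<theta> \<in> \<Theta>" "w \<in> {0..2 * pi}" "(u, v) \<in> {-L..L} \<times> {-L..L}" for \<theta> w u v
    unfolding B_def by (rule order_trans[OF norm_triangle_ineq4 add_mono[OF G C[OF that]]])
  have "G \<ge> 0" using G[of 0 0 0] norm_ge_zero order_trans by blast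
  then have "B \<ge> 0" using \<open>C > 0\<close> by (simp add: B_def)
  obtain K where "K \<ge> 0"
    and K2: "\<And>n m L a B. m \<ge> 1 \<Longrightarrow> (\<And>w u v. w \<in> {0..2 * pi} \<Longrightarrow> (u, v) \<in> {-L..L} \<times> {-L..L} \<Longrightarrow> cmod (a w u v) \<le> B) \<Longrightarrow> n \<ge> 1 \<Longrightarrow> L > 0 \<Longrightarrow>
      (\<integral>\<omega>. (grid_sum L m n (\<lambda>w u v. Re ((I n \<omega> w u v - f w u v) * cnj (a w u v))))\<^sup>2 \<partial>P)
        \<le> K * (L ^ 4 * B\<^sup>2) / real n"
    and K1: "\<And>n j u v. j \<in> {1..n - 1} \<Longrightarrow>
      (\<integral>\<omega>. cmod (I n \<omega> (fourier_freq n j) u v - f (fourier_freq n j) u v) \<partial>P) \<le> K"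
    unfolding I_def f_def by (rule periodogram_error_bounds) blast
  have I_meas: "(\<lambda>\<omega>. I n \<omega> w u v - f w u v) \<in> borel_measurable P" for n w u v
    unfolding I_def by (intro borel_measurable_diff periodogram_measurable borel_measurable_const)
  have I_bnd: "cmod (I n \<omega> w u v - f w u v) \<le> real n + G" for n \<omega> w u v
    unfolding I_def by (rule order_trans[OF norm_triangle_ineq4 add_mono[OF norm_periodogram_le G]])

  have f_meas: "(\<lambda>x. f (fst x) (fst (snd x)) (snd (snd x))) \<in> borel_measurable borel"
    unfolding f_def by (rule gen_spectrum_borel_measurable[OF assms(1,2) gen_cov_summable])
  have F_meas: "(\<lambda>x. F \<theta> (fst x) (fst (snd x)) (snd (snd x))) \<in> borel_measurable borel" if \<theta>: "\<theta> \<in> \<Theta>" for \<theta>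
  proof -
    obtain Q :: "(int \<Rightarrow> real) measure" and X where Q: "prob_space Q" "strictly_stationary Q X"
      "\<forall>u v. (\<lambda>l. gen_cov Q X l u v) summable_on UNIV" "F \<theta> = gen_spectrum Q X"
      using family[OF \<theta>] unfolding is_gen_spectrum_def by (elim exE conjE) (rule that)
    show ?thesis unfolding Q(4) by (rule gen_spectrum_borel_measurable[OF Q(1,2)]) (use Q(3) in blast)
  qed

  \<comment> \<open>The contrast \<open>A\<close> is the criterion minus its \<open>\<theta>\<close>-free part, split into its deterministic part \<open>det\<close> and twice the
  averaged error \<open>err\<close>.\<close>
  define det where "det n \<theta> = grid_sum L (M n) n (\<lambda>w u v. (cmod (f w u v - F \<theta> w u v))\<^sup>2)" for n \<theta>
  define err where "err n \<theta> \<omega> = grid_sum L (M n) n (\<lambda>w u v. Re ((I n \<omega> w u v - f w u v) * cnj (f w u v - F \<theta> w u v)))" for n \<theta> \<omega>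
  define A where "A n \<theta> \<omega> = det n \<theta> + 2 * err n \<theta> \<omega>" for n \<theta> \<omega>
  have A_eq: "A n \<theta> \<omega> = emp_divergence L (M n) n (I n \<omega>) (F \<theta>) - grid_sum L (M n) n (\<lambda>w u v. (cmod (I n \<omega> w u v - f w u v))\<^sup>2)" for n \<theta> \<omega>
    unfolding A_def det_def err_def emp_divergence_eq_grid_sum grid_sum_diff[symmetric] grid_sum_cmult[symmetric] grid_sum_add[symmetric]
      square_distance_expand ..

  have det_lim: "(\<lambda>n. det n \<theta>) \<longlonglongrightarrow> a \<theta>" if \<theta>: "\<theta> \<in> \<Theta>" for \<theta>
  proof -
    have sq: "(cmod (f w u v - F \<theta> w u v))\<^sup>2 \<le> B\<^sup>2" if "(w, u, v) \<in> spectral_box L" for w u v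
      using that by (intro power_mono B \<theta>) (simp_all add: spectral_box_def)
    have "(\<lambda>n. det n \<theta>) \<longlonglongrightarrow>
      (\<integral>x. indicat_real (spectral_box L) x * (cmod (f (fst x) (fst (snd x)) (snd (snd x)) - F \<theta> (fst x) (fst (snd x)) (snd (snd x))))\<^sup>2 \<partial>lborel)"
      unfolding det_def
    proof (rule grid_sum_tendsto[OF L M _ _ admissible_set_null[OF \<open>admissible_set L S\<close>]])
      show "(\<lambda>x. (cmod (f (fst x) (fst (snd x)) (snd (snd x)) - F \<theta> (fst x) (fst (snd x)) (snd (snd x))))\<^sup>2) \<in> borel_measurable borel"
        by (rule borel_measurable_power[OF measurable_compose[OF borel_measurable_diff[OF f_meas F_meas[OF \<theta>]] borel_measurable_norm]])
      show "\<bar>(cmod (f w u v - F \<theta> w u v))\<^sup>2\<bar> \<le> B\<^sup>2" if "(w, u, v) \<in> spectral_box L" for w u v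
        using sq[OF that] by simp
      fix w u v W U V
      assume *: "w \<in> {0..2 * pi}" "(u, v) \<in> {-L..L} \<times> {-L..L}" "(u, v) \<notin> S"
        "\<And>k. W k \<in> {0..2 * pi}" "\<And>k. (U k, V k) \<in> {-L..L} \<times> {-L..L}" "W \<longlonglongrightarrow> w" "U \<longlonglongrightarrow> u" "V \<longlonglongrightarrow> v"
      have "(\<lambda>k. f (W k) (U k) (V k)) \<longlonglongrightarrow> f w u v"
        unfolding f_def by (rule PH_tendsto[OF \<open>PH L (gen_spectrum P Z) S \<tau>' \<alpha>' \<beta>'\<close> _ _ closed_S *])
          (use \<open>\<alpha>' \<in> {0<..1}\<close> \<open>\<beta>' \<in> {0<..1}\<close> in simp_all)
      moreover have "(\<lambda>k. F \<theta> (W k) (U k) (V k)) \<longlonglongrightarrow> F \<theta> w u v"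
        by (rule PH_tendsto[OF UBPH_imp_PH[OF UBPH \<theta>] _ _ closed_S *])
          (use \<open>\<alpha> \<in> {0<..1}\<close> \<open>\<beta> \<in> {0<..1}\<close> in simp_all)
      ultimately show "(\<lambda>k. (cmod (f (W k) (U k) (V k) - F \<theta> (W k) (U k) (V k)))\<^sup>2) \<longlonglongrightarrow> (cmod (f w u v - F \<theta> w u v))\<^sup>2"
        by (intro tendsto_intros)
    qed
    moreover have "a \<theta> = (\<integral>x. indicat_real (spectral_box L) x * (cmod (f (fst x) (fst (snd x)) (snd (snd x)) - F \<theta> (fst x) (fst (snd x)) (snd (snd x))))\<^sup>2 \<partial>lborel)"
      unfolding a_def by (rule divergence_eq_box_integral[OF f_meas F_meas[OF \<theta>]]) (rule sq)
    ultimately show ?thesis by (simp only:)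
  qed

  have modulus: "\<exists>\<delta>>0. \<exists>h. (\<forall>u v. h u v \<ge> 0) \<and>
      (\<forall>\<theta>\<in>\<Theta>. \<forall>\<theta>'\<in>\<Theta>. dist \<theta> \<theta>' < \<delta> \<longrightarrow> (\<forall>w\<in>{0..2 * pi}. \<forall>u v. (u, v) \<in> {-L..L} \<times> {-L..L} \<longrightarrow>
         cmod (F \<theta> w u v - F \<theta>' w u v) \<le> h u v)) \<and>
      (\<forall>\<^sub>F n in sequentially. grid_sum L (M n) n (\<lambda>w u v. h u v) \<le> \<kappa>)" if "\<kappa> > 0" for \<kappa>
  proof -
    have "\<gamma> > 0" using \<open>\<gamma> \<in> {0<..1}\<close> by simp
    obtain \<delta> h where "\<delta> > 0" "\<And>u v. h u v \<ge> (0::real)"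
      "\<And>\<theta> \<theta>' w u v. \<theta> \<in> \<Theta> \<Longrightarrow> \<theta>' \<in> \<Theta> \<Longrightarrow> dist \<theta> \<theta>' < \<delta> \<Longrightarrow> w \<in> {0..2 * pi} \<Longrightarrow>
        (u, v) \<in> {-L..L} \<times> {-L..L} \<Longrightarrow> cmod (F \<theta> w u v - F \<theta>' w u v) \<le> h u v"
      "\<forall>\<^sub>F n in sequentially. grid_sum L (M n) n (\<lambda>w u v. h u v) \<le> \<kappa>"
      by (rule UBPH_grid_modulus[OF UBPH \<open>\<gamma> > 0\<close> \<open>admissible_set L S\<close> L M \<open>\<kappa> > 0\<close>]) (rule that)
    then show ?thesis by (intro exI[of _ \<delta>] exI[of _ h] conjI ballI allI impI)
  qed

  \<comment> \<open>The deterministic parts have a common modulus of continuity for large \<open>n\<close>, which their limit inherits.\<close>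
  have cont: "continuous_on \<Theta> a"
    unfolding continuous_on_iff
  proof (intro ballI allI impI)
    fix \<theta> and \<kappa> :: real assume \<theta>: "\<theta> \<in> \<Theta>" and "\<kappa> > 0"
    define \<kappa>' where "\<kappa>' = \<kappa> / (2 * B + 1)"
    have "\<kappa>' > 0" using \<open>\<kappa> > 0\<close> \<open>B \<ge> 0\<close> by (simp add: \<kappa>'_def)
    have small: "2 * B * \<kappa>' < \<kappa>" using \<open>\<kappa> > 0\<close> \<open>B \<ge> 0\<close> by (simp add: \<kappa>'_def field_simps)
    obtain \<delta> h where "\<delta> > 0" and h: "\<forall>\<theta>\<in>\<Theta>. \<forall>\<theta>'\<in>\<Theta>. dist \<theta> \<theta>' < \<delta> \<longrightarrow> (\<forall>w\<in>{0..2 * pi}. \<forall>u v. (u, v) \<in> {-L..L} \<times> {-L..L} \<longrightarrow>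
         cmod (F \<theta> w u v - F \<theta>' w u v) \<le> h u v)"
      and sum_h: "\<forall>\<^sub>F n in sequentially. grid_sum L (M n) n (\<lambda>w u v. h u v) \<le> \<kappa>'"
      using modulus[OF \<open>\<kappa>' > 0\<close>] by (elim exE conjE) (rule that)
    show "\<exists>d>0. \<forall>\<theta>'\<in>\<Theta>. dist \<theta>' \<theta> < d \<longrightarrow> dist (a \<theta>') (a \<theta>) < \<kappa>"
    proof (intro exI[of _ \<delta>] conjI ballI impI)
      fix \<theta>' assume \<theta>': "\<theta>' \<in> \<Theta>" "dist \<theta>' \<theta> < \<delta>"
      have "\<bar>det n \<theta>' - det n \<theta>\<bar> \<le> 2 * B * grid_sum L (M n) n (\<lambda>w u v. h u v)" for n
        unfolding det_def grid_sum_diff[symmetric] grid_sum_cmult[symmetric]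
      proof (rule abs_grid_sum_le[OF L])
        fix w u v assume wuv: "w \<in> {0..2 * pi}" "(u, v) \<in> {-L..L} \<times> {-L..L}"
        have "cmod (F \<theta>' w u v - F \<theta> w u v) \<le> h u v" using h \<theta> \<theta>' wuv by blast
        from square_distance_diff_le[OF B[OF \<theta>'(1) wuv] B[OF \<theta> wuv] this, of "f w u v"]
        show "\<bar>(cmod (f w u v - F \<theta>' w u v))\<^sup>2 - (cmod (f w u v - F \<theta> w u v))\<^sup>2\<bar> \<le> 2 * B * h u v"
          by simp
      qed
      then have ev: "\<forall>\<^sub>F n in sequentially. \<bar>det n \<theta>' - det n \<theta>\<bar> \<le> 2 * B * \<kappa>'"
        using sum_h by (elim eventually_mono) (use \<open>B \<ge> 0\<close> in \<open>meson mult_left_mono order_trans mult_nonneg_nonneg zero_le_numeral\<close>)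
      have lm: "(\<lambda>n. \<bar>det n \<theta>' - det n \<theta>\<bar>) \<longlonglongrightarrow> \<bar>a \<theta>' - a \<theta>\<bar>"
        by (intro tendsto_rabs tendsto_diff det_lim \<theta> \<theta>')
      have "\<bar>a \<theta>' - a \<theta>\<bar> \<le> 2 * B * \<kappa>'"
        by (rule tendsto_upperbound[OF lm ev trivial_limit_sequentially])
      then show "dist (a \<theta>') (a \<theta>) < \<kappa>" using small by (simp add: dist_real_def)
    qed (rule \<open>\<delta> > 0\<close>)
  qed

  have err_meas: "err n \<theta> \<in> borel_measurable P" for n \<theta>
  proof -
    have "(\<lambda>\<omega>. Re ((I n \<omega> w u v - f w u v) * cnj (f w u v - F \<theta> w u v))) \<in> borel_measurable P" for w u v
      by (rule measurable_compose[OF borel_measurable_times[OF I_meas borel_measurable_const]])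
        (intro borel_measurable_continuous_onI continuous_intros)
    then show ?thesis unfolding err_def by (rule grid_sum_measurable)
  qed

  show ?thesis
  proof (rule argmin_consistent[OF \<open>compact \<Theta>\<close> cont, where A = A])
    show "\<theta>\<^sub>0 \<in> \<Theta>" using minimizer by (simp add: is_arg_min_def)
    show "a \<theta>\<^sub>0 < a \<theta>" if "\<theta> \<in> \<Theta>" "\<theta> \<noteq> \<theta>\<^sub>0" for \<theta>
    proof (rule ccontr)
      assume "\<not> a \<theta>\<^sub>0 < a \<theta>"
      then have "is_arg_min (\<lambda>\<theta>. divergence L (gen_spectrum P Z) (F \<theta>)) (\<lambda>\<theta>. \<theta> \<in> \<Theta>) \<theta>"
        using minimizer that(1) unfolding is_arg_min_def a_def f_def by force
      then show False using unique that(2) by blast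
    qed
    show "A n \<theta> \<in> borel_measurable P" for n \<theta>
      unfolding A_def by (intro borel_measurable_add borel_measurable_times borel_measurable_const err_meas)
    show "est n \<omega> \<in> \<Theta> \<and> A n (est n \<omega>) \<omega> \<le> A n \<theta>\<^sub>0 \<omega>" if "n \<ge> 1" "\<omega> \<in> space P" for n \<omega>
      using estimator[OF that] minimizer unfolding is_arg_min_def A_eq I_def by force

    show "(\<lambda>n. prob {\<omega> \<in> space P. \<kappa> < \<bar>A n \<theta> \<omega> - a \<theta>\<bar>}) \<longlonglongrightarrow> 0" if \<theta>: "\<theta> \<in> \<Theta>" and "\<kappa> > 0" for \<theta> \<kappa>
    proof (rule tendsto_sandwich[OF _ _ tendsto_const])
      define V where "V = K * (L ^ 4 * B\<^sup>2) / (\<kappa> / 4)\<^sup>2"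
      show "\<forall>\<^sub>F n in sequentially. 0 \<le> prob {\<omega> \<in> space P. \<kappa> < \<bar>A n \<theta> \<omega> - a \<theta>\<bar>}" by simp
      show "(\<lambda>n. V / real n) \<longlonglongrightarrow> 0" by (rule lim_const_over_n)
      have "\<forall>\<^sub>F n in sequentially. dist (det n \<theta>) (a \<theta>) < \<kappa> / 2"
        using det_lim[OF \<theta>] \<open>\<kappa> > 0\<close> by (intro tendstoD) simp_all
      then show "\<forall>\<^sub>F n in sequentially. prob {\<omega> \<in> space P. \<kappa> < \<bar>A n \<theta> \<omega> - a \<theta>\<bar>} \<le> V / real n"
        using eventually_ge_at_top[of 1]
      proof eventually_elim
        case (elim n)
        have bnd: "\<bar>err n \<theta> \<omega>\<bar> \<le> grid_sum L (M n) n (\<lambda>w u v. (real n + G) * B)" for \<omega>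
          unfolding err_def
        proof (rule abs_grid_sum_le[OF L])
          fix w u v assume wuv: "w \<in> {0..2 * pi}" "(u, v) \<in> {-L..L} \<times> {-L..L}"
          have "\<bar>Re ((I n \<omega> w u v - f w u v) * cnj (f w u v - F \<theta> w u v))\<bar> \<le>
              cmod (I n \<omega> w u v - f w u v) * cmod (f w u v - F \<theta> w u v)"
            by (rule order_trans[OF abs_Re_le_cmod]) (simp only: norm_mult complex_mod_cnj order_refl)
          also have "\<dots> \<le> (real n + G) * B"
            using \<open>G \<ge> 0\<close> by (intro mult_mono I_bnd B \<theta> wuv) simp_all
          finally show "\<bar>Re ((I n \<omega> w u v - f w u v) * cnj (f w u v - F \<theta> w u v))\<bar> \<le> (real n + G) * B" .
        qed
        have second: "(\<integral>\<omega>. (err n \<theta> \<omega>)\<^sup>2 \<partial>P) \<le> K * (L ^ 4 * B\<^sup>2) / real n"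
          unfolding err_def using assms(18)[OF \<open>n \<ge> 1\<close>] by (intro K2 B \<theta> L \<open>n \<ge> 1\<close>) simp_all
        have "prob {\<omega> \<in> space P. \<kappa> < \<bar>A n \<theta> \<omega> - a \<theta>\<bar>} \<le> prob {\<omega> \<in> space P. \<kappa> / 4 < \<bar>err n \<theta> \<omega>\<bar>}"
        proof (rule finite_measure_mono)
          show "{\<omega> \<in> space P. \<kappa> < \<bar>A n \<theta> \<omega> - a \<theta>\<bar>} \<subseteq> {\<omega> \<in> space P. \<kappa> / 4 < \<bar>err n \<theta> \<omega>\<bar>}"
          proof safe
            fix \<omega> assume "\<kappa> < \<bar>A n \<theta> \<omega> - a \<theta>\<bar>"
            moreover have "\<bar>A n \<theta> \<omega> - a \<theta>\<bar> \<le> \<bar>det n \<theta> - a \<theta>\<bar> + 2 * \<bar>err n \<theta> \<omega>\<bar>"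
              unfolding A_def by linarith
            moreover have "\<bar>det n \<theta> - a \<theta>\<bar> < \<kappa> / 2" using elim(1) by (simp only: dist_real_def)
            ultimately show "\<kappa> / 4 < \<bar>err n \<theta> \<omega>\<bar>" by linarith
          qed
          have [measurable]: "err n \<theta> \<in> borel_measurable P" by (rule err_meas)
          show "{\<omega> \<in> space P. \<kappa> / 4 < \<bar>err n \<theta> \<omega>\<bar>} \<in> sets P" by measurable
        qed
        also have "\<dots> \<le> K * (L ^ 4 * B\<^sup>2) / real n / (\<kappa> / 4)\<^sup>2"
          by (rule prob_le_of_second_moment[OF err_meas bnd _ second]) (use \<open>\<kappa> > 0\<close> in simp)
        also have "\<dots> = V / real n" by (simp add: V_def)
        finally show ?case .
      qed
    qed

    show "\<exists>\<delta>>0. \<exists>R. (\<forall>n. R n \<in> borel_measurable P) \<and>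
        (\<forall>\<^sub>F n in sequentially. prob {\<omega> \<in> space P. \<kappa> < R n \<omega>} \<le> \<rho>) \<and>
        (\<forall>n\<ge>1. \<forall>\<omega>\<in>space P. \<forall>\<theta>\<in>\<Theta>. \<forall>\<theta>'\<in>\<Theta>. dist \<theta> \<theta>' < \<delta> \<longrightarrow> \<bar>A n \<theta> \<omega> - A n \<theta>' \<omega>\<bar> \<le> R n \<omega>)"
      if "\<kappa> > 0" "\<rho> > 0" for \<kappa> \<rho>
    proof -
      \<comment> \<open>Markov's inequality bounds the probability of \<open>R n > \<kappa>\<close> by \<open>(2K + 2B) \<kappa>' / \<kappa>\<close>, which should be at most \<open>\<rho>\<close>;
      the summand 1 keeps the denominator positive.\<close>
      define \<kappa>' where "\<kappa>' = \<kappa> * \<rho> / (2 * K + 2 * B + 1)"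
      have den: "2 * K + 2 * B + 1 > 0" using \<open>K \<ge> 0\<close> \<open>B \<ge> 0\<close> by simp
      have "\<kappa>' > 0" unfolding \<kappa>'_def by (intro divide_pos_pos mult_pos_pos that den)
      have small: "(2 * K + 2 * B) * \<kappa>' / \<kappa> \<le> \<rho>"
      proof -
        have "(2 * K + 2 * B) * \<kappa>' / \<kappa> = \<rho> * ((2 * K + 2 * B) / (2 * K + 2 * B + 1))"
          using \<open>\<kappa> > 0\<close> by (simp add: \<kappa>'_def)
        also have "\<dots> \<le> \<rho> * 1" using \<open>\<rho> > 0\<close> den by (intro mult_left_mono) simp_all
        finally show ?thesis by simp
      qed
      obtain \<delta> h where "\<delta> > 0" and h0: "\<forall>u v. h u v \<ge> 0" and h: "\<forall>\<theta>\<in>\<Theta>. \<forall>\<theta>'\<in>\<Theta>. dist \<theta> \<theta>' < \<delta> \<longrightarrow> (\<forall>w\<in>{0..2 * pi}. \<forall>u v. (u, v) \<in> {-L..L} \<times> {-L..L} \<longrightarrow>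
           cmod (F \<theta> w u v - F \<theta>' w u v) \<le> h u v)"
        and sum_h: "\<forall>\<^sub>F n in sequentially. grid_sum L (M n) n (\<lambda>w u v. h u v) \<le> \<kappa>'"
        using modulus[OF \<open>\<kappa>' > 0\<close>] by (elim exE conjE) (rule that)
      define r where "r n w u v \<omega> = (2 * cmod (I n \<omega> w u v - f w u v) + 2 * B) * h u v" for n w u v \<omega>
      define R where "R n \<omega> = grid_sum L (M n) n (\<lambda>w u v. r n w u v \<omega>)" for n \<omega>
      have nI: "integrable P (\<lambda>\<omega>. cmod (I n \<omega> w u v - f w u v))" for n w u v
        by (rule integrable_const_bound[where B = "real n + G"])
          (simp_all add: I_bnd measurable_compose[OF I_meas borel_measurable_norm])
      have r_int: "integrable P (r n w u v)" for n w u v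
        unfolding r_def using nI by simp
      have r_nonneg: "0 \<le> r n w u v \<omega>" for n w u v \<omega>
        using h0 \<open>B \<ge> 0\<close> by (simp add: r_def)
      have R_meas: "R n \<in> borel_measurable P" for n
        unfolding R_def by (rule grid_sum_measurable) (rule borel_measurable_integrable[OF r_int])
      have R_int: "integrable P (R n)" for n
        unfolding R_def grid_sum_def by (intro integrable_mult_right Bochner_Integration.integrable_sum r_int)
      have R_nonneg: "0 \<le> R n \<omega>" for n \<omega>
        unfolding R_def grid_sum_def by (intro mult_nonneg_nonneg sum_nonneg r_nonneg) simp
      have ER: "(\<integral>\<omega>. R n \<omega> \<partial>P) \<le> (2 * K + 2 * B) * grid_sum L (M n) n (\<lambda>w u v. h u v)" for n
        unfolding R_def grid_sum_cmult[symmetric]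
      proof (rule integral_grid_sum_le[OF r_int])
        fix j u v assume j: "j \<in> {1..n - 1}"
        have "(\<integral>\<omega>. r n (fourier_freq n j) u v \<omega> \<partial>P) =
            (2 * (\<integral>\<omega>. cmod (I n \<omega> (fourier_freq n j) u v - f (fourier_freq n j) u v) \<partial>P) + 2 * B) * h u v"
          unfolding r_def using nI by (simp add: prob_space)
        also have "\<dots> \<le> (2 * K + 2 * B) * h u v"
          using K1[OF j] h0 by (intro mult_right_mono) simp_all
        finally show "(\<integral>\<omega>. r n (fourier_freq n j) u v \<omega> \<partial>P) \<le> (2 * K + 2 * B) * h u v" .
      qed
      have prob_R: "\<forall>\<^sub>F n in sequentially. prob {\<omega> \<in> space P. \<kappa> < R n \<omega>} \<le> \<rho>"
        using sum_h
      proof (rule eventually_mono)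
        fix n assume n: "grid_sum L (M n) n (\<lambda>w u v. h u v) \<le> \<kappa>'"
        have "prob {\<omega> \<in> space P. \<kappa> < R n \<omega>} \<le> prob {\<omega> \<in> space P. \<kappa> \<le> R n \<omega>}"
        proof (rule finite_measure_mono)
          have [measurable]: "R n \<in> borel_measurable P" by (rule R_meas)
          show "{\<omega> \<in> space P. \<kappa> \<le> R n \<omega>} \<in> sets P" by measurable
        qed auto
        also have "\<dots> \<le> (\<integral>\<omega>. R n \<omega> \<partial>P) / \<kappa>"
          by (rule integral_Markov_inequality_measure[OF R_int sets.empty_sets]) (simp_all add: R_nonneg \<open>\<kappa> > 0\<close>)
        also have "\<dots> \<le> (2 * K + 2 * B) * \<kappa>' / \<kappa>"
          using \<open>\<kappa> > 0\<close> \<open>K \<ge> 0\<close> \<open>B \<ge> 0\<close> n by (intro divide_right_mono order_trans[OF ER] mult_left_mono) simp_all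
        also have "\<dots> \<le> \<rho>" by (rule small)
        finally show "prob {\<omega> \<in> space P. \<kappa> < R n \<omega>} \<le> \<rho>" .
      qed
      have osc: "\<bar>A n \<theta> \<omega> - A n \<theta>' \<omega>\<bar> \<le> R n \<omega>" if \<theta>: "\<theta> \<in> \<Theta>" "\<theta>' \<in> \<Theta>" "dist \<theta> \<theta>' < \<delta>" for n \<omega> \<theta> \<theta>'
      proof -
        have "A n \<theta> \<omega> - A n \<theta>' \<omega> = grid_sum L (M n) n (\<lambda>w u v. (cmod (I n \<omega> w u v - F \<theta> w u v))\<^sup>2 - (cmod (I n \<omega> w u v - F \<theta>' w u v))\<^sup>2)"
          unfolding A_eq emp_divergence_eq_grid_sum grid_sum_diff by simp
        also have "\<bar>\<dots>\<bar> \<le> R n \<omega>"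
          unfolding R_def r_def
        proof (rule abs_grid_sum_le[OF L])
          fix w u v assume wuv: "w \<in> {0..2 * pi}" "(u, v) \<in> {-L..L} \<times> {-L..L}"
          have "cmod (F \<theta> w u v - F \<theta>' w u v) \<le> h u v" using h \<theta> wuv by blast
          from square_distance_diff_le[OF B[OF \<theta>(1) wuv] B[OF \<theta>(2) wuv] this]
          show "\<bar>(cmod (I n \<omega> w u v - F \<theta> w u v))\<^sup>2 - (cmod (I n \<omega> w u v - F \<theta>' w u v))\<^sup>2\<bar>
            \<le> (2 * cmod (I n \<omega> w u v - f w u v) + 2 * B) * h u v" .
        qed
        finally show ?thesis .
      qed
      show ?thesis
        using \<open>\<delta> > 0\<close> R_meas prob_R osc by (intro exI[of _ \<delta>] exI[of _ R] conjI allI impI ballI) simp_all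
    qed
  qed
qed

end
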